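(* Let $F\in\mathcal P_A(P_{\rm avg})$. For $G\in\mathcal P_A(P_{\rm avg})$, put $F_\epsilon=(1-\epsilon)F+\epsilon G$ and $$D\mathcal I_F(G-F)=\left.\frac{d}{d\epsilon}\mathcal I(F_\epsilon)\right|_{\epsilon=0^+},$$ whenever the derivative exists. For $x\in[0,A]$ define the point-mass influence $$\psi_F(x)=\left.\frac{d}{d\epsilon}\mathcal I\bigl((1-\epsilon)F+\epsilon\delta_x\bigr)\right|_{\epsilon=0^+}.$$ Then $\psi_F$ exists and is continuous on $[0,A]$. Moreover, there is a holomorphic function $\Psi_F$ on $\Omega=\{z\in\mathbb C:\operatorname{Re}z>-\lambda_0/h_+\}$, where $h_+=\max_{0\le r\le L:\,h_r>0}h_r$, such that $\Psi_F(x)=\psi_F(x)$ for all $x\in[0,A]$, and for every $G\in\mathcal P_A(P_{\rm avg})$, $$D\mathcal I_F(G-F)=\int_{[0,A]}\psi_F(x)\,dG(x)-\int_{[0,A]}\psi_F(x)\,dF(x).$$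
   Context: Setting: $L\ge0$ an integer, $\lambda_0>0$, $h_0>0$, $h_\ell\ge0$, $\sum_{\ell=0}^L h_\ell=1$, $0\le A<\infty$, $P_{\rm avg}\ge0$; $\mathcal P_A(P_{\rm avg})$ is the set of Borel probability measures on $[0,A]$ with mean at most $P_{\rm avg}$. For any Borel probability law $F$ on $[0,A]$, the subscript $F$ refers to the stationary process with $(X_k)_{k\in\mathbb Z}$ i.i.d. of law $F$ and, given the inputs, conditionally independent $Y_k\sim\operatorname{Poisson}(Z_k)$, $Z_k=\lambda_0+\sum_{\ell=0}^L h_\ell X_{k-\ell}$. The stationary mutual information rate is $$\mathcal I(F)=\lim_{n\to\infty}\frac1n I_F(X_1^n;Y_1^n)=H_F(Y_0\mid Y_{-\infty}^{-1})-\mathbb E_F[\phi(Z_0)],$$ where $\phi(z)=z-z\log z+\sum_{m\ge0}\frac{e^{-z}z^m}{m!}\log(m!)$ is the entropy of a Poisson variable of mean $z$. Here $\mathcal I$ is defined for all Borel probability laws on $[0,A]$ (so that $(1-\epsilon)F+\epsilon\delta_x$ is allowed even if its mean exceeds $P_{\rm avg}$). Logarithms are natural; $X_i^j=(X_i,\dots,X_j)$, $Y_i^j=(Y_i,\dots,Y_j)$. *)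

theory Defs
  imports "HOL-Probability.Probability"
begin

text \<open>Input laws are Borel probability measures whose underlying space is the interval
  \<open>[0, A]\<close> itself. In particular the intensities below are positive on the whole sample space,
  which matters because \<^const>\<open>poisson_pmf\<close> is unspecified for nonpositive rates.\<close>

definition input_space :: "real \<Rightarrow> real measure" where
  "input_space A = restrict_space borel {0..A}"

definition input_laws :: "real \<Rightarrow> real measure set" where
  "input_laws A = space (prob_algebra (input_space A))"

definition constrained_laws :: "real \<Rightarrow> real \<Rightarrow> real measure set" where
  "constrained_laws A Pavg = {F \<in> input_laws A. (\<integral>x. x \<partial>F) \<le> Pavg}"

definition mixture :: "real \<Rightarrow> 'a measure \<Rightarrow> 'a measure \<Rightarrow> 'a measure" where
  "mixture \<epsilon> F G = measure_of (space F) (sets F)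
     (\<lambda>B. ennreal (1 - \<epsilon>) * emeasure F B + ennreal \<epsilon> * emeasure G B)"

definition point_mass :: "real \<Rightarrow> real \<Rightarrow> real measure" where
  "point_mass A x = return (input_space A) x"

text \<open>\<open>dark\<close> is the background rate \<open>\<lambda>\<^sub>0\<close>; only the taps \<open>h l\<close> with \<open>l \<le> L\<close> are used.\<close>

definition intensity :: "real \<Rightarrow> nat \<Rightarrow> (nat \<Rightarrow> real) \<Rightarrow> (int \<Rightarrow> real) \<Rightarrow> int \<Rightarrow> real" where
  "intensity dark L h x k = dark + (\<Sum>l\<le>L. h l * x (k - int l))"

text \<open>The conditional law of \<open>(Y\<^sub>k)\<close> given the whole input sequence \<open>x\<close>.\<close>

definition output_kernel ::
  "real \<Rightarrow> nat \<Rightarrow> (nat \<Rightarrow> real) \<Rightarrow> (int \<Rightarrow> real) \<Rightarrow> (int \<Rightarrow> nat) measure" where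
  "output_kernel dark L h x =
     (\<Pi>\<^sub>M k\<in>UNIV. measure_pmf (poisson_pmf (intensity dark L h x k)))"

definition path_space :: "real \<Rightarrow> ((int \<Rightarrow> real) \<times> (int \<Rightarrow> nat)) measure" where
  "path_space A = (\<Pi>\<^sub>M k\<in>UNIV. input_space A) \<Otimes>\<^sub>M (\<Pi>\<^sub>M k\<in>UNIV. count_space UNIV)"

text \<open>The joint law of \<open>(X\<^sub>k)\<close> and \<open>(Y\<^sub>k)\<close>.\<close>

definition process_law ::
  "real \<Rightarrow> nat \<Rightarrow> (nat \<Rightarrow> real) \<Rightarrow> real \<Rightarrow> real measure
     \<Rightarrow> ((int \<Rightarrow> real) \<times> (int \<Rightarrow> nat)) measure" where
  "process_law dark L h A F =
     (\<Pi>\<^sub>M k\<in>UNIV. F) \<bind> (\<lambda>x. distr (output_kernel dark L h x) (path_space A) (Pair x))"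

text \<open>\<open>I\<^sub>F(X\<^sub>1,\<dots>,X\<^sub>n; Y\<^sub>1,\<dots>,Y\<^sub>n)\<close> in nats. The inputs \<open>X\<^sub>k\<close> with \<open>k \<le> 0\<close>, on which the first outputs
  depend, are random with the stationary law and are not part of the block.\<close>

definition block_information ::
  "real \<Rightarrow> nat \<Rightarrow> (nat \<Rightarrow> real) \<Rightarrow> real \<Rightarrow> real measure \<Rightarrow> nat \<Rightarrow> real" where
  "block_information dark L h A F n =
     prob_space.mutual_information (process_law dark L h A F) (exp 1)
       (\<Pi>\<^sub>M k\<in>{1..int n}. input_space A) (\<Pi>\<^sub>M k\<in>{1..int n}. count_space UNIV)
       (\<lambda>\<omega>. restrict (fst \<omega>) {1..int n}) (\<lambda>\<omega>. restrict (snd \<omega>) {1..int n})"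

definition information_rate ::
  "real \<Rightarrow> nat \<Rightarrow> (nat \<Rightarrow> real) \<Rightarrow> real \<Rightarrow> real measure \<Rightarrow> real" where
  "information_rate dark L h A F = lim (\<lambda>n. block_information dark L h A F n / real n)"

text \<open>The value of the one-sided derivative at \<open>0\<close> of the rate along the segment from \<open>F\<close> to \<open>G\<close>.
  As \<^const>\<open>vector_derivative\<close> is total, existence has to be stated separately.\<close>

definition directional_derivative ::
  "real \<Rightarrow> nat \<Rightarrow> (nat \<Rightarrow> real) \<Rightarrow> real \<Rightarrow> real measure \<Rightarrow> real measure \<Rightarrow> real" where
  "directional_derivative dark L h A F G =
     vector_derivative (\<lambda>\<epsilon>. information_rate dark L h A (mixture \<epsilon> F G)) (at_right 0)"

definition directionally_differentiable ::
  "real \<Rightarrow> nat \<Rightarrow> (nat \<Rightarrow> real) \<Rightarrow> real \<Rightarrow> real measure \<Rightarrow> real measure \<Rightarrow> bool" where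
  "directionally_differentiable dark L h A F G \<longleftrightarrow>
     (\<lambda>\<epsilon>. information_rate dark L h A (mixture \<epsilon> F G)) differentiable (at_right 0)"

definition influence ::
  "real \<Rightarrow> nat \<Rightarrow> (nat \<Rightarrow> real) \<Rightarrow> real \<Rightarrow> real measure \<Rightarrow> real \<Rightarrow> real" where
  "influence dark L h A F x = directional_derivative dark L h A F (point_mass A x)"

definition max_tap :: "nat \<Rightarrow> (nat \<Rightarrow> real) \<Rightarrow> real" where
  "max_tap L h = Max {h r | r. r \<le> L \<and> h r > 0}"

text \<open>The constructions by \<^const>\<open>measure_of\<close> and \<^const>\<open>bind\<close> above are meaningful only once the
  following facts are known: countable additivity of the mixture and measurability of the
  output kernel.\<close>

lemma space_input_space: "space (input_space A) = {0..A}"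
  by (simp add: input_space_def space_restrict_space)

lemma input_lawsD:
  assumes "F \<in> input_laws A"
  shows "prob_space F" "sets F = sets (input_space A)" "space F = {0..A}"
  using assms sets_eq_imp_space_eq[of F "input_space A"]
  by (auto simp: input_laws_def space_prob_algebra space_input_space)

lemma point_mass_in_input_laws: "x \<in> {0..A} \<Longrightarrow> point_mass A x \<in> input_laws A"
  by (auto simp: input_laws_def space_prob_algebra point_mass_def space_input_space
      intro!: prob_space_return)

lemma sets_mixture [simp]: "sets (mixture \<epsilon> F G) = sets F"
  and space_mixture [simp]: "space (mixture \<epsilon> F G) = space F"
  by (simp_all add: mixture_def)

lemma emeasure_mixture:
  assumes "sets G = sets F" "B \<in> sets F"
  shows "emeasure (mixture \<epsilon> F G) B = ennreal (1 - \<epsilon>) * emeasure F B + ennreal \<epsilon> * emeasure G B"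
  unfolding mixture_def
proof (rule emeasure_measure_of_sigma)
  show "countably_additive (sets F)
      (\<lambda>B. ennreal (1 - \<epsilon>) * emeasure F B + ennreal \<epsilon> * emeasure G B)"
  proof (rule countably_additiveI)
    fix C :: "nat \<Rightarrow> 'a set"
    assume C: "range C \<subseteq> sets F" "disjoint_family C"
    have "(\<Sum>i. ennreal (1 - \<epsilon>) * emeasure F (C i) + ennreal \<epsilon> * emeasure G (C i))
        = (\<Sum>i. ennreal (1 - \<epsilon>) * emeasure F (C i)) + (\<Sum>i. ennreal \<epsilon> * emeasure G (C i))"
      by (rule suminf_add[symmetric]) simp_all
    also have "\<dots> = ennreal (1 - \<epsilon>) * emeasure F (\<Union>i. C i) + ennreal \<epsilon> * emeasure G (\<Union>i. C i)"
      using C assms(1) by (simp add: suminf_emeasure)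
    finally show "(\<Sum>i. ennreal (1 - \<epsilon>) * emeasure F (C i) + ennreal \<epsilon> * emeasure G (C i))
        = ennreal (1 - \<epsilon>) * emeasure F (\<Union>i. C i) + ennreal \<epsilon> * emeasure G (\<Union>i. C i)" .
  qed
qed (auto simp: sets.sigma_algebra_axioms positive_def assms)

lemma mixture_in_input_laws:
  assumes F: "F \<in> input_laws A" and G: "G \<in> input_laws A" and "0 \<le> \<epsilon>" "\<epsilon> \<le> 1"
  shows "mixture \<epsilon> F G \<in> input_laws A"
proof -
  interpret F: prob_space F using input_lawsD[OF F] by simp
  interpret G: prob_space G using input_lawsD[OF G] by simp
  have S: "sets G = sets F" "space G = space F"
    using input_lawsD[OF F] input_lawsD[OF G] by simp_all
  have "emeasure (mixture \<epsilon> F G) (space F)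
      = ennreal (1 - \<epsilon>) * emeasure F (space F) + ennreal \<epsilon> * emeasure G (space G)"
    using S by (simp add: emeasure_mixture)
  also have "\<dots> = 1"
    using assms(3,4) by (simp add: F.emeasure_space_1 G.emeasure_space_1 flip: ennreal_plus)
  finally have "prob_space (mixture \<epsilon> F G)" by (intro prob_spaceI) simp
  then show ?thesis
    using input_lawsD[OF F] by (simp add: input_laws_def space_prob_algebra)
qed

lemma intensity_pos:
  assumes "dark > 0" "\<And>l. l \<le> L \<Longrightarrow> h l \<ge> 0" "\<And>k. x k \<ge> 0"
  shows "intensity dark L h x k > 0"
  unfolding intensity_def using assms by (intro add_pos_nonneg sum_nonneg mult_nonneg_nonneg) auto

lemma measurable_intensity:
  "(\<lambda>x. intensity dark L h x k) \<in> borel_measurable (\<Pi>\<^sub>M k\<in>UNIV. input_space A)"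
proof -
  have [measurable]: "(\<lambda>x. x j) \<in> borel_measurable (\<Pi>\<^sub>M k\<in>UNIV. input_space A)" for j :: int
  proof -
    have "(\<lambda>x. x j) \<in> (\<Pi>\<^sub>M k\<in>UNIV. input_space A) \<rightarrow>\<^sub>M input_space A"
      by (rule measurable_component_singleton) simp
    then show ?thesis unfolding input_space_def by (simp add: measurable_restrict_space2_iff)
  qed
  show ?thesis unfolding intensity_def by measurable
qed

lemma measurable_output_kernel:
  assumes "dark > 0" "\<And>l. l \<le> L \<Longrightarrow> h l \<ge> 0"
  shows "output_kernel dark L h \<in>
    (\<Pi>\<^sub>M k\<in>UNIV. input_space A) \<rightarrow>\<^sub>M prob_algebra (\<Pi>\<^sub>M k\<in>UNIV. count_space UNIV)"
proof (rule measurable_prob_algebra_generated[OF sets_PiM Int_stable_prod_algebra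
      prod_algebra_sets_into_space])
  fix x :: "int \<Rightarrow> real"
  show "prob_space (output_kernel dark L h x)"
    unfolding output_kernel_def by (intro prob_space_PiM prob_space_measure_pmf)
  show "sets (output_kernel dark L h x) = sets (\<Pi>\<^sub>M k\<in>UNIV. count_space UNIV)"
    unfolding output_kernel_def by (intro sets_PiM_cong) simp_all
next
  let ?N = "\<Pi>\<^sub>M k\<in>(UNIV::int set). input_space A"
  fix E :: "(int \<Rightarrow> nat) set"
  assume "E \<in> prod_algebra UNIV (\<lambda>_. count_space UNIV)"
  then obtain J B where E: "E = prod_emb UNIV (\<lambda>_. count_space UNIV) J (Pi\<^sub>E J B)"
    and J: "finite J"
    by (elim prod_algebraE) auto
  have "(\<lambda>x. \<Prod>j\<in>J. emeasure (measure_pmf (poisson_pmf (intensity dark L h x j))) (B j))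
      \<in> borel_measurable ?N"
  proof (intro borel_measurable_prod_ennreal)
    fix j
    have "(\<lambda>x. emeasure (measure_pmf (poisson_pmf (intensity dark L h x j))) (B j))
        \<in> borel_measurable ?N \<longleftrightarrow>
      (\<lambda>x. \<integral>\<^sup>+m. ennreal (intensity dark L h x j ^ m / fact m * exp (- intensity dark L h x j))
            * indicator (B j) m \<partial>count_space UNIV) \<in> borel_measurable ?N"
    proof (rule measurable_cong)
      fix x assume "x \<in> space ?N"
      then have "x k \<ge> 0" for k by (auto simp: space_PiM space_input_space PiE_iff)
      then have pos: "intensity dark L h x j > 0" using assms by (intro intensity_pos) auto
      show "emeasure (measure_pmf (poisson_pmf (intensity dark L h x j))) (B j) =
        (\<integral>\<^sup>+m. ennreal (intensity dark L h x j ^ m / fact m * exp (- intensity dark L h x j))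
            * indicator (B j) m \<partial>count_space UNIV)"
        unfolding pmf_poisson[OF pos, symmetric] nn_integral_pmf[symmetric]
        by (simp add: nn_integral_count_space_indicator)
    qed
    moreover have "(\<lambda>x. \<integral>\<^sup>+m. ennreal (intensity dark L h x j ^ m / fact m
        * exp (- intensity dark L h x j)) * indicator (B j) m \<partial>count_space UNIV) \<in> borel_measurable ?N"
      using measurable_intensity[measurable] by (simp add: nn_integral_count_space_nat)
    ultimately show "(\<lambda>x. emeasure (measure_pmf (poisson_pmf (intensity dark L h x j))) (B j))
        \<in> borel_measurable ?N" by simp
  qed
  moreover have "emeasure (output_kernel dark L h x) E =
      (\<Prod>j\<in>J. emeasure (measure_pmf (poisson_pmf (intensity dark L h x j))) (B j))" for x
  proof -
    interpret product_prob_space "\<lambda>k. measure_pmf (poisson_pmf (intensity dark L h x k))" UNIV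
      by unfold_locales
    have "E = prod_emb UNIV (\<lambda>k. measure_pmf (poisson_pmf (intensity dark L h x k))) J (Pi\<^sub>E J B)"
      by (simp add: E prod_emb_def)
    then show ?thesis unfolding output_kernel_def using J by (simp add: emeasure_PiM_emb)
  qed
  ultimately show "(\<lambda>x. emeasure (output_kernel dark L h x) E) \<in> borel_measurable ?N" by simp
qed

lemma measurable_joint_kernel:
  assumes "dark > 0" "\<And>l. l \<le> L \<Longrightarrow> h l \<ge> 0"
  shows "(\<lambda>x. distr (output_kernel dark L h x) (path_space A) (Pair x)) \<in>
    (\<Pi>\<^sub>M k\<in>UNIV. input_space A) \<rightarrow>\<^sub>M prob_algebra (path_space A)"
proof -
  have [measurable]: "output_kernel dark L h \<in>
    (\<Pi>\<^sub>M k\<in>UNIV. input_space A) \<rightarrow>\<^sub>M prob_algebra (\<Pi>\<^sub>M k\<in>UNIV. count_space UNIV)"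
    using assms by (rule measurable_output_kernel)
  show ?thesis unfolding path_space_def
    by (rule measurable_distr_prob_space2[where M = "\<Pi>\<^sub>M k\<in>UNIV. count_space UNIV"]) measurable
qed

lemma process_law_in_prob_algebra:
  assumes "dark > 0" "\<And>l. l \<le> L \<Longrightarrow> h l \<ge> 0" and F: "F \<in> input_laws A"
  shows "process_law dark L h A F \<in> space (prob_algebra (path_space A))"
proof -
  have "(\<Pi>\<^sub>M k\<in>(UNIV::int set). F) \<in> space (prob_algebra (\<Pi>\<^sub>M k\<in>UNIV. input_space A))"
    using input_lawsD[OF F]
    by (auto simp: space_prob_algebra intro!: prob_space_PiM sets_PiM_cong)
  from measurable_space[OF measurable_bind_prob_space[OF measurable_ident
        measurable_joint_kernel[OF assms(1,2)]] this]
  show ?thesis by (simp add: process_law_def)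
qed

end

theory Submission
  imports Defs "HOL-Complex_Analysis.Complex_Analysis"
begin

text \<open>
  Write \<open>f\<close> for the negative logarithm of the density of the output block under the law \<open>F\<close>. Up to a bounded
  term, the block information at the mixture \<open>(1 - \<epsilon>) F + \<epsilon> G\<close> is the mean there of a fixed function of the inputs
  built from \<open>f\<close>, minus a relative entropy. Exchanging the input law site by site shows that the mean
  is \<open>\<epsilon>\<close> times a linear functional of \<open>G\<close> plus \<open>O(\<epsilon>\<^sup>2 n)\<close>, and that the relative entropy is \<open>O(\<epsilon>\<^sup>2 n)\<close>, provided that the
  influence of two inputs on \<open>f\<close> decays exponentially in their distance. It does: a Poisson likelihood at output \<open>0\<close>
  is \<open>exp (- Z)\<close> with \<open>Z\<close> linear in the inputs, so \<open>L\<close> consecutive zero outputs make the density factorize exactly, and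
  such runs have probability bounded below whatever the inputs are. The expansion is uniform in
  the block length \<open>n\<close>, so existence of the rates forces the normalized linear functionals to converge, and
  their limit is the right derivative. For point masses at \<open>x\<close> these functionals are holomorphic in \<open>x\<close> and
  locally bounded uniformly in \<open>n\<close>, so Montel's theorem gives the holomorphic extension.
\<close>

text \<open>The function \<open>f\<close> is frozen at \<open>F\<close> because letting it follow
  the mixture costs only a relative entropy between output blocks, whose expansion starts at second
  order. The obstacle is the number of pairs of sites, of order n^2: only summable pair interactions
  keep the error at order n. Since sites are exchanged from left to right, each pair can be read so
  that a quantity local at the earlier site is perturbed at the later one, and forgetting towards
  the right is enough. The function \<open>f\<close> is itself of size n. It enters only through its
  change when the outputs seen by one input are set to zero, and this change is controlled by those
  outputs alone, uniformly in n; the part that remains does not react to that input. The half plane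
  of the theorem is the set of complex values for one input that keep all intensities in the open
  right half plane, whatever the other inputs are; there the logarithm in \<open>z * ln z\<close> is
  holomorphic.\<close>

section \<open>Gluing coordinates of infinite product measures\<close>

definition glue :: "'i set \<Rightarrow> ('i \<Rightarrow> 'a) \<Rightarrow> ('i \<Rightarrow> 'a) \<Rightarrow> 'i \<Rightarrow> 'a" where
  "glue I y y' = (\<lambda>i. if i \<in> I then y i else y' i)"

lemma measurable_glue:
  assumes "\<And>i. i \<in> I \<Longrightarrow> sets (M i) = sets (S i)" "\<And>i. i \<notin> I \<Longrightarrow> sets (M' i) = sets (S i)"
  shows "(\<lambda>p. glue I (fst p) (snd p)) \<in> (PiM UNIV M \<Otimes>\<^sub>M PiM UNIV M') \<rightarrow>\<^sub>M PiM UNIV S"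
proof (rule measurable_PiM_single')
  show "(\<lambda>p. glue I (fst p) (snd p) i) \<in> (PiM UNIV M \<Otimes>\<^sub>M PiM UNIV M') \<rightarrow>\<^sub>M S i" for i
  proof (cases "i \<in> I")
    case True
    have "(\<lambda>p. fst p i) \<in> (PiM UNIV M \<Otimes>\<^sub>M PiM UNIV M') \<rightarrow>\<^sub>M M i" by measurable
    then show ?thesis using True assms by (simp add: glue_def cong: measurable_cong_sets)
  next
    case False
    have "(\<lambda>p. snd p i) \<in> (PiM UNIV M \<Otimes>\<^sub>M PiM UNIV M') \<rightarrow>\<^sub>M M' i" by measurable
    then show ?thesis using False assms by (simp add: glue_def cong: measurable_cong_sets)
  qed
next
  have "space (M i) = space (S i)" if "i \<in> I" for i using assms(1)[OF that] by (rule sets_eq_imp_space_eq)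
  moreover have "space (M' i) = space (S i)" if "i \<notin> I" for i using assms(2)[OF that] by (rule sets_eq_imp_space_eq)
  ultimately show "(\<lambda>p. glue I (fst p) (snd p)) \<in> space (PiM UNIV M \<Otimes>\<^sub>M PiM UNIV M') \<rightarrow> (\<Pi>\<^sub>E i\<in>UNIV. space (S i))"
    by (fastforce simp: space_pair_measure space_PiM glue_def PiE_iff)
qed

text \<open>Cylinders over finitely many coordinates determine a product measure, and the preimage
  of such a cylinder is a rectangle: its coordinates in \<open>I\<close> constrain the first sample,
  the others the second.\<close>

lemma distr_glue:
  fixes M M' :: "'i \<Rightarrow> 'a measure"
  assumes P: "\<And>i. prob_space (M i)" "\<And>i. prob_space (M' i)"
    and S: "\<And>i. sets (M i) = sets (S i)" "\<And>i. sets (M' i) = sets (S i)"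
  shows "distr (PiM UNIV M \<Otimes>\<^sub>M PiM UNIV M') (PiM UNIV S) (\<lambda>p. glue I (fst p) (snd p))
    = PiM UNIV (\<lambda>i. if i \<in> I then M i else M' i)"
proof (rule measure_eqI_PiM_infinite[symmetric])
  let ?N = "\<lambda>i. if i \<in> I then M i else M' i"
  interpret M: prob_space "PiM UNIV M" by (intro prob_space_PiM P)
  interpret M': prob_space "PiM UNIV M'" by (intro prob_space_PiM P)
  interpret N: prob_space "PiM UNIV ?N" by (intro prob_space_PiM) (simp add: P)
  show "finite_measure (PiM UNIV ?N)" by unfold_locales
  have sN: "sets (?N i) = sets (S i)" for i using S by simp
  show "sets (distr (PiM UNIV M \<Otimes>\<^sub>M PiM UNIV M') (PiM UNIV S) (\<lambda>p. glue I (fst p) (snd p)))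
     = sets (PiM UNIV ?N)" unfolding sets_distr by (rule sets_PiM_cong[OF refl sN[symmetric]])
  fix A and J :: "'i set"
  assume J: "finite J" and A: "\<And>i. i \<in> J \<Longrightarrow> A i \<in> sets (?N i)"
  let ?X = "prod_emb UNIV ?N J (Pi\<^sub>E J A)"
  let ?X1 = "prod_emb UNIV M (J \<inter> I) (Pi\<^sub>E (J \<inter> I) A)"
  let ?X2 = "prod_emb UNIV M' (J - I) (Pi\<^sub>E (J - I) A)"
  have X: "?X \<in> sets (PiM UNIV S)"
  proof -
    have "?X \<in> sets (PiM UNIV ?N)" using J A by (intro sets_PiM_I) auto
    also have "sets (PiM UNIV ?N) = sets (PiM UNIV S)" by (rule sets_PiM_cong[OF refl sN])
    finally show ?thesis .
  qed
  have A': "A i \<in> sets (S i)" if "i \<in> J" for i using A[OF that] sN by simp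
  have sp: "space (M i) = space (S i)" "space (M' i) = space (S i)" for i
    by (rule sets_eq_imp_space_eq[OF S(1)], rule sets_eq_imp_space_eq[OF S(2)])
  have "emeasure (distr (PiM UNIV M \<Otimes>\<^sub>M PiM UNIV M') (PiM UNIV S) (\<lambda>p. glue I (fst p) (snd p))) ?X
      = emeasure (PiM UNIV M \<Otimes>\<^sub>M PiM UNIV M')
         ((\<lambda>p. glue I (fst p) (snd p)) -` ?X \<inter> space (PiM UNIV M \<Otimes>\<^sub>M PiM UNIV M'))"
    using X S by (intro emeasure_distr measurable_glue) auto
  also have "(\<lambda>p. glue I (fst p) (snd p)) -` ?X \<inter> space (PiM UNIV M \<Otimes>\<^sub>M PiM UNIV M') = ?X1 \<times> ?X2"
    using A[THEN sets.sets_into_space] sp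
    by (auto simp: prod_emb_def space_pair_measure space_PiM PiE_iff glue_def extensional_def split: if_splits)
  also have "emeasure (PiM UNIV M \<Otimes>\<^sub>M PiM UNIV M') (?X1 \<times> ?X2) =
      emeasure (PiM UNIV M) ?X1 * emeasure (PiM UNIV M') ?X2"
    using J A' S by (intro M'.emeasure_pair_measure_Times sets_PiM_I) auto
  also have "emeasure (PiM UNIV M) ?X1 = (\<Prod>i\<in>J \<inter> I. emeasure (?N i) (A i))"
    using J A' P S by (subst emeasure_PiM_emb) (auto intro!: prod.cong)
  also have "emeasure (PiM UNIV M') ?X2 = (\<Prod>i\<in>J - I. emeasure (?N i) (A i))"
    using J A' P S by (subst emeasure_PiM_emb) (auto intro!: prod.cong)
  also have "(\<Prod>i\<in>J \<inter> I. emeasure (?N i) (A i)) * (\<Prod>i\<in>J - I. emeasure (?N i) (A i))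
      = (\<Prod>i\<in>J. emeasure (?N i) (A i))"
    using J by (subst prod.union_disjoint[symmetric]) (auto intro!: prod.cong)
  also have "\<dots> = emeasure (PiM UNIV ?N) ?X"
    using J A P by (subst emeasure_PiM_emb) auto
  finally show "emeasure (PiM UNIV ?N) ?X =
    emeasure (distr (PiM UNIV M \<Otimes>\<^sub>M PiM UNIV M') (PiM UNIV S) (\<lambda>p. glue I (fst p) (snd p))) ?X" ..
qed simp_all

lemma nn_integral_glue:
  fixes M M' :: "'i \<Rightarrow> 'a measure"
  assumes P: "\<And>i. prob_space (M i)" "\<And>i. prob_space (M' i)"
    and S: "\<And>i. sets (M i) = sets (S i)" "\<And>i. sets (M' i) = sets (S i)"
    and u: "u \<in> borel_measurable (PiM UNIV S)"
  shows "(\<integral>\<^sup>+y. u y \<partial>PiM UNIV (\<lambda>i. if i \<in> I then M i else M' i))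
    = (\<integral>\<^sup>+y. \<integral>\<^sup>+y'. u (glue I y y') \<partial>PiM UNIV M' \<partial>PiM UNIV M)"
proof -
  interpret M': prob_space "PiM UNIV M'" by (intro prob_space_PiM P)
  have m: "(\<lambda>p. glue I (fst p) (snd p)) \<in> (PiM UNIV M \<Otimes>\<^sub>M PiM UNIV M') \<rightarrow>\<^sub>M PiM UNIV S"
    using S by (intro measurable_glue) auto
  have "(\<integral>\<^sup>+y. u y \<partial>PiM UNIV (\<lambda>i. if i \<in> I then M i else M' i))
      = (\<integral>\<^sup>+p. u (glue I (fst p) (snd p)) \<partial>(PiM UNIV M \<Otimes>\<^sub>M PiM UNIV M'))"
    unfolding distr_glue[OF P S, symmetric] using u by (intro nn_integral_distr[OF m]) simp
  then show ?thesis using M'.nn_integral_fst[OF measurable_compose[OF m u]] by simp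
qed

lemma integral_glue:
  fixes M M' :: "'i \<Rightarrow> 'a measure" and u :: "('i \<Rightarrow> 'a) \<Rightarrow> 'b::{banach, second_countable_topology}"
  assumes P: "\<And>i. prob_space (M i)" "\<And>i. prob_space (M' i)"
    and S: "\<And>i. sets (M i) = sets (S i)" "\<And>i. sets (M' i) = sets (S i)"
    and u: "integrable (PiM UNIV (\<lambda>i. if i \<in> I then M i else M' i)) u"
  shows "(\<integral>y. u y \<partial>PiM UNIV (\<lambda>i. if i \<in> I then M i else M' i))
    = (\<integral>y. \<integral>y'. u (glue I y y') \<partial>PiM UNIV M' \<partial>PiM UNIV M)"
proof -
  let ?N = "\<lambda>i. if i \<in> I then M i else M' i"
  interpret M: prob_space "PiM UNIV M" by (intro prob_space_PiM P)
  interpret M': prob_space "PiM UNIV M'" by (intro prob_space_PiM P)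
  interpret pair_sigma_finite "PiM UNIV M" "PiM UNIV M'" ..
  have m: "(\<lambda>p. glue I (fst p) (snd p)) \<in> (PiM UNIV M \<Otimes>\<^sub>M PiM UNIV M') \<rightarrow>\<^sub>M PiM UNIV S"
    using S by (intro measurable_glue) auto
  have "sets (PiM UNIV ?N) = sets (PiM UNIV S)" using S by (intro sets_PiM_cong) auto
  then have um: "u \<in> borel_measurable (PiM UNIV S)"
    using borel_measurable_integrable[OF u] by (simp cong: measurable_cong_sets)
  have i: "integrable (PiM UNIV M \<Otimes>\<^sub>M PiM UNIV M') (\<lambda>p. u (glue I (fst p) (snd p)))"
    using u unfolding distr_glue[OF P S, symmetric] by (simp add: integrable_distr_eq[OF m um])
  have "(\<integral>y. u y \<partial>PiM UNIV ?N) = (\<integral>p. u (glue I (fst p) (snd p)) \<partial>(PiM UNIV M \<Otimes>\<^sub>M PiM UNIV M'))"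
    unfolding distr_glue[OF P S, symmetric] by (rule integral_distr[OF m um])
  then show ?thesis using integral_fst'[OF i] by simp
qed

text \<open>Locality is expressed by values rather than by a sub-sigma-algebra, so that a glued
  argument simplifies to one of its two components.\<close>

definition depends_on :: "'i set \<Rightarrow> (('i \<Rightarrow> 'a) \<Rightarrow> 'b) \<Rightarrow> bool" where
  "depends_on I u \<longleftrightarrow> (\<forall>y y'. (\<forall>i\<in>I. y i = y' i) \<longrightarrow> u y = u y')"

lemma depends_onI: "(\<And>y y'. (\<And>i. i \<in> I \<Longrightarrow> y i = y' i) \<Longrightarrow> u y = u y') \<Longrightarrow> depends_on I u"
  unfolding depends_on_def by blast

lemma depends_onD: "depends_on I u \<Longrightarrow> (\<And>i. i \<in> I \<Longrightarrow> y i = y' i) \<Longrightarrow> u y = u y'"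
  unfolding depends_on_def by blast

lemma depends_on_mono: "depends_on I u \<Longrightarrow> I \<subseteq> J \<Longrightarrow> depends_on J u"
  unfolding depends_on_def by blast

lemma depends_on_glue:
  "depends_on I u \<Longrightarrow> u (glue I y y') = u y" "depends_on I u \<Longrightarrow> I \<inter> J = {} \<Longrightarrow> u (glue J y y') = u y'"
  by (auto elim!: depends_onD simp: glue_def)

text \<open>Gluing the \<open>I\<close>-coordinates of a sample of \<open>M\<close> onto one of
  \<open>N\<close> gives a sample of \<open>N\<close>, as the factors agree on \<open>I\<close>,
  while \<open>u\<close> reads only the part that came from \<open>M\<close>.\<close>

lemma nn_integral_PiM_cong_depends:
  fixes M N :: "'i \<Rightarrow> 'a measure"
  assumes P: "\<And>i. prob_space (M i)" "\<And>i. prob_space (N i)"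
    and S: "\<And>i. sets (M i) = sets (S i)" "\<And>i. sets (N i) = sets (S i)"
    and u: "u \<in> borel_measurable (PiM UNIV S)" and d: "depends_on I u"
    and eq: "\<And>i. i \<in> I \<Longrightarrow> M i = N i"
  shows "(\<integral>\<^sup>+y. u y \<partial>PiM UNIV M) = (\<integral>\<^sup>+y. u y \<partial>PiM UNIV N)"
proof -
  interpret N: prob_space "PiM UNIV N" by (intro prob_space_PiM P)
  have "(\<lambda>i. if i \<in> I then M i else N i) = N" using eq by auto
  then have "(\<integral>\<^sup>+y. u y \<partial>PiM UNIV N) = (\<integral>\<^sup>+y. \<integral>\<^sup>+y'. u (glue I y y') \<partial>PiM UNIV N \<partial>PiM UNIV M)"
    using nn_integral_glue[OF P S u, of I] by simp
  then show ?thesis by (simp add: depends_on_glue[OF d] N.emeasure_space_1)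
qed

text \<open>Equality of image laws transfers integrals and integrability at once; both vector-valued
  versions below are read off from it.\<close>

lemma distr_PiM_cong_depends:
  fixes M N :: "'i \<Rightarrow> 'a measure"
  assumes P: "\<And>i. prob_space (M i)" "\<And>i. prob_space (N i)"
    and S: "\<And>i. sets (M i) = sets (S i)" "\<And>i. sets (N i) = sets (S i)"
    and u: "u \<in> PiM UNIV S \<rightarrow>\<^sub>M T" and d: "depends_on I u"
    and eq: "\<And>i. i \<in> I \<Longrightarrow> M i = N i"
  shows "distr (PiM UNIV M) T u = distr (PiM UNIV N) T u"
proof (rule measure_eqI)
  have s: "sets (PiM UNIV M) = sets (PiM UNIV S)" "sets (PiM UNIV N) = sets (PiM UNIV S)"
    using S by (auto intro!: sets_PiM_cong)
  have um: "u \<in> PiM UNIV M \<rightarrow>\<^sub>M T" "u \<in> PiM UNIV N \<rightarrow>\<^sub>M T" using u s by (auto cong: measurable_cong_sets)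
  fix X assume "X \<in> sets (distr (PiM UNIV M) T u)"
  then have X: "X \<in> sets T" by simp
  have "emeasure (distr (PiM UNIV M) T u) X = (\<integral>\<^sup>+y. indicator X (u y) \<partial>PiM UNIV M)"
    using X um by (simp add: nn_integral_distr[symmetric])
  also have "\<dots> = (\<integral>\<^sup>+y. indicator X (u y) \<partial>PiM UNIV N)"
  proof (rule nn_integral_PiM_cong_depends[OF P S _ _ eq])
    show "depends_on I (\<lambda>y. indicator X (u y) :: ennreal)"
      by (rule depends_onI) (metis depends_onD[OF d])
    show "(\<lambda>y. indicator X (u y) :: ennreal) \<in> borel_measurable (PiM UNIV S)"
      using X by (intro measurable_compose[OF u]) simp
  qed
  also have "\<dots> = emeasure (distr (PiM UNIV N) T u) X"
    using X um by (simp add: nn_integral_distr[symmetric])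
  finally show "emeasure (distr (PiM UNIV M) T u) X = emeasure (distr (PiM UNIV N) T u) X" .
qed simp

lemma integral_PiM_cong_depends:
  fixes M N :: "'i \<Rightarrow> 'a measure" and u :: "('i \<Rightarrow> 'a) \<Rightarrow> 'b::{banach, second_countable_topology}"
  assumes P: "\<And>i. prob_space (M i)" "\<And>i. prob_space (N i)"
    and S: "\<And>i. sets (M i) = sets (S i)" "\<And>i. sets (N i) = sets (S i)"
    and u: "u \<in> borel_measurable (PiM UNIV S)" and d: "depends_on I u"
    and eq: "\<And>i. i \<in> I \<Longrightarrow> M i = N i"
  shows "(\<integral>y. u y \<partial>PiM UNIV M) = (\<integral>y. u y \<partial>PiM UNIV N)"
proof -
  have s: "sets (PiM UNIV M) = sets (PiM UNIV S)" "sets (PiM UNIV N) = sets (PiM UNIV S)"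
    using S by (auto intro!: sets_PiM_cong)
  have um: "u \<in> borel_measurable (PiM UNIV M)" "u \<in> borel_measurable (PiM UNIV N)"
    using u s by (auto cong: measurable_cong_sets)
  have "(\<integral>y. u y \<partial>PiM UNIV M) = (\<integral>z. z \<partial>distr (PiM UNIV M) borel u)"
    using um by (simp add: integral_distr)
  also have "\<dots> = (\<integral>z. z \<partial>distr (PiM UNIV N) borel u)"
    by (rule arg_cong[where f="\<lambda>D. integral\<^sup>L D (\<lambda>z. z)"]) (rule distr_PiM_cong_depends[OF P S u d eq])
  also have "\<dots> = (\<integral>y. u y \<partial>PiM UNIV N)" using um by (simp add: integral_distr)
  finally show ?thesis .
qed

lemma integrable_PiM_cong_depends:
  fixes M N :: "'i \<Rightarrow> 'a measure" and u :: "('i \<Rightarrow> 'a) \<Rightarrow> 'b::{banach, second_countable_topology}"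
  assumes P: "\<And>i. prob_space (M i)" "\<And>i. prob_space (N i)"
    and S: "\<And>i. sets (M i) = sets (S i)" "\<And>i. sets (N i) = sets (S i)"
    and u: "u \<in> borel_measurable (PiM UNIV S)" and d: "depends_on I u"
    and eq: "\<And>i. i \<in> I \<Longrightarrow> M i = N i"
  shows "integrable (PiM UNIV M) u \<longleftrightarrow> integrable (PiM UNIV N) u"
proof -
  have s: "sets (PiM UNIV M) = sets (PiM UNIV S)" "sets (PiM UNIV N) = sets (PiM UNIV S)"
    using S by (auto intro!: sets_PiM_cong)
  have um: "u \<in> borel_measurable (PiM UNIV M)" "u \<in> borel_measurable (PiM UNIV N)"
    using u s by (auto cong: measurable_cong_sets)
  have "integrable (PiM UNIV M) u \<longleftrightarrow> integrable (distr (PiM UNIV M) borel u) (\<lambda>z. z)"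
    using um by (simp add: integrable_distr_eq)
  also have "distr (PiM UNIV M) borel u = distr (PiM UNIV N) borel u"
    by (rule distr_PiM_cong_depends[OF P S u d eq])
  also have "integrable (distr (PiM UNIV N) borel u) (\<lambda>z. z) \<longleftrightarrow> integrable (PiM UNIV N) u"
    using um by (simp add: integrable_distr_eq)
  finally show ?thesis .
qed

text \<open>Independence by gluing: if the coordinates in \<open>I\<close> are taken from
  \<open>y\<close> and the others from an independent \<open>y'\<close>, the integrand becomes
  \<open>u y * w y'\<close>.\<close>

lemma nn_integral_PiM_mult:
  fixes M :: "'i \<Rightarrow> 'a measure"
  assumes P: "\<And>i. prob_space (M i)"
    and u: "u \<in> borel_measurable (PiM UNIV M)" "depends_on I u"
    and w: "w \<in> borel_measurable (PiM UNIV M)" "depends_on J w" and "I \<inter> J = {}"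
  shows "(\<integral>\<^sup>+y. u y * w y \<partial>PiM UNIV M) = (\<integral>\<^sup>+y. u y \<partial>PiM UNIV M) * (\<integral>\<^sup>+y. w y \<partial>PiM UNIV M)"
proof -
  have "J \<inter> I = {}" using \<open>I \<inter> J = {}\<close> by auto
  then have "(\<integral>\<^sup>+y. u y * w y \<partial>PiM UNIV M) = (\<integral>\<^sup>+y. \<integral>\<^sup>+y'. u y * w y' \<partial>PiM UNIV M \<partial>PiM UNIV M)"
    using nn_integral_glue[OF P P refl refl borel_measurable_times_ennreal[OF u(1) w(1)], of I]
    by (simp add: depends_on_glue[OF u(2)] depends_on_glue[OF w(2)])
  then show ?thesis using u w by (simp add: nn_integral_cmult nn_integral_multc)
qed

lemma integral_PiM_mult:
  fixes M :: "'i \<Rightarrow> 'a measure" and u w :: "_ \<Rightarrow> real"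
  assumes P: "\<And>i. prob_space (M i)"
    and u: "integrable (PiM UNIV M) u" "depends_on I u"
    and w: "integrable (PiM UNIV M) w" "depends_on J w" and "I \<inter> J = {}"
    and uw: "integrable (PiM UNIV M) (\<lambda>y. u y * w y)"
  shows "(\<integral>y. u y * w y \<partial>PiM UNIV M) = (\<integral>y. u y \<partial>PiM UNIV M) * (\<integral>y. w y \<partial>PiM UNIV M)"
proof -
  have "J \<inter> I = {}" using \<open>I \<inter> J = {}\<close> by auto
  then have "(\<integral>y. u y * w y \<partial>PiM UNIV M) = (\<integral>y. \<integral>y'. u y * w y' \<partial>PiM UNIV M \<partial>PiM UNIV M)"
    using integral_glue[OF P P refl refl, of I _ "\<lambda>y. u y * w y"] uw
    by (simp add: depends_on_glue[OF u(2)] depends_on_glue[OF w(2)])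
  then show ?thesis by simp
qed

lemma nn_integral_PiM_component:
  assumes "\<And>i. prob_space (M i)" "u \<in> borel_measurable (M k)"
  shows "(\<integral>\<^sup>+y. u (y k) \<partial>PiM UNIV M) = (\<integral>\<^sup>+s. u s \<partial>M k)"
  using nn_integral_distr[of "\<lambda>y. y k" "PiM UNIV M" "M k" u] assms
  by (simp add: distr_PiM_component)

lemma integral_PiM_component:
  fixes u :: "'a \<Rightarrow> 'b::{banach, second_countable_topology}"
  assumes "\<And>i. prob_space (M i)" "u \<in> borel_measurable (M k)"
  shows "(\<integral>y. u (y k) \<partial>PiM UNIV M) = (\<integral>s. u s \<partial>M k)"
  using integral_distr[of "\<lambda>y. y k" "PiM UNIV M" "M k" u] assms
  by (simp add: distr_PiM_component)

lemma nn_integral_PiM_prod: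
  fixes M :: "'i \<Rightarrow> 'a measure" and u :: "'i \<Rightarrow> 'a \<Rightarrow> ennreal"
  assumes P: "\<And>i. prob_space (M i)" and "finite J" and u: "\<And>i. i \<in> J \<Longrightarrow> u i \<in> borel_measurable (M i)"
  shows "(\<integral>\<^sup>+y. (\<Prod>i\<in>J. u i (y i)) \<partial>PiM UNIV M) = (\<Prod>i\<in>J. \<integral>\<^sup>+s. u i s \<partial>M i)"
  using \<open>finite J\<close> u
proof (induction J rule: finite_induct)
  case empty
  interpret prob_space "PiM UNIV M" by (intro prob_space_PiM P)
  show ?case by (simp add: emeasure_space_1)
next
  case (insert k J)
  have m: "(\<lambda>y. u i (y i)) \<in> borel_measurable (PiM UNIV M)" if "i \<in> insert k J" for i
    using measurable_compose[OF measurable_component_singleton[of i UNIV M] insert.prems[OF that]] by simp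
  have "(\<integral>\<^sup>+y. u k (y k) * (\<Prod>i\<in>J. u i (y i)) \<partial>PiM UNIV M)
      = (\<integral>\<^sup>+y. u k (y k) \<partial>PiM UNIV M) * (\<integral>\<^sup>+y. (\<Prod>i\<in>J. u i (y i)) \<partial>PiM UNIV M)"
    by (rule nn_integral_PiM_mult[where I="{k}" and J=J])
       (use P m insert.hyps in \<open>auto intro!: depends_onI borel_measurable_prod_ennreal prod.cong\<close>)
  then show ?case using insert by (simp add: nn_integral_PiM_component[OF P, where u="u k" and k=k])
qed

text \<open>Only finitely many factors change, so the density is a finite product even though the
  index set is infinite. This is what makes a block of outputs tractable inside a two-sided
  sequence.\<close>

lemma PiM_density:
  fixes M N :: "'i \<Rightarrow> 'a measure" and r :: "'i \<Rightarrow> 'a \<Rightarrow> ennreal"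
  assumes P: "\<And>i. prob_space (M i)" "\<And>i. prob_space (N i)" and "finite T"
    and r: "\<And>i. i \<in> T \<Longrightarrow> r i \<in> borel_measurable (M i)"
    and N: "\<And>i. i \<in> T \<Longrightarrow> N i = density (M i) (r i)" "\<And>i. i \<notin> T \<Longrightarrow> N i = M i"
  shows "PiM UNIV N = density (PiM UNIV M) (\<lambda>y. \<Prod>i\<in>T. r i (y i))"
proof -
  let ?r = "\<lambda>y. \<Prod>i\<in>T. r i (y i)"
  have rm [measurable]: "?r \<in> borel_measurable (PiM UNIV M)"
    using r by (intro borel_measurable_prod_ennreal measurable_compose[OF measurable_component_singleton]) auto
  have sN: "sets (N i) = sets (M i)" for i using N by (cases "i \<in> T") auto
  have sP: "sets (PiM UNIV N) = sets (PiM UNIV M)" using sN by (intro sets_PiM_cong) auto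
  show ?thesis
  proof (rule measure_eqI_PiM_infinite[OF refl])
    interpret prob_space "PiM UNIV N" by (intro prob_space_PiM P)
    show "finite_measure (PiM UNIV N)" by unfold_locales
    show "sets (density (PiM UNIV M) ?r) = sets (PiM UNIV N)" using sP by simp
    fix A and J :: "'i set"
    assume J: "finite J" and A: "\<And>i. i \<in> J \<Longrightarrow> A i \<in> sets (N i)"
    let ?X = "prod_emb UNIV N J (Pi\<^sub>E J A)"
    \<comment> \<open>Merges the density factor at a site of \<open>T\<close> with the indicator of
      the cylinder at a site of \<open>J\<close>, so that one finite product over both sets remains.
      A site of \<open>T\<close> outside \<open>J\<close> then contributes the total mass of
      \<open>N i\<close>, which is 1.\<close>
    define v where "v i s = (if i \<in> T then r i s else 1) * (if i \<in> J then indicator (A i) s else 1)" for i s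
    have X: "?X \<in> sets (PiM UNIV M)" using J A sP sets_PiM_I[of J UNIV A N] by simp
    have vm: "v i \<in> borel_measurable (M i)" if "i \<in> T \<union> J" for i
      using r A[of i] sN unfolding v_def by (cases "i \<in> T"; cases "i \<in> J") auto
    have "emeasure (density (PiM UNIV M) ?r) ?X = (\<integral>\<^sup>+y. ?r y * indicator ?X y \<partial>PiM UNIV M)"
      using X by (simp add: emeasure_density)
    also have "\<dots> = (\<integral>\<^sup>+y. (\<Prod>i\<in>T \<union> J. v i (y i)) \<partial>PiM UNIV M)"
    proof (rule nn_integral_cong)
      fix y assume y: "y \<in> space (PiM UNIV M)"
      have "indicator ?X y = (\<Prod>i\<in>J. indicator (A i) (y i) :: ennreal)"
      proof (cases "y \<in> ?X")
        case True
        then show ?thesis by (auto simp: prod_emb_def PiE_iff)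
      next
        case False
        then obtain i where "i \<in> J" "y i \<notin> A i"
          using y sN[THEN sets_eq_imp_space_eq] by (auto simp: prod_emb_def space_PiM PiE_iff)
        then have "(\<Prod>i\<in>J. indicator (A i) (y i) :: ennreal) = 0"
          using J by (intro prod_zero) (auto intro!: bexI[of _ i])
        then show ?thesis using False by simp
      qed
      moreover have "(\<Prod>i\<in>T \<union> J. v i (y i)) = ?r y * (\<Prod>i\<in>J. indicator (A i) (y i))"
      proof -
        have "(\<Prod>i\<in>T \<union> J. (if i \<in> T then r i (y i) else 1)) = ?r y"
          using \<open>finite T\<close> J by (subst prod.If_cases) (auto simp: Int_absorb1)
        moreover have "(\<Prod>i\<in>T \<union> J. (if i \<in> J then indicator (A i) (y i) else 1)) = (\<Prod>i\<in>J. indicator (A i) (y i) :: ennreal)"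
          using \<open>finite T\<close> J by (subst prod.If_cases) (auto simp: Int_absorb1)
        ultimately show ?thesis unfolding v_def prod.distrib by simp
      qed
      ultimately show "?r y * indicator ?X y = (\<Prod>i\<in>T \<union> J. v i (y i))" by simp
    qed
    also have "\<dots> = (\<Prod>i\<in>T \<union> J. \<integral>\<^sup>+s. v i s \<partial>M i)"
      using vm J \<open>finite T\<close> by (intro nn_integral_PiM_prod P) auto
    also have "\<dots> = (\<Prod>i\<in>T \<union> J. if i \<in> J then emeasure (N i) (A i) else 1)"
    proof (rule prod.cong)
      fix i assume i: "i \<in> T \<union> J"
      show "(\<integral>\<^sup>+s. v i s \<partial>M i) = (if i \<in> J then emeasure (N i) (A i) else 1)"
      proof (cases "i \<in> T")
        case True
        then have *: "emeasure (N i) B = (\<integral>\<^sup>+s. r i s * indicator B s \<partial>M i)" if "B \<in> sets (M i)" for B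
          using that r N by (simp add: emeasure_density)
        have "(\<integral>\<^sup>+s. r i s \<partial>M i) = (\<integral>\<^sup>+s. r i s * indicator (space (M i)) s \<partial>M i)"
          by (intro nn_integral_cong) auto
        also have "\<dots> = 1" using *[of "space (M i)"] sN[THEN sets_eq_imp_space_eq]
            prob_space.emeasure_space_1[OF P(2)] by simp
        finally show ?thesis using True * A sN by (auto simp: v_def)
      next
        case False
        then show ?thesis using i A sN N by (auto simp: v_def)
      qed
    qed simp
    also have "\<dots> = (\<Prod>i\<in>J. emeasure (N i) (A i))"
      using J \<open>finite T\<close> by (subst prod.If_cases) (auto simp: Int_absorb1)
    also have "\<dots> = emeasure (PiM UNIV N) ?X"
      using J A P by (subst emeasure_PiM_emb) auto
    finally show "emeasure (PiM UNIV N) ?X = emeasure (density (PiM UNIV M) ?r) ?X" ..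
  qed
qed

section \<open>Poisson variables: density and generating function\<close>

lemma measurable_power_nat:
  fixes f :: "'a \<Rightarrow> 'b::{real_normed_algebra_1, second_countable_topology, banach}"
  assumes f: "f \<in> borel_measurable M" and g: "g \<in> M \<rightarrow>\<^sub>M count_space (UNIV :: nat set)"
  shows "(\<lambda>x. f x ^ g x) \<in> borel_measurable M"
  by (rule measurable_compose_countable[OF _ g]) (use f in measurable)

lemma measure_pmf_poisson_density:
  assumes "z > 0"
  shows "measure_pmf (poisson_pmf z)
    = density (measure_pmf (poisson_pmf 1)) (\<lambda>n. ennreal (exp (1 - z) * z ^ n))"
proof -
  have "density (measure_pmf (poisson_pmf 1)) (\<lambda>n. ennreal (exp (1 - z) * z ^ n))
      = density (count_space UNIV) (\<lambda>n. ennreal (pmf (poisson_pmf 1) n) * ennreal (exp (1 - z) * z ^ n))"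
    by (subst measure_pmf_eq_density, subst density_density_eq) auto
  also have "\<dots> = density (count_space UNIV) (\<lambda>n. ennreal (pmf (poisson_pmf z) n))"
  proof (rule density_cong)
    show "AE n in count_space UNIV. ennreal (pmf (poisson_pmf 1) n) * ennreal (exp (1 - z) * z ^ n)
        = ennreal (pmf (poisson_pmf z) n)"
      using assms by (simp add: ennreal_mult[symmetric] exp_minus exp_diff field_simps)
  qed auto
  finally show ?thesis by (simp add: measure_pmf_eq_density)
qed

lemma nn_integral_poisson_power:
  assumes "z > 0" "r \<ge> 0"
  shows "(\<integral>\<^sup>+n. ennreal (r ^ n) \<partial>measure_pmf (poisson_pmf z)) = ennreal (exp (z * (r - 1)))"
proof -
  have "(\<integral>\<^sup>+n. ennreal (r ^ n) \<partial>measure_pmf (poisson_pmf z))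
      = (\<integral>\<^sup>+n. ennreal (pmf (poisson_pmf z) n) * ennreal (r ^ n) \<partial>count_space UNIV)"
    by (simp add: measure_pmf_eq_density nn_integral_density)
  also have "\<dots> = (\<Sum>n. ennreal (exp (- z) * ((z * r) ^ n /\<^sub>R fact n)))"
    using assms by (simp add: nn_integral_count_space_nat ennreal_mult[symmetric] power_mult_distrib field_simps)
  also have "\<dots> = ennreal (exp (- z) * exp (z * r))"
  proof (rule suminf_ennreal_eq)
    show "(\<lambda>n. exp (- z) * ((z * r) ^ n /\<^sub>R fact n)) sums (exp (- z) * exp (z * r))"
      by (intro sums_mult exp_converges)
  qed (use assms in auto)
  also have "exp (- z) * exp (z * r) = exp (z * (r - 1))"
    by (simp add: exp_add[symmetric] algebra_simps)
  finally show ?thesis .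
qed

section \<open>The channel: intensities and output kernel\<close>

locale poisson_channel =
  fixes dark :: real and L :: nat and h :: "nat \<Rightarrow> real" and A :: real
  assumes dark: "dark > 0" and h_nonneg: "\<And>l. l \<le> L \<Longrightarrow> h l \<ge> 0"
    and h_sum: "(\<Sum>l\<le>L. h l) = 1" and A: "A \<ge> 0"
begin

abbreviation Z :: "(int \<Rightarrow> real) \<Rightarrow> int \<Rightarrow> real" where "Z \<equiv> intensity dark L h"

abbreviation SX :: "(int \<Rightarrow> real) measure" where "SX \<equiv> PiM UNIV (\<lambda>_. input_space A)"

abbreviation SY :: "(int \<Rightarrow> nat) measure" where "SY \<equiv> PiM UNIV (\<lambda>_. count_space UNIV)"

abbreviation K :: "(int \<Rightarrow> real) \<Rightarrow> (int \<Rightarrow> nat) measure" where "K \<equiv> output_kernel dark L h"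

text \<open>The largest possible intensity, because the taps sum to one.\<close>

definition peak :: real where "peak = dark + A"

definition inputs :: "(int \<Rightarrow> real) set" where "inputs = {x. \<forall>k. 0 \<le> x k \<and> x k \<le> A}"

text \<open>The outputs that input \<open>j\<close> can influence.\<close>

definition win :: "int \<Rightarrow> int set" where "win j = {j..j + int L}"

text \<open>Extending the taps by zero makes \<open>tap (k - j)\<close> the coefficient of input
  \<open>j\<close> in the intensity at \<open>k\<close> for all \<open>k\<close> and
  \<open>j\<close>.\<close>

definition tap :: "int \<Rightarrow> real" where "tap d = (if 0 \<le> d \<and> d \<le> int L then h (nat d) else 0)"

lemma finite_win [simp]: "finite (win j)" and card_win [simp]: "card (win j) = L + 1"
  by (simp_all add: win_def)

lemma space_SX: "space SX = inputs"
  by (auto simp: space_PiM space_input_space inputs_def PiE_iff)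

lemma inputs_upd: "x \<in> inputs \<Longrightarrow> 0 \<le> t \<Longrightarrow> t \<le> A \<Longrightarrow> x(j := t) \<in> inputs"
  by (auto simp: inputs_def)

lemma peak_pos: "peak > 0" and dark_le_peak: "dark \<le> peak"
  using dark A by (auto simp: peak_def)

lemma tap_nonneg: "tap d \<ge> 0"
  using h_nonneg by (auto simp: tap_def)

lemma tap_le_1: "tap d \<le> 1"
proof -
  have "h l \<le> 1" if "l \<le> L" for l
    using member_le_sum[of l "{..L}" h] that h_nonneg h_sum by auto
  then show ?thesis by (auto simp: tap_def)
qed

lemma Z_upper: assumes "x \<in> inputs" shows "Z x k \<le> peak"
proof -
  have "(\<Sum>l\<le>L. h l * x (k - int l)) \<le> (\<Sum>l\<le>L. h l * A)"
    using assms h_nonneg by (intro sum_mono mult_left_mono) (auto simp: inputs_def)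
  then show ?thesis using h_sum by (simp add: intensity_def peak_def sum_distrib_right[symmetric])
qed

lemma Z_lower: assumes "x \<in> inputs" shows "dark \<le> Z x k"
  using assms h_nonneg by (auto simp: intensity_def inputs_def intro!: sum_nonneg mult_nonneg_nonneg)

lemma Z_pos: "x \<in> inputs \<Longrightarrow> Z x k > 0"
  using Z_lower[of x k] dark by linarith

lemma Z_cong: "(\<And>i. k - int L \<le> i \<Longrightarrow> i \<le> k \<Longrightarrow> x i = x' i) \<Longrightarrow> Z x k = Z x' k"
  unfolding intensity_def by (intro arg_cong2[where f="(+)"] sum.cong refl arg_cong2[where f="(*)"]) auto

lemma Z_upd_outside: "k \<notin> win j \<Longrightarrow> Z (x(j := t)) k = Z x k"
  by (rule Z_cong) (auto simp: win_def)

text \<open>Separates the affine dependence on one input. The same formula later defines the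
  intensity at a complex input value.\<close>

lemma Z_upd: "Z (x(j := t)) k = Z (x(j := 0)) k + tap (k - j) * t"
proof (cases "k \<in> win j")
  case True
  have *: "(\<Sum>l\<le>L. h l * (x(j := s)) (k - int l))
      = h (nat (k - j)) * s + (\<Sum>l\<in>{..L} - {nat (k - j)}. h l * x (k - int l))" for s
  proof -
    have "(\<Sum>l\<in>{..L} - {nat (k - j)}. h l * (x(j := s)) (k - int l))
        = (\<Sum>l\<in>{..L} - {nat (k - j)}. h l * x (k - int l))"
      by (rule sum.cong) auto
    moreover have "nat (k - j) \<le> L" "0 \<le> k - j" using True by (auto simp: win_def)
    ultimately show ?thesis by (subst sum.remove[of _ "nat (k - j)"]) auto
  qed
  from True show ?thesis unfolding intensity_def *
    by (simp add: tap_def win_def)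
next
  case False
  then have "tap (k - j) = 0" by (auto simp: tap_def win_def)
  then show ?thesis using False by (simp add: Z_upd_outside)
qed

lemma measurable_Z [measurable]: "(\<lambda>x. Z x k) \<in> borel_measurable SX"
  by (rule measurable_intensity)

lemma prob_K: "prob_space (K x)"
  unfolding output_kernel_def by (intro prob_space_PiM prob_space_measure_pmf)

lemma sets_K [measurable_cong, simp]: "sets (K x) = sets SY"
  unfolding output_kernel_def by (intro sets_PiM_cong) simp_all

lemma space_K [simp]: "space (K x) = UNIV"
  using sets_eq_imp_space_eq[OF sets_K] by (simp add: space_PiM)

lemma measurable_K: "K \<in> SX \<rightarrow>\<^sub>M prob_algebra SY"
  using dark h_nonneg by (rule measurable_output_kernel)

lemma measurable_K_sub: "K \<in> SX \<rightarrow>\<^sub>M subprob_algebra SY"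
  using measurable_K by (rule measurable_prob_algebraD)

subsection \<open>Growth of functions of the outputs\<close>

text \<open>Powers of a total count have means that factorize over independent outputs and are
  bounded for all inputs simultaneously. The bound depends on the cardinality of \<open>S\<close>,
  so it is uniform in the block length as soon as \<open>S\<close> is a window.\<close>

definition growth :: "int set \<Rightarrow> real \<Rightarrow> real \<Rightarrow> ((int \<Rightarrow> nat) \<Rightarrow> real) \<Rightarrow> bool" where
  "growth S c r \<phi> \<longleftrightarrow> \<phi> \<in> borel_measurable SY \<and> (\<forall>y. \<bar>\<phi> y\<bar> \<le> c * r ^ (\<Sum>k\<in>S. y k))"

text \<open>The Poisson generating function at \<open>r\<close> for the largest possible
  mean.\<close>

definition mgf :: "real \<Rightarrow> real" where "mgf r = exp (peak * (r - 1))"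

lemma measurable_growth_weight [measurable]:
  "finite S \<Longrightarrow> (\<lambda>y. r ^ (\<Sum>k\<in>S. y k) :: real) \<in> borel_measurable SY"
  by (subst power_sum) (intro borel_measurable_prod measurable_power_nat; measurable)

lemma nn_integral_growth_weight:
  assumes "x \<in> inputs" "finite S" "r \<ge> 1"
  shows "(\<integral>\<^sup>+y. ennreal (r ^ (\<Sum>k\<in>S. y k)) \<partial>K x) \<le> ennreal (mgf r ^ card S)"
proof -
  have "(\<integral>\<^sup>+y. ennreal (r ^ (\<Sum>k\<in>S. y k)) \<partial>K x) = (\<integral>\<^sup>+y. (\<Prod>k\<in>S. ennreal (r ^ y k)) \<partial>K x)"
    using assms by (simp add: power_sum prod_ennreal)
  also have "\<dots> = (\<Prod>k\<in>S. \<integral>\<^sup>+n. ennreal (r ^ n) \<partial>measure_pmf (poisson_pmf (Z x k)))"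
    unfolding output_kernel_def
    by (rule nn_integral_PiM_prod) (use assms prob_space_measure_pmf in auto)
  also have "\<dots> = (\<Prod>k\<in>S. ennreal (exp (Z x k * (r - 1))))"
    using assms Z_pos by (intro prod.cong nn_integral_poisson_power) auto
  also have "\<dots> = ennreal (\<Prod>k\<in>S. exp (Z x k * (r - 1)))"
    by (simp add: prod_ennreal)
  also have "\<dots> \<le> ennreal (\<Prod>k\<in>S. mgf r)"
    using assms Z_upper by (intro ennreal_leI prod_mono) (auto simp: mgf_def intro!: mult_right_mono)
  finally show ?thesis by simp
qed

lemma growth_nn_integral:
  assumes "x \<in> inputs" "finite S" "r \<ge> 1" "c \<ge> 0" "growth S c r \<phi>"
  shows "(\<integral>\<^sup>+y. ennreal \<bar>\<phi> y\<bar> \<partial>K x) \<le> ennreal (c * mgf r ^ card S)"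
proof -
  have [measurable]: "finite S" by fact
  have "(\<integral>\<^sup>+y. ennreal \<bar>\<phi> y\<bar> \<partial>K x) \<le> (\<integral>\<^sup>+y. ennreal c * ennreal (r ^ (\<Sum>k\<in>S. y k)) \<partial>K x)"
    using assms unfolding growth_def
    by (intro nn_integral_mono) (auto simp: ennreal_mult[symmetric] intro!: ennreal_leI)
  also have "\<dots> = ennreal c * (\<integral>\<^sup>+y. ennreal (r ^ (\<Sum>k\<in>S. y k)) \<partial>K x)"
    using assms by (intro nn_integral_cmult) measurable
  also have "\<dots> \<le> ennreal c * ennreal (mgf r ^ card S)"
    using assms by (intro mult_left_mono nn_integral_growth_weight) auto
  finally show ?thesis using assms by (simp add: ennreal_mult mgf_def)
qed

lemma growth_integral:
  assumes "x \<in> inputs" "finite S" "r \<ge> 1" "c \<ge> 0" "growth S c r \<phi>"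
  shows "integrable (K x) \<phi>" and "\<bar>\<integral>y. \<phi> y \<partial>K x\<bar> \<le> c * mgf r ^ card S"
proof -
  have m: "\<phi> \<in> borel_measurable (K x)" using assms by (simp add: growth_def cong: measurable_cong_sets)
  show i: "integrable (K x) \<phi>"
    using growth_nn_integral[OF assms] m by (auto simp: integrable_iff_bounded intro: le_less_trans)
  have "ennreal \<bar>\<integral>y. \<phi> y \<partial>K x\<bar> \<le> (\<integral>\<^sup>+y. ennreal \<bar>\<phi> y\<bar> \<partial>K x)"
    using integral_norm_bound_ennreal[OF i] by simp
  also have "\<dots> \<le> ennreal (c * mgf r ^ card S)" by (rule growth_nn_integral[OF assms])
  finally show "\<bar>\<integral>y. \<phi> y \<partial>K x\<bar> \<le> c * mgf r ^ card S"
    using assms by (simp add: mgf_def)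
qed

lemma growth_mono:
  assumes "growth S c r \<phi>" "S \<subseteq> S'" "finite S'" "c \<le> c'" "r \<le> r'" "1 \<le> r" "0 \<le> c"
  shows "growth S' c' r' \<phi>"
  unfolding growth_def
proof (intro conjI allI)
  fix y :: "int \<Rightarrow> nat"
  have "r ^ (\<Sum>k\<in>S. y k) \<le> r ^ (\<Sum>k\<in>S'. y k)"
    using assms by (intro power_increasing sum_mono2) auto
  also have "\<dots> \<le> r' ^ (\<Sum>k\<in>S'. y k)" using assms by (intro power_mono) auto
  finally have "c * r ^ (\<Sum>k\<in>S. y k) \<le> c' * r' ^ (\<Sum>k\<in>S'. y k)"
    using assms by (intro mult_mono) auto
  then show "\<bar>\<phi> y\<bar> \<le> c' * r' ^ (\<Sum>k\<in>S'. y k)" using assms(1) unfolding growth_def by (meson order_trans)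
qed (use assms in \<open>simp add: growth_def\<close>)

lemma integral_K_cong:
  fixes u :: "_ \<Rightarrow> 'b::{banach, second_countable_topology}"
  assumes "u \<in> borel_measurable SY" "depends_on I u" "\<And>k. k \<in> I \<Longrightarrow> Z x k = Z x' k"
  shows "(\<integral>y. u y \<partial>K x) = (\<integral>y. u y \<partial>K x')"
  unfolding output_kernel_def
  by (rule integral_PiM_cong_depends[OF _ _ _ _ assms(1,2)]) (use assms in \<open>auto simp: prob_space_measure_pmf\<close>)

subsection \<open>Forgetting\<close>

text \<open>A run of \<open>L\<close> zero outputs decouples past and future: \<open>settled j \<phi>\<close> says that \<open>\<phi>\<close> ignores everything
  behind the first such run to the right of the window of \<open>j\<close>.\<close>

definition settled :: "int \<Rightarrow> ((int \<Rightarrow> nat) \<Rightarrow> real) \<Rightarrow> bool" where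
  "settled j \<phi> \<longleftrightarrow> (\<forall>t y y'. j + int L \<le> t \<longrightarrow> (\<forall>k\<le>t + int L. y k = y' k) \<longrightarrow>
     (\<forall>k\<in>{t + 1..t + int L}. y k = 0) \<longrightarrow> \<phi> y = \<phi> y')"

text \<open>Halving the probability bound for a run of zeros keeps \<open>theta\<close> positive for
  \<open>L = 0\<close> too, where \<open>exp (- peak * real L)\<close> equals 1; its root is a
  denominator later.\<close>

definition theta :: real where "theta = 1 - exp (- peak * real L) / 2"

lemma theta: "0 < theta" "theta < 1"
proof -
  have "exp (- peak * real L) \<le> 1" using peak_pos by simp
  then show "0 < theta" unfolding theta_def by linarith
qed (simp add: theta_def)

text \<open>Candidate places for a run of zeros, starting just after the window of \<open>j\<close>.
  The period \<open>L + 1\<close> leaves one position between successive blocks.\<close>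

definition blk :: "int \<Rightarrow> nat \<Rightarrow> int set" where
  "blk j b = {j + int L + int b * (int L + 1) + 1..j + int L + int b * (int L + 1) + int L}"

text \<open>Values in \<open>ennreal\<close> let products be integrated by independence without
  integrability conditions. For \<open>L = 0\<close> the blocks are empty and none of them is
  busy.\<close>

definition busy :: "int \<Rightarrow> nat \<Rightarrow> (int \<Rightarrow> nat) \<Rightarrow> ennreal" where
  "busy j b y = (if \<forall>k\<in>blk j b. y k = 0 then 0 else 1)"

lemma measurable_busy [measurable]: "busy j b \<in> borel_measurable SY"
proof -
  have "finite (blk j b)" by (simp add: blk_def)
  then show ?thesis unfolding busy_def by measurable
qed

lemma nn_integral_busy:
  assumes "x \<in> inputs"
  shows "(\<integral>\<^sup>+y. busy j b y \<partial>K x) \<le> ennreal theta"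
proof -
  interpret prob_space "K x" by (rule prob_K)
  define v where "v y = (\<Prod>k\<in>blk j b. indicator {0} (y k) :: ennreal)" for y :: "int \<Rightarrow> nat"
  have fin: "finite (blk j b)" by (simp add: blk_def)
  have v: "v y = (if \<forall>k\<in>blk j b. y k = 0 then 1 else 0)" for y
    using fin by (auto simp: v_def prod_zero_iff indicator_def)
  have [measurable]: "v \<in> borel_measurable SY"
    unfolding v_def
    by (intro borel_measurable_prod_ennreal measurable_compose[OF measurable_component_singleton]) auto
  have cb: "card (blk j b) = L" by (simp add: blk_def)
  have pz: "pmf (poisson_pmf (Z x k)) 0 = exp (- Z x k)" for k
    using Z_pos[OF assms] by simp
  have "(\<integral>\<^sup>+y. v y \<partial>K x) = (\<Prod>k\<in>blk j b. \<integral>\<^sup>+n. indicator {0} n \<partial>measure_pmf (poisson_pmf (Z x k)))"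
    unfolding output_kernel_def v_def
    by (rule nn_integral_PiM_prod) (use fin prob_space_measure_pmf in auto)
  also have "\<dots> = (\<Prod>k\<in>blk j b. ennreal (exp (- Z x k)))"
    by (intro prod.cong) (simp_all add: emeasure_pmf_single pz)
  also have "\<dots> = ennreal (\<Prod>k\<in>blk j b. exp (- Z x k))" by (simp add: prod_ennreal)
  finally have eq: "(\<integral>\<^sup>+y. v y \<partial>K x) = ennreal (\<Prod>k\<in>blk j b. exp (- Z x k))" .
  \<comment> \<open>Every output is zero with probability at least \<open>exp (- peak)\<close>, and
    the block has \<open>L\<close> of them; the inputs do not matter.\<close>
  have "(\<Prod>k\<in>blk j b. exp (- peak)) \<le> (\<Prod>k\<in>blk j b. exp (- Z x k))"
    using Z_upper[OF assms] by (intro prod_mono) auto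
  then have ge: "exp (- peak * real L) \<le> (\<Prod>k\<in>blk j b. exp (- Z x k))"
    by (simp add: cb exp_of_nat_mult[symmetric] mult.commute)
  have "(\<integral>\<^sup>+y. busy j b y \<partial>K x) + (\<integral>\<^sup>+y. v y \<partial>K x) = (\<integral>\<^sup>+y. busy j b y + v y \<partial>K x)"
    by (rule nn_integral_add[symmetric]) measurable
  also have "(\<lambda>y. busy j b y + v y) = (\<lambda>y. 1)" by (auto simp: v busy_def)
  finally have "(\<integral>\<^sup>+y. busy j b y \<partial>K x) + ennreal (\<Prod>k\<in>blk j b. exp (- Z x k)) = 1"
    by (simp add: eq emeasure_space_1[simplified])
  then have "(\<integral>\<^sup>+y. busy j b y \<partial>K x) = 1 - ennreal (\<Prod>k\<in>blk j b. exp (- Z x k))"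
    by (metis ennreal_add_diff_cancel_right ennreal_neq_top)
  also have "\<dots> = ennreal (1 - (\<Prod>k\<in>blk j b. exp (- Z x k)))"
    by (subst ennreal_1[symmetric], subst ennreal_minus) (auto intro: prod_nonneg)
  also have "\<dots> \<le> ennreal theta"
    using ge by (intro ennreal_leI) (simp add: theta_def, smt (verit) exp_gt_zero)
  finally show ?thesis .
qed

text \<open>The window and the earlier blocks all end before the next block begins, so independence
  yields one factor \<open>theta\<close> per block.\<close>

lemma nn_integral_all_busy:
  assumes "x \<in> inputs" "r \<ge> 1"
  shows "(\<integral>\<^sup>+y. ennreal (r ^ (\<Sum>k\<in>win j. y k)) * (\<Prod>b<B. busy j b y) \<partial>K x)
    \<le> ennreal (mgf r ^ (L + 1) * theta ^ B)"
proof (induction B)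
  case 0
  then show ?case using nn_integral_growth_weight[OF assms(1) finite_win assms(2)] by simp
next
  case (Suc B)
  let ?u = "\<lambda>y. ennreal (r ^ (\<Sum>k\<in>win j. y k)) * (\<Prod>b<B. busy j b y)"
  have "(\<integral>\<^sup>+y. ?u y * busy j B y \<partial>K x) = (\<integral>\<^sup>+y. ?u y \<partial>K x) * (\<integral>\<^sup>+y. busy j B y \<partial>K x)"
    unfolding output_kernel_def
  proof (rule nn_integral_PiM_mult[where I="{..j + int L + int B * (int L + 1)}" and J="blk j B"])
    have s: "sets (\<Pi>\<^sub>M k\<in>UNIV. measure_pmf (poisson_pmf (Z x k))) = sets SY"
      using sets_K[of x] by (simp add: output_kernel_def)
    show "?u \<in> borel_measurable (\<Pi>\<^sub>M k\<in>UNIV. measure_pmf (poisson_pmf (Z x k)))"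
      unfolding measurable_cong_sets[OF s refl] by measurable
    show "busy j B \<in> borel_measurable (\<Pi>\<^sub>M k\<in>UNIV. measure_pmf (poisson_pmf (Z x k)))"
      unfolding measurable_cong_sets[OF s refl] by measurable
    show "depends_on (blk j B) (busy j B)"
      by (rule depends_onI) (simp add: busy_def)
    show "depends_on {..j + int L + int B * (int L + 1)} ?u"
    proof (rule depends_onI)
      fix y y' :: "int \<Rightarrow> nat"
      assume eq: "\<And>i. i \<in> {..j + int L + int B * (int L + 1)} \<Longrightarrow> y i = y' i"
      have "(\<Sum>k\<in>win j. y k) = (\<Sum>k\<in>win j. y' k)"
      proof (rule sum.cong[OF refl], rule eq)
        fix k assume "k \<in> win j"
        moreover have "0 \<le> int B * (int L + 1)" by simp
        ultimately show "k \<in> {..j + int L + int B * (int L + 1)}"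
          unfolding win_def atMost_iff atLeastAtMost_iff by linarith
      qed
      moreover have "busy j b y = busy j b y'" if "b < B" for b
      proof -
        have "(int b + 1) * (int L + 1) \<le> int B * (int L + 1)"
          using that by (intro mult_right_mono) auto
        then have "\<forall>k\<in>blk j b. y k = y' k"
          by (auto simp: blk_def algebra_simps intro!: eq)
        then show ?thesis by (simp add: busy_def)
      qed
      ultimately show "?u y = ?u y'" by simp
    qed
  qed (auto simp: prob_space_measure_pmf blk_def)
  also have "\<dots> \<le> ennreal (mgf r ^ (L + 1) * theta ^ B) * ennreal theta"
    by (intro mult_mono Suc.IH nn_integral_busy assms) auto
  also have "\<dots> = ennreal (mgf r ^ (L + 1) * theta ^ Suc B)"
    using theta by (simp add: ennreal_mult[symmetric] mgf_def ac_simps)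
  finally show ?case by (simp add: ac_simps)
qed

text \<open>Zeroing the outputs in the window of \<open>i\<close> turns \<open>\<phi>\<close> into a
  function whose mean does not react to input \<open>i\<close>. The two functions differ only if
  every block between the window of \<open>j\<close> and \<open>i\<close> is busy. Each of the two
  inputs contributes an error of \<open>2 * c\<close> times the weight, hence the factor 4.\<close>

lemma influence_decay_blocks:
  assumes x: "x \<in> inputs" and t: "0 \<le> t" "t \<le> A" and "r \<ge> 1" "c \<ge> 0"
    and g: "growth (win j) c r \<phi>" and s: "settled j \<phi>"
  shows "\<bar>(\<integral>y. \<phi> y \<partial>K x) - (\<integral>y. \<phi> y \<partial>K (x(i := t)))\<bar>
    \<le> 4 * c * mgf r ^ (L + 1) * theta ^ (nat (i - j - int L) div (L + 1))"
proof -
  \<comment> \<open>Counts the blocks that end before \<open>i\<close>.\<close>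
  define B where "B = nat (i - j - int L) div (L + 1)"
  define \<phi>0 where "\<phi>0 y = \<phi> (glue (- win i) y (\<lambda>_. 0))" for y
  have gm: "(\<lambda>y. glue (- win i) y (\<lambda>_. 0)) \<in> SY \<rightarrow>\<^sub>M SY"
    by (rule measurable_PiM_single') (auto simp: glue_def space_PiM)
  have \<phi>m: "\<phi> \<in> borel_measurable SY" and \<phi>b: "\<bar>\<phi> y\<bar> \<le> c * r ^ (\<Sum>k\<in>win j. y k)" for y
    using g by (auto simp: growth_def)
  have \<phi>0m: "\<phi>0 \<in> borel_measurable SY"
    unfolding \<phi>0_def by (rule measurable_compose[OF gm \<phi>m])
  have \<phi>0b: "\<bar>\<phi>0 y\<bar> \<le> c * r ^ (\<Sum>k\<in>win j. y k)" for y
  proof -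
    have "(\<Sum>k\<in>win j. glue (- win i) y (\<lambda>_. 0) k) \<le> (\<Sum>k\<in>win j. y k)"
      by (rule sum_mono) (auto simp: glue_def)
    then have "c * r ^ (\<Sum>k\<in>win j. glue (- win i) y (\<lambda>_. 0) k) \<le> c * r ^ (\<Sum>k\<in>win j. y k)"
      using assms by (intro mult_left_mono power_increasing) auto
    then show ?thesis using \<phi>b unfolding \<phi>0_def by (meson order_trans)
  qed
  have g0: "growth (win j) c r \<phi>0" using \<phi>0m \<phi>0b by (simp add: growth_def)
  have diff: "ennreal \<bar>\<phi> y - \<phi>0 y\<bar> \<le> ennreal (2 * c) * (ennreal (r ^ (\<Sum>k\<in>win j. y k)) * (\<Prod>b<B. busy j b y))" for y
  proof (cases "\<exists>b<B. busy j b y = 0")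
    case True
    then obtain b where b: "b < B" "busy j b y = 0" by blast
    have "B * (L + 1) \<le> nat (i - j - int L)" unfolding B_def by (rule div_times_less_eq_dividend)
    moreover have "0 < B * (L + 1)" using b by simp
    ultimately have "int (B * (L + 1)) \<le> i - j - int L" by linarith
    then have "int B * (int L + 1) \<le> i - j - int L" by (simp add: algebra_simps)
    moreover have "(int b + 1) * (int L + 1) \<le> int B * (int L + 1)"
      using b by (intro mult_right_mono) auto
    ultimately have i: "j + int L + int b * (int L + 1) + int L < i" by (simp add: algebra_simps)
    \<comment> \<open>The zeroed outputs start at \<open>i\<close>, strictly to the right of the
      quiet block, so \<open>settled\<close> applies with that block as the run.\<close>
    have "\<phi> y = \<phi>0 y" unfolding \<phi>0_def
      using s[unfolded settled_def, rule_format, of "j + int L + int b * (int L + 1)" y "glue (- win i) y (\<lambda>_. 0)"] b i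
      by (auto simp: busy_def blk_def glue_def win_def split: if_splits)
    then show ?thesis by simp
  next
    case False
    then have "(\<Prod>b<B. busy j b y) = 1"
      by (intro prod.neutral) (auto simp: busy_def split: if_splits)
    moreover have "\<bar>\<phi> y - \<phi>0 y\<bar> \<le> 2 * c * r ^ (\<Sum>k\<in>win j. y k)"
      using \<phi>b[of y] \<phi>0b[of y] by linarith
    ultimately show ?thesis using assms by (simp add: ennreal_mult[symmetric] ennreal_leI)
  qed
  have close: "\<bar>(\<integral>y. \<phi> y \<partial>K x') - (\<integral>y. \<phi>0 y \<partial>K x')\<bar> \<le> 2 * c * (mgf r ^ (L + 1) * theta ^ B)"
    if x': "x' \<in> inputs" for x'
  proof -
    note i = growth_integral(1)[OF x' finite_win assms(4,5) g] growth_integral(1)[OF x' finite_win assms(4,5) g0]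
    have "ennreal \<bar>\<integral>y. \<phi> y - \<phi>0 y \<partial>K x'\<bar> \<le> (\<integral>\<^sup>+y. ennreal \<bar>\<phi> y - \<phi>0 y\<bar> \<partial>K x')"
      using integral_norm_bound_ennreal[OF Bochner_Integration.integrable_diff[OF i]] by simp
    also have "\<dots> \<le> (\<integral>\<^sup>+y. ennreal (2 * c) * (ennreal (r ^ (\<Sum>k\<in>win j. y k)) * (\<Prod>b<B. busy j b y)) \<partial>K x')"
      by (intro nn_integral_mono diff)
    also have "\<dots> = ennreal (2 * c) * (\<integral>\<^sup>+y. ennreal (r ^ (\<Sum>k\<in>win j. y k)) * (\<Prod>b<B. busy j b y) \<partial>K x')"
      by (intro nn_integral_cmult) (unfold measurable_cong_sets[OF sets_K refl], measurable)
    also have "\<dots> \<le> ennreal (2 * c) * ennreal (mgf r ^ (L + 1) * theta ^ B)"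
      by (intro mult_left_mono nn_integral_all_busy x' assms) auto
    also have "\<dots> = ennreal (2 * c * (mgf r ^ (L + 1) * theta ^ B))"
      using assms theta by (simp add: ennreal_mult[symmetric] mgf_def)
    finally show ?thesis using i assms theta by (simp add: mgf_def)
  qed
  have "(\<integral>y. \<phi>0 y \<partial>K x) = (\<integral>y. \<phi>0 y \<partial>K (x(i := t)))"
  proof (rule integral_K_cong[OF \<phi>0m])
    show "depends_on (- win i) \<phi>0"
    proof (rule depends_onI)
      fix y y' :: "int \<Rightarrow> nat" assume "\<And>k. k \<in> - win i \<Longrightarrow> y k = y' k"
      then have "glue (- win i) y (\<lambda>_. 0) = glue (- win i) y' (\<lambda>_. 0)" by (auto simp: glue_def)
      then show "\<phi>0 y = \<phi>0 y'" by (simp add: \<phi>0_def)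
    qed
  qed (simp add: Z_upd_outside)
  then show ?thesis
    using close[OF x] close[OF inputs_upd[OF x t, of i]] unfolding B_def[symmetric] by linarith
qed

text \<open>Distributes the decay of one block evenly over its period of \<open>L + 1\<close>
  positions.\<close>

definition rho :: real where "rho = root (L + 1) theta"

lemma rho: "0 < rho" "rho < 1"
  using theta by (auto simp: rho_def real_root_gt_zero real_root_lt_1_iff)

text \<open>Rounding down to whole blocks loses at most \<open>L\<close> positions and the window
  itself another \<open>L\<close>; dividing by \<open>rho ^ (2 * L + 1)\<close> pays for
  both.\<close>

lemma theta_power_le: "theta ^ (nat (i - j - int L) div (L + 1)) \<le> rho ^ nat (i - j) / rho ^ (2 * L + 1)"
proof -
  have "theta = rho ^ (L + 1)" using theta by (simp add: rho_def real_root_pow_pos2 del: power_Suc)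
  then have "theta ^ (nat (i - j - int L) div (L + 1)) * rho ^ (2 * L + 1)
      = rho ^ ((L + 1) * (nat (i - j - int L) div (L + 1)) + (2 * L + 1))"
    by (simp only: power_mult power_add)
  also have "\<dots> \<le> rho ^ nat (i - j)"
  proof (rule power_decreasing)
    have "nat (i - j - int L) = (L + 1) * (nat (i - j - int L) div (L + 1)) + nat (i - j - int L) mod (L + 1)"
      by (rule mult_div_mod_eq[symmetric])
    moreover have "nat (i - j - int L) mod (L + 1) < L + 1" by (rule mod_less_divisor) simp
    ultimately show "nat (i - j) \<le> (L + 1) * (nat (i - j - int L) div (L + 1)) + (2 * L + 1)" by linarith
  qed (use rho in auto)
  finally show ?thesis using rho by (simp add: field_simps)
qed

text \<open>Joins the constant of the block estimate with the price of passing from blocks to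
  positions.\<close>

definition decay :: "real \<Rightarrow> real \<Rightarrow> real" where
  "decay c r = 4 * c * mgf r ^ (L + 1) / rho ^ (2 * L + 1)"

lemma decay_nonneg: "c \<ge> 0 \<Longrightarrow> decay c r \<ge> 0"
  using rho by (simp add: decay_def mgf_def)

text \<open>For \<open>i\<close> at or before \<open>j\<close> the exponent is truncated to zero, so
  the estimate holds without decay. The relative entropy bound uses this at
  \<open>i = j\<close>.\<close>

lemma influence_decay:
  assumes "x \<in> inputs" "0 \<le> t" "t \<le> A" "r \<ge> 1" "c \<ge> 0" "growth (win j) c r \<phi>" "settled j \<phi>"
  shows "\<bar>(\<integral>y. \<phi> y \<partial>K x) - (\<integral>y. \<phi> y \<partial>K (x(i := t)))\<bar> \<le> decay c r * rho ^ nat (i - j)"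
proof -
  have "4 * c * mgf r ^ (L + 1) * theta ^ (nat (i - j - int L) div (L + 1))
      \<le> 4 * c * mgf r ^ (L + 1) * (rho ^ nat (i - j) / rho ^ (2 * L + 1))"
    using assms by (intro mult_left_mono theta_power_le) (auto simp: mgf_def)
  then show ?thesis using influence_decay_blocks[OF assms, of i] by (simp add: decay_def)
qed

lemma sum_rho_le:
  assumes "finite I" "\<And>i. i \<in> I \<Longrightarrow> i \<ge> j"
  shows "(\<Sum>i\<in>I. rho ^ nat (i - j)) \<le> 1 / (1 - rho)"
proof -
  have "inj_on (\<lambda>i. nat (i - j)) I"
  proof (rule inj_onI)
    fix x y assume "x \<in> I" "y \<in> I" "nat (x - j) = nat (y - j)"
    then show "x = y" using assms(2)[of x] assms(2)[of y] by linarith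
  qed
  then have "(\<Sum>i\<in>I. rho ^ nat (i - j)) = (\<Sum>n\<in>(\<lambda>i. nat (i - j)) ` I. rho ^ n)"
    by (simp add: sum.reindex)
  also have "\<dots> \<le> (\<Sum>n. rho ^ n)"
    using assms rho by (intro sum_le_suminf summable_geometric) auto
  also have "\<dots> = 1 / (1 - rho)" using rho by (intro suminf_geometric) auto
  finally show ?thesis .
qed

lemma sum_rho_le':
  assumes "finite I" "\<And>i. i \<in> I \<Longrightarrow> i \<le> j"
  shows "(\<Sum>i\<in>I. rho ^ nat (j - i)) \<le> 1 / (1 - rho)"
proof -
  have "inj_on (\<lambda>i. nat (j - i)) I"
  proof (rule inj_onI)
    fix x y assume "x \<in> I" "y \<in> I" "nat (j - x) = nat (j - y)"
    then show "x = y" using assms(2)[of x] assms(2)[of y] by linarith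
  qed
  then have "(\<Sum>i\<in>I. rho ^ nat (j - i)) = (\<Sum>n\<in>(\<lambda>i. nat (j - i)) ` I. rho ^ n)"
    by (simp add: sum.reindex)
  also have "\<dots> \<le> (\<Sum>n. rho ^ n)"
    using assms rho by (intro sum_le_suminf summable_geometric) auto
  also have "\<dots> = 1 / (1 - rho)" using rho by (intro suminf_geometric) auto
  finally show ?thesis .
qed

end

section \<open>Integrals against a mixture\<close>

text \<open>Sampling from a mixture means tossing a coin and then sampling from the chosen law;
  integration over \<open>bind\<close> then applies.\<close>

lemma mixture_eq_bind:
  assumes F: "F \<in> input_laws A" and G: "G \<in> input_laws A" and e: "0 \<le> \<epsilon>" "\<epsilon> \<le> 1"
  shows "mixture \<epsilon> F G = measure_pmf (bernoulli_pmf \<epsilon>) \<bind> (\<lambda>b. if b then G else F)"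
proof (rule measure_eqI)
  have S: "sets G = sets F" using input_lawsD[OF F] input_lawsD[OF G] by simp
  have m: "(\<lambda>b. if b then G else F) \<in> measure_pmf (bernoulli_pmf \<epsilon>) \<rightarrow>\<^sub>M subprob_algebra F"
    using input_lawsD[OF F] input_lawsD[OF G] S
    by (auto simp: space_subprob_algebra prob_space_imp_subprob_space)
  show "sets (mixture \<epsilon> F G) = sets (measure_pmf (bernoulli_pmf \<epsilon>) \<bind> (\<lambda>b. if b then G else F))"
    using S by (subst sets_bind[where N=F]) auto
  fix B assume "B \<in> sets (mixture \<epsilon> F G)"
  then have B: "B \<in> sets F" by simp
  show "emeasure (mixture \<epsilon> F G) B = emeasure (measure_pmf (bernoulli_pmf \<epsilon>) \<bind> (\<lambda>b. if b then G else F)) B"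
    using e by (simp add: emeasure_mixture[OF S B] emeasure_bind[OF _ m B] ac_simps)
qed

lemma integral_mixture:
  fixes f :: "real \<Rightarrow> real"
  assumes F: "F \<in> input_laws A" and G: "G \<in> input_laws A" and e: "0 \<le> \<epsilon>" "\<epsilon> \<le> 1"
    and f: "f \<in> borel_measurable (input_space A)" and C: "\<And>t. 0 \<le> t \<Longrightarrow> t \<le> A \<Longrightarrow> \<bar>f t\<bar> \<le> C"
  shows "(\<integral>t. f t \<partial>mixture \<epsilon> F G) = (1 - \<epsilon>) * (\<integral>t. f t \<partial>F) + \<epsilon> * (\<integral>t. f t \<partial>G)"
proof -
  \<comment> \<open>Adding the bound \<open>C\<close> makes the integrand nonnegative, so that the
    identity can be derived in \<open>ennreal\<close> and shifted back.\<close>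
  have i: "integrable H (\<lambda>t. f t + C)" and nn: "(\<integral>\<^sup>+t. ennreal (f t + C) \<partial>H) = ennreal ((\<integral>t. f t \<partial>H) + C)"
    and p: "0 \<le> (\<integral>t. f t \<partial>H) + C"
    if H: "H \<in> input_laws A" for H
  proof -
    note HD = input_lawsD[OF H]
    interpret prob_space H by (rule HD(1))
    have "integrable H f"
      by (rule integrable_const_bound[where B=C])
         (use f C HD in \<open>auto cong: measurable_cong_sets intro!: AE_I2\<close>)
    then show i: "integrable H (\<lambda>t. f t + C)" by simp
    have eq: "(\<integral>t. f t + C \<partial>H) = (\<integral>t. f t \<partial>H) + C"
      using \<open>integrable H f\<close> by (simp add: prob_space)
    have ge: "AE t in H. 0 \<le> f t + C"
      using C HD by (intro AE_I2) (auto, smt (verit))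
    show "(\<integral>\<^sup>+t. ennreal (f t + C) \<partial>H) = ennreal ((\<integral>t. f t \<partial>H) + C)"
      unfolding eq[symmetric] by (rule nn_integral_eq_integral[OF i ge])
    show "0 \<le> (\<integral>t. f t \<partial>H) + C" unfolding eq[symmetric] by (rule integral_nonneg_AE[OF ge])
  qed
  have m: "(\<lambda>b. if b then G else F) \<in> measure_pmf (bernoulli_pmf \<epsilon>) \<rightarrow>\<^sub>M subprob_algebra (input_space A)"
    using input_lawsD[OF F] input_lawsD[OF G]
    by (auto simp: space_subprob_algebra prob_space_imp_subprob_space)
  note M = mixture_in_input_laws[OF F G e]
  have "ennreal ((\<integral>t. f t \<partial>mixture \<epsilon> F G) + C) = (\<integral>\<^sup>+t. ennreal (f t + C) \<partial>mixture \<epsilon> F G)"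
    by (simp add: nn[OF M])
  also have "\<dots> = ennreal ((\<integral>t. f t \<partial>G) + C) * ennreal \<epsilon> + ennreal ((\<integral>t. f t \<partial>F) + C) * ennreal (1 - \<epsilon>)"
    unfolding mixture_eq_bind[OF F G e] using f e by (subst nn_integral_bind[OF _ m]) (simp_all add: nn F G)
  also have "\<dots> = ennreal (((\<integral>t. f t \<partial>G) + C) * \<epsilon> + ((\<integral>t. f t \<partial>F) + C) * (1 - \<epsilon>))"
    using e p[OF F] p[OF G] by (simp add: ennreal_mult[symmetric] ennreal_plus[symmetric] del: ennreal_plus)
  finally have "(\<integral>t. f t \<partial>mixture \<epsilon> F G) + C = ((\<integral>t. f t \<partial>G) + C) * \<epsilon> + ((\<integral>t. f t \<partial>F) + C) * (1 - \<epsilon>)"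
    using e p[OF F] p[OF G] p[OF M] by (subst (asm) ennreal_inj) auto
  then show ?thesis by (simp add: algebra_simps)
qed

section \<open>Independent inputs with site-dependent laws\<close>

context poisson_channel
begin

text \<open>Laws may vary with the site because intermediate configurations carry the mixture at
  some sites and \<open>F\<close> at others.\<close>

definition laws :: "(int \<Rightarrow> real measure) \<Rightarrow> bool" where
  "laws \<sigma> \<longleftrightarrow> (\<forall>k. \<sigma> k \<in> input_laws A)"

lemma laws_upd: "laws \<sigma> \<Longrightarrow> G \<in> input_laws A \<Longrightarrow> laws (\<sigma>(j := G))"
  by (simp add: laws_def)

lemma lawsD:
  assumes "laws \<sigma>"
  shows "prob_space (\<sigma> k)" "sets (\<sigma> k) = sets (input_space A)" "space (\<sigma> k) = {0..A}"
  using assms input_lawsD unfolding laws_def by blast+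

lemma prob_PX: "laws \<sigma> \<Longrightarrow> prob_space (PiM UNIV \<sigma>)"
  by (intro prob_space_PiM lawsD)

lemma sets_PX: "laws \<sigma> \<Longrightarrow> sets (PiM UNIV \<sigma>) = sets SX"
  by (intro sets_PiM_cong lawsD refl)

lemma space_PX: "laws \<sigma> \<Longrightarrow> space (PiM UNIV \<sigma>) = inputs"
  using sets_eq_imp_space_eq[OF sets_PX] space_SX by simp

text \<open>Boundedness on admissible sequences gives integrability under every family of input laws
  and survives fixing or averaging one input.\<close>

definition tame :: "((int \<Rightarrow> real) \<Rightarrow> real) \<Rightarrow> bool" where
  "tame \<Phi> \<longleftrightarrow> \<Phi> \<in> borel_measurable SX \<and> (\<exists>C. \<forall>x\<in>inputs. \<bar>\<Phi> x\<bar> \<le> C)"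

lemma tameI: "\<Phi> \<in> borel_measurable SX \<Longrightarrow> (\<And>x. x \<in> inputs \<Longrightarrow> \<bar>\<Phi> x\<bar> \<le> C) \<Longrightarrow> tame \<Phi>"
  unfolding tame_def by blast

lemma tame_measurable: "tame \<Phi> \<Longrightarrow> laws \<sigma> \<Longrightarrow> \<Phi> \<in> borel_measurable (PiM UNIV \<sigma>)"
  by (simp add: tame_def sets_PX cong: measurable_cong_sets)

lemma tame_integrable:
  assumes "tame \<Phi>" "laws \<sigma>"
  shows "integrable (PiM UNIV \<sigma>) \<Phi>"
proof -
  interpret prob_space "PiM UNIV \<sigma>" by (rule prob_PX[OF assms(2)])
  obtain C where "\<forall>x\<in>inputs. \<bar>\<Phi> x\<bar> \<le> C" using assms(1) by (auto simp: tame_def)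
  then show ?thesis
    using tame_measurable[OF assms] space_PX[OF assms(2)]
    by (intro integrable_const_bound[where B=C]) auto
qed

lemma tame_integral_bound:
  assumes "tame \<Phi>" "laws \<sigma>" "\<And>x. x \<in> inputs \<Longrightarrow> \<bar>\<Phi> x\<bar> \<le> C"
  shows "\<bar>\<integral>x. \<Phi> x \<partial>PiM UNIV \<sigma>\<bar> \<le> C"
proof -
  interpret prob_space "PiM UNIV \<sigma>" by (rule prob_PX[OF assms(2)])
  have "\<bar>\<integral>x. \<Phi> x \<partial>PiM UNIV \<sigma>\<bar> \<le> (\<integral>x. \<bar>\<Phi> x\<bar> \<partial>PiM UNIV \<sigma>)" by (rule integral_abs_bound)
  also have "\<dots> \<le> C"
    using tame_integrable[OF assms(1,2)] assms(3) space_PX[OF assms(2)]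
    by (intro integral_le_const) auto
  finally show ?thesis .
qed

lemma tame_diff: "tame \<Phi> \<Longrightarrow> tame \<Psi> \<Longrightarrow> tame (\<lambda>x. \<Phi> x - \<Psi> x)"
  unfolding tame_def
  by (elim conjE exE, intro conjI borel_measurable_diff, assumption, assumption)
     (metis abs_triangle_ineq4 add_mono order_trans)

lemma measurable_fun_upd_input:
  "(\<lambda>p. (fst p)(j := snd p)) \<in> SX \<Otimes>\<^sub>M input_space A \<rightarrow>\<^sub>M SX"
proof (rule measurable_PiM_single')
  show "(\<lambda>p. ((fst p)(j := snd p)) i) \<in> SX \<Otimes>\<^sub>M input_space A \<rightarrow>\<^sub>M input_space A" for i
    by (cases "i = j") simp_all
qed (auto simp: space_pair_measure space_PiM PiE_iff)

lemma tame_joint_measurable: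
  "tame \<Phi> \<Longrightarrow> (\<lambda>p. \<Phi> ((fst p)(j := snd p))) \<in> borel_measurable (SX \<Otimes>\<^sub>M input_space A)"
  unfolding tame_def by (intro measurable_compose[OF measurable_fun_upd_input]) auto

lemma tame_slice_measurable:
  assumes "tame \<Phi>" "x \<in> inputs"
  shows "(\<lambda>t. \<Phi> (x(j := t))) \<in> borel_measurable (input_space A)"
proof -
  have "(\<lambda>t. (x, t)) \<in> input_space A \<rightarrow>\<^sub>M SX \<Otimes>\<^sub>M input_space A"
    using assms by (intro measurable_Pair) (auto simp: space_SX)
  from measurable_compose[OF this tame_joint_measurable[OF assms(1), of j]] show ?thesis by simp
qed

lemma tame_upd:
  assumes "tame \<Phi>" "0 \<le> t" "t \<le> A"
  shows "tame (\<lambda>x. \<Phi> (x(j := t)))"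
proof -
  obtain C where C: "\<forall>x\<in>inputs. \<bar>\<Phi> x\<bar> \<le> C" using assms(1) by (auto simp: tame_def)
  have "(\<lambda>x. (x, t)) \<in> SX \<rightarrow>\<^sub>M SX \<Otimes>\<^sub>M input_space A"
    using assms by (intro measurable_Pair) (auto simp: space_input_space)
  from measurable_compose[OF this tame_joint_measurable[OF assms(1), of j]]
  show ?thesis using C assms by (intro tameI[where C=C]) (auto simp: inputs_upd)
qed

text \<open>Take all coordinates except \<open>j\<close> from \<open>\<sigma>\<close> and coordinate
  \<open>j\<close> from the updated family: what remains is one fresh draw from
  \<open>G\<close>.\<close>

lemma integral_upd:
  assumes \<Phi>: "tame \<Phi>" and \<sigma>: "laws \<sigma>" and G: "G \<in> input_laws A"
  shows "(\<integral>x. \<Phi> x \<partial>PiM UNIV (\<sigma>(j := G))) = (\<integral>x. \<integral>t. \<Phi> (x(j := t)) \<partial>G \<partial>PiM UNIV \<sigma>)"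
proof -
  note \<sigma>' = laws_upd[OF \<sigma> G, of j]
  have eq: "\<sigma>(j := G) = (\<lambda>i. if i \<in> - {j} then \<sigma> i else (\<sigma>(j := G)) i)" by auto
  have "(\<integral>x. \<Phi> x \<partial>PiM UNIV (\<sigma>(j := G)))
      = (\<integral>x. \<integral>x'. \<Phi> (glue (- {j}) x x') \<partial>PiM UNIV (\<sigma>(j := G)) \<partial>PiM UNIV \<sigma>)"
    by (subst eq, subst integral_glue[where S="\<lambda>_. input_space A"])
       (use lawsD[OF \<sigma>] lawsD[OF \<sigma>'] tame_integrable[OF \<Phi> \<sigma>'] eq[symmetric] in simp_all)
  also have "\<dots> = (\<integral>x. \<integral>x'. \<Phi> (x(j := x' j)) \<partial>PiM UNIV (\<sigma>(j := G)) \<partial>PiM UNIV \<sigma>)"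
  proof -
    have "glue (- {j}) x x' = x(j := x' j)" for x x' :: "int \<Rightarrow> real" by (auto simp: glue_def)
    then show ?thesis by simp
  qed
  also have "\<dots> = (\<integral>x. \<integral>t. \<Phi> (x(j := t)) \<partial>G \<partial>PiM UNIV \<sigma>)"
  proof (rule Bochner_Integration.integral_cong[OF refl])
    fix x assume "x \<in> space (PiM UNIV \<sigma>)"
    then have "(\<lambda>t. \<Phi> (x(j := t))) \<in> borel_measurable ((\<sigma>(j := G)) j)"
      using tame_slice_measurable[OF \<Phi>, of x j] space_PX[OF \<sigma>] input_lawsD[OF G]
      by (simp cong: measurable_cong_sets)
    from integral_PiM_component[where M="\<sigma>(j := G)" and k=j, OF lawsD(1)[OF \<sigma>'] this]
    show "(\<integral>x'. \<Phi> (x(j := x' j)) \<partial>PiM UNIV (\<sigma>(j := G))) = (\<integral>t. \<Phi> (x(j := t)) \<partial>G)" by simp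
  qed
  finally show ?thesis .
qed

lemma tame_integral_slice:
  assumes \<Phi>: "tame \<Phi>" and G: "G \<in> input_laws A"
  shows "tame (\<lambda>x. \<integral>t. \<Phi> (x(j := t)) \<partial>G)"
proof -
  interpret prob_space G by (rule input_lawsD[OF G])
  obtain C where C: "\<forall>x\<in>inputs. \<bar>\<Phi> x\<bar> \<le> C" using assms(1) by (auto simp: tame_def)
  have "sets (SX \<Otimes>\<^sub>M G) = sets (SX \<Otimes>\<^sub>M input_space A)" using input_lawsD[OF G] by (intro sets_pair_measure_cong) auto
  then have "(\<lambda>p. \<Phi> ((fst p)(j := snd p))) \<in> borel_measurable (SX \<Otimes>\<^sub>M G)"
    using tame_joint_measurable[OF \<Phi>, of j] by (simp cong: measurable_cong_sets)
  from borel_measurable_lebesgue_integral[of "\<lambda>x t. \<Phi> (x(j := t))" SX] this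
  have m: "(\<lambda>x. \<integral>t. \<Phi> (x(j := t)) \<partial>G) \<in> borel_measurable SX" by (simp add: case_prod_beta)
  show ?thesis
  proof (rule tameI[OF m, where C=C])
    fix x assume x: "x \<in> inputs"
    have b: "AE t in G. \<bar>\<Phi> (x(j := t))\<bar> \<le> C"
      using C input_lawsD[OF G] inputs_upd[OF x] by (intro AE_I2) auto
    have mm: "(\<lambda>t. \<Phi> (x(j := t))) \<in> borel_measurable G"
      using tame_slice_measurable[OF \<Phi> x, of j] input_lawsD[OF G] by (simp cong: measurable_cong_sets)
    have "integrable G (\<lambda>t. \<Phi> (x(j := t)))"
      by (rule integrable_const_bound[where B=C]) (use b mm in auto)
    then have "(\<integral>t. \<bar>\<Phi> (x(j := t))\<bar> \<partial>G) \<le> C" using b by (intro integral_le_const) auto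
    then show "\<bar>\<integral>t. \<Phi> (x(j := t)) \<partial>G\<bar> \<le> C"
      using integral_abs_bound[of G "\<lambda>t. \<Phi> (x(j := t))"] by linarith
  qed
qed

lemma integral_upd_swap:
  assumes \<Phi>: "tame \<Phi>" and \<sigma>: "laws \<sigma>" and G: "G \<in> input_laws A"
  shows "(\<integral>x. \<Phi> x \<partial>PiM UNIV (\<sigma>(j := G))) = (\<integral>t. \<integral>x. \<Phi> (x(j := t)) \<partial>PiM UNIV \<sigma> \<partial>G)"
proof -
  interpret X: prob_space "PiM UNIV \<sigma>" by (rule prob_PX[OF \<sigma>])
  interpret G: prob_space G by (rule input_lawsD[OF G])
  interpret pair_prob_space "PiM UNIV \<sigma>" G ..
  obtain C where C: "\<forall>x\<in>inputs. \<bar>\<Phi> x\<bar> \<le> C" using \<Phi> by (auto simp: tame_def)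
  have "sets (PiM UNIV \<sigma> \<Otimes>\<^sub>M G) = sets (SX \<Otimes>\<^sub>M input_space A)"
    using input_lawsD[OF G] sets_PX[OF \<sigma>] by (intro sets_pair_measure_cong) auto
  then have m: "(\<lambda>p. \<Phi> ((fst p)(j := snd p))) \<in> borel_measurable (PiM UNIV \<sigma> \<Otimes>\<^sub>M G)"
    using tame_joint_measurable[OF \<Phi>, of j] by (simp cong: measurable_cong_sets)
  have "integrable (PiM UNIV \<sigma> \<Otimes>\<^sub>M G) (\<lambda>p. \<Phi> ((fst p)(j := snd p)))"
    by (rule P.integrable_const_bound[where B=C])
       (use C m space_PX[OF \<sigma>] input_lawsD[OF G] inputs_upd in \<open>auto intro!: AE_I2 simp: space_pair_measure\<close>)
  then have "integrable (PiM UNIV \<sigma> \<Otimes>\<^sub>M G) (\<lambda>(x, t). \<Phi> (x(j := t)))" by (simp add: split_beta')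
  from Fubini_integral[OF this] show ?thesis by (simp add: integral_upd[OF assms])
qed

lemma integral_upd_mixture:
  assumes \<Phi>: "tame \<Phi>" and \<sigma>: "laws \<sigma>" and FG: "F \<in> input_laws A" "G \<in> input_laws A" and e: "0 \<le> \<epsilon>" "\<epsilon> \<le> 1"
  shows "(\<integral>x. \<Phi> x \<partial>PiM UNIV (\<sigma>(j := mixture \<epsilon> F G)))
    = (1 - \<epsilon>) * (\<integral>x. \<Phi> x \<partial>PiM UNIV (\<sigma>(j := F))) + \<epsilon> * (\<integral>x. \<Phi> x \<partial>PiM UNIV (\<sigma>(j := G)))"
proof -
  obtain C where C: "\<forall>x\<in>inputs. \<bar>\<Phi> x\<bar> \<le> C" using \<Phi> by (auto simp: tame_def)
  have "(\<integral>x. \<Phi> x \<partial>PiM UNIV (\<sigma>(j := mixture \<epsilon> F G)))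
      = (\<integral>x. (1 - \<epsilon>) * (\<integral>t. \<Phi> (x(j := t)) \<partial>F) + \<epsilon> * (\<integral>t. \<Phi> (x(j := t)) \<partial>G) \<partial>PiM UNIV \<sigma>)"
    unfolding integral_upd[OF \<Phi> \<sigma> mixture_in_input_laws[OF FG e]]
  proof (rule Bochner_Integration.integral_cong[OF refl])
    fix x assume "x \<in> space (PiM UNIV \<sigma>)"
    then have x: "x \<in> inputs" using space_PX[OF \<sigma>] by simp
    show "(\<integral>t. \<Phi> (x(j := t)) \<partial>mixture \<epsilon> F G)
        = (1 - \<epsilon>) * (\<integral>t. \<Phi> (x(j := t)) \<partial>F) + \<epsilon> * (\<integral>t. \<Phi> (x(j := t)) \<partial>G)"
      by (rule integral_mixture[OF FG e tame_slice_measurable[OF \<Phi> x]]) (use C inputs_upd[OF x] in auto)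
  qed
  also have "\<dots> = (1 - \<epsilon>) * (\<integral>x. \<integral>t. \<Phi> (x(j := t)) \<partial>F \<partial>PiM UNIV \<sigma>)
      + \<epsilon> * (\<integral>x. \<integral>t. \<Phi> (x(j := t)) \<partial>G \<partial>PiM UNIV \<sigma>)"
    using tame_integrable[OF tame_integral_slice[OF \<Phi> FG(1)] \<sigma>]
      tame_integrable[OF tame_integral_slice[OF \<Phi> FG(2)] \<sigma>] by simp
  finally show ?thesis by (simp add: integral_upd[OF \<Phi> \<sigma> FG(1)] integral_upd[OF \<Phi> \<sigma> FG(2)])
qed

text \<open>With input \<open>j\<close> set to zero, the integrand is blind to the law at
  \<open>j\<close>; setting it to zero costs at most \<open>c\<close>.\<close>

lemma integral_upd_close:
  assumes \<Phi>: "tame \<Phi>" and \<sigma>: "laws \<sigma>" and G: "G \<in> input_laws A"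
    and c: "\<And>x t. x \<in> inputs \<Longrightarrow> 0 \<le> t \<Longrightarrow> t \<le> A \<Longrightarrow> \<bar>\<Phi> (x(j := t)) - \<Phi> (x(j := 0))\<bar> \<le> c"
  shows "\<bar>(\<integral>x. \<Phi> x \<partial>PiM UNIV (\<sigma>(j := G))) - (\<integral>x. \<Phi> (x(j := 0)) \<partial>PiM UNIV \<sigma>)\<bar> \<le> c"
proof -
  note \<Phi>0 = tame_upd[OF \<Phi> order_refl A, of j]
  have d: "tame (\<lambda>x. \<Phi> x - \<Phi> (x(j := 0)))" by (rule tame_diff[OF \<Phi> \<Phi>0])
  have "(\<integral>x. \<Phi> (x(j := 0)) \<partial>PiM UNIV (\<sigma>(j := G))) = (\<integral>x. \<Phi> (x(j := 0)) \<partial>PiM UNIV \<sigma>)"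
    using integral_upd[OF \<Phi>0 \<sigma> G, of j] input_lawsD[OF G] prob_space.prob_space[of G] by simp
  moreover have "\<bar>\<integral>x. \<Phi> x - \<Phi> (x(j := 0)) \<partial>PiM UNIV (\<sigma>(j := G))\<bar> \<le> c"
  proof (rule tame_integral_bound[OF d laws_upd[OF \<sigma> G]])
    fix x assume "x \<in> inputs"
    then show "\<bar>\<Phi> x - \<Phi> (x(j := 0))\<bar> \<le> c" using c[of x "x j"] by (auto simp: inputs_def)
  qed
  ultimately show ?thesis
    using tame_integrable[OF \<Phi> laws_upd[OF \<sigma> G, of j]] tame_integrable[OF \<Phi>0 laws_upd[OF \<sigma> G, of j]] by simp
qed

lemma integral_upd_diff:
  assumes \<Phi>: "tame \<Phi>" and \<sigma>: "laws \<sigma>" and FG: "F \<in> input_laws A" "G \<in> input_laws A"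
    and c: "\<And>x t. x \<in> inputs \<Longrightarrow> 0 \<le> t \<Longrightarrow> t \<le> A \<Longrightarrow> \<bar>\<Phi> (x(j := t)) - \<Phi> (x(j := 0))\<bar> \<le> c"
  shows "\<bar>(\<integral>x. \<Phi> x \<partial>PiM UNIV (\<sigma>(j := G))) - (\<integral>x. \<Phi> x \<partial>PiM UNIV (\<sigma>(j := F)))\<bar> \<le> 2 * c"
  using integral_upd_close[OF \<Phi> \<sigma> FG(1) c] integral_upd_close[OF \<Phi> \<sigma> FG(2) c] by linarith

lemma integral_PX_cong:
  assumes "tame \<Phi>" "depends_on I \<Phi>" "laws \<sigma>" "laws \<sigma>'" "\<And>k. k \<in> I \<Longrightarrow> \<sigma> k = \<sigma>' k"
  shows "(\<integral>x. \<Phi> x \<partial>PiM UNIV \<sigma>) = (\<integral>x. \<Phi> x \<partial>PiM UNIV \<sigma>')"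
  by (rule integral_PiM_cong_depends[where S="\<lambda>_. input_space A" and I=I])
     (use assms lawsD in \<open>auto simp: tame_def\<close>)

lemma tame_output_average:
  assumes "growth S c r \<phi>" "finite S" "r \<ge> 1" "c \<ge> 0"
  shows "tame (\<lambda>x. \<integral>y. \<phi> y \<partial>K x)"
proof (rule tameI[where C="c * mgf r ^ card S"])
  have "\<phi> \<in> borel_measurable SY" using assms by (simp add: growth_def)
  then show "(\<lambda>x. \<integral>y. \<phi> y \<partial>K x) \<in> borel_measurable SX"
    by (intro measurable_compose[OF measurable_K_sub] integral_measurable_subprob_algebra)
qed (use assms in \<open>auto intro!: growth_integral(2)\<close>)

lemma depends_on_output_average:
  fixes \<phi> :: "_ \<Rightarrow> real"
  assumes "\<phi> \<in> borel_measurable SY" "depends_on T \<phi>" "\<And>k. k \<in> T \<Longrightarrow> {k - int L..k} \<subseteq> S"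
  shows "depends_on S (\<lambda>x. \<integral>y. \<phi> y \<partial>K x)"
proof (rule depends_onI)
  fix x x' :: "int \<Rightarrow> real" assume eq: "\<And>i. i \<in> S \<Longrightarrow> x i = x' i"
  show "(\<integral>y. \<phi> y \<partial>K x) = (\<integral>y. \<phi> y \<partial>K x')"
  proof (rule integral_K_cong[OF assms(1,2)])
    fix k assume "k \<in> T"
    show "Z x k = Z x' k" by (rule Z_cong, rule eq) (use assms(3)[OF \<open>k \<in> T\<close>] in auto)
  qed
qed

end

section \<open>Relative entropy and likelihoods\<close>

text \<open>Apply \<open>ln u <= u - 1\<close> at \<open>u = q y / p y\<close>; the linear terms
  cancel since both masses agree. It gives the sign of \<open>kl\<close> and the superadditivity
  behind the existence of the rate.\<close>

lemma gibbs:
  fixes p q :: "'a \<Rightarrow> real"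
  assumes "integrable M p" "integrable M q" "(\<integral>y. p y \<partial>M) = (\<integral>y. q y \<partial>M)"
    and pos: "\<And>y. p y > 0" "\<And>y. q y > 0"
    and i: "integrable M (\<lambda>y. p y * (ln (p y) - ln (q y)))"
  shows "0 \<le> (\<integral>y. p y * (ln (p y) - ln (q y)) \<partial>M)"
proof -
  have "p y - q y \<le> p y * (ln (p y) - ln (q y))" for y
  proof -
    have "ln (q y) - ln (p y) \<le> q y / p y - 1"
      using ln_le_minus_one[of "q y / p y"] pos[of y] by (simp add: ln_div)
    then have "p y * (ln (q y) - ln (p y)) \<le> p y * (q y / p y - 1)"
      using pos(1)[of y] by (intro mult_left_mono) auto
    then show ?thesis using pos(1)[of y] by (simp add: algebra_simps)
  qed
  then have "(\<integral>y. p y - q y \<partial>M) \<le> (\<integral>y. p y * (ln (p y) - ln (q y)) \<partial>M)"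
    using assms by (intro integral_mono) auto
  then show ?thesis using assms by simp
qed

context poisson_channel
begin

text \<open>Densities are taken with respect to Poisson variables of mean \<open>1\<close>, so that the factorials cancel.\<close>

definition lik :: "int set \<Rightarrow> (int \<Rightarrow> real) \<Rightarrow> (int \<Rightarrow> nat) \<Rightarrow> real" where
  "lik T x y = (\<Prod>k\<in>T. exp (1 - Z x k) * Z x k ^ y k)"

definition nu :: "(int \<Rightarrow> nat) measure" where
  "nu = (\<Pi>\<^sub>M k\<in>UNIV. measure_pmf (poisson_pmf 1))"

text \<open>The density with respect to \<open>nu\<close> of the law of the outputs in
  \<open>T\<close>, the inputs being averaged out.\<close>

definition dens :: "(int \<Rightarrow> real measure) \<Rightarrow> int set \<Rightarrow> (int \<Rightarrow> nat) \<Rightarrow> real" where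
  "dens \<sigma> T y = (\<integral>x. lik T x y \<partial>PiM UNIV \<sigma>)"

lemma sets_nu [measurable_cong, simp]: "sets nu = sets SY"
  unfolding nu_def by (intro sets_PiM_cong) simp_all

lemma prob_nu: "prob_space nu"
  unfolding nu_def by (intro prob_space_PiM prob_space_measure_pmf)

lemma measurable_input [measurable]: "(\<lambda>x. x i) \<in> borel_measurable SX"
proof -
  have "(\<lambda>x. x i) \<in> SX \<rightarrow>\<^sub>M input_space A" by (rule measurable_component_singleton) simp
  then show ?thesis unfolding input_space_def by (simp add: measurable_restrict_space2_iff)
qed

lemma measurable_lik [measurable]: "(\<lambda>p. lik T (fst p) (snd p)) \<in> borel_measurable (SX \<Otimes>\<^sub>M SY)"
  unfolding lik_def by (intro borel_measurable_prod borel_measurable_times measurable_power_nat) measurable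

lemma measurable_lik_input [measurable]: "(\<lambda>x. lik T x y) \<in> borel_measurable SX"
  unfolding lik_def by measurable

lemma measurable_lik_output [measurable]: "lik T x \<in> borel_measurable SY"
  unfolding lik_def by (intro borel_measurable_prod borel_measurable_times measurable_power_nat) measurable

lemma lik_pos: "x \<in> inputs \<Longrightarrow> lik T x y > 0"
  unfolding lik_def using Z_pos by (intro prod_pos) auto

lemma depends_on_lik: "depends_on T (lik T x)"
  by (rule depends_onI) (simp add: lik_def)

lemma depends_on_dens: "depends_on T (dens \<sigma> T)"
  by (rule depends_onI) (simp add: dens_def lik_def)

lemma lik_cong: "(\<And>i k. k \<in> T \<Longrightarrow> k - int L \<le> i \<Longrightarrow> i \<le> k \<Longrightarrow> x i = x' i) \<Longrightarrow> lik T x y = lik T x' y"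
  unfolding lik_def by (rule prod.cong[OF refl]) (metis Z_cong)

text \<open>Bounds the logarithm of every intensity, as these lie between \<open>dark\<close> and
  \<open>peak\<close>.\<close>

definition log_size :: real where "log_size = max \<bar>ln dark\<bar> \<bar>ln peak\<bar>"

lemma log_size_nonneg: "log_size \<ge> 0" by (simp add: log_size_def)

lemma Z_power_bounds:
  assumes "x \<in> inputs"
  shows "exp (- log_size * real n) \<le> Z x k ^ n" "Z x k ^ n \<le> exp (log_size * real n)"
proof -
  have "ln dark \<le> ln (Z x k)" "ln (Z x k) \<le> ln peak"
    using Z_lower[OF assms, of k] Z_upper[OF assms, of k] dark by auto
  then have b: "- log_size \<le> ln (Z x k)" "ln (Z x k) \<le> log_size"
    by (auto simp: log_size_def)
  have "Z x k ^ n = exp (ln (Z x k) * real n)"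
    using Z_pos[OF assms, of k] by (simp add: exp_of_nat2_mult)
  then show "exp (- log_size * real n) \<le> Z x k ^ n" "Z x k ^ n \<le> exp (log_size * real n)"
    using b by (auto intro!: mult_right_mono simp: minus_le_iff) (metis b(1) minus_mult_left mult_right_mono of_nat_0_le_iff)
qed

lemma prod_exp_affine:
  "(\<Prod>k\<in>T. exp a * exp (b * real (y k :: nat))) = exp (real (card T) * a + b * real (\<Sum>k\<in>T. y k))"
  by (induction T rule: infinite_finite_induct) (auto simp: exp_add[symmetric] algebra_simps)

lemma lik_bounds:
  assumes "x \<in> inputs"
  shows "exp (- (real (card T) * (1 + peak) + log_size * real (\<Sum>k\<in>T. y k))) \<le> lik T x y"
    and "lik T x y \<le> exp (real (card T) * (1 + peak) + log_size * real (\<Sum>k\<in>T. y k))"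
proof -
  have "(\<Prod>k\<in>T. exp (- (1 + peak)) * exp (- log_size * real (y k))) \<le> lik T x y"
    unfolding lik_def
  proof (intro prod_mono conjI mult_mono)
    show "exp (- (1 + peak)) \<le> exp (1 - Z x k)" for k using Z_upper[OF assms, of k] by simp
    show "exp (- log_size * real (y k)) \<le> Z x k ^ y k" for k by (rule Z_power_bounds(1)[OF assms])
  qed auto
  then show "exp (- (real (card T) * (1 + peak) + log_size * real (\<Sum>k\<in>T. y k))) \<le> lik T x y"
    unfolding prod_exp_affine by (simp add: algebra_simps)
  have "lik T x y \<le> (\<Prod>k\<in>T. exp (1 + peak) * exp (log_size * real (y k)))"
    unfolding lik_def using Z_power_bounds[OF assms] Z_pos[OF assms] peak_pos
    by (intro prod_mono) (auto intro!: mult_mono intro: less_imp_le order_trans simp: less_imp_le add_increasing2)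
  then show "lik T x y \<le> exp (real (card T) * (1 + peak) + log_size * real (\<Sum>k\<in>T. y k))"
    unfolding prod_exp_affine .
qed

lemma tame_lik: "tame (\<lambda>x. lik T x y)"
proof (rule tameI)
  fix x assume "x \<in> inputs"
  then show "\<bar>lik T x y\<bar> \<le> exp (real (card T) * (1 + peak) + log_size * real (\<Sum>k\<in>T. y k))"
    using lik_bounds(2) lik_pos by (simp add: less_imp_le abs_of_pos)
qed measurable

lemma dens_bounds:
  assumes "laws \<sigma>"
  shows "exp (- (real (card T) * (1 + peak) + log_size * real (\<Sum>k\<in>T. y k))) \<le> dens \<sigma> T y"
    and "dens \<sigma> T y \<le> exp (real (card T) * (1 + peak) + log_size * real (\<Sum>k\<in>T. y k))"
proof -
  interpret prob_space "PiM UNIV \<sigma>" by (rule prob_PX[OF assms])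
  note i = tame_integrable[OF tame_lik assms, of T y]
  show "exp (- (real (card T) * (1 + peak) + log_size * real (\<Sum>k\<in>T. y k))) \<le> dens \<sigma> T y"
    unfolding dens_def using lik_bounds space_PX[OF assms] by (intro integral_ge_const[OF i] AE_I2) auto
  show "dens \<sigma> T y \<le> exp (real (card T) * (1 + peak) + log_size * real (\<Sum>k\<in>T. y k))"
    unfolding dens_def using lik_bounds space_PX[OF assms] by (intro integral_le_const[OF i] AE_I2) auto
qed

lemma dens_pos: "laws \<sigma> \<Longrightarrow> dens \<sigma> T y > 0"
  using dens_bounds(1)[of \<sigma> T y] exp_gt_zero by (rule order.strict_trans2[rotated])

lemma measurable_dens [measurable]:
  assumes "laws \<sigma>"
  shows "dens \<sigma> T \<in> borel_measurable SY"
proof -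
  interpret prob_space "PiM UNIV \<sigma>" by (rule prob_PX[OF assms])
  have "(\<lambda>p. lik T (snd p) (fst p)) \<in> borel_measurable (SY \<Otimes>\<^sub>M SX)"
    using measurable_compose[OF measurable_pair_swap'[of SY SX] measurable_lik[of T]] by (simp add: split_beta')
  moreover have "sets (SY \<Otimes>\<^sub>M PiM UNIV \<sigma>) = sets (SY \<Otimes>\<^sub>M SX)"
    using sets_PX[OF assms] by (intro sets_pair_measure_cong) auto
  ultimately have "(\<lambda>(y, x). lik T x y) \<in> borel_measurable (SY \<Otimes>\<^sub>M PiM UNIV \<sigma>)"
    by (simp add: split_beta' cong: measurable_cong_sets)
  then show ?thesis unfolding dens_def by (rule borel_measurable_lebesgue_integral)
qed

lemma real_le_two_power: "real n \<le> 2 ^ n"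
  by (metis less_exp less_imp_le of_nat_le_iff of_nat_numeral of_nat_power)

lemma linear_le_two_power: "0 \<le> a \<Longrightarrow> 0 \<le> b \<Longrightarrow> a + b * real n \<le> (a + b) * 2 ^ n"
  using mult_left_mono[OF real_le_two_power[of n], of b] mult_left_mono[of 1 "2 ^ n" a]
  by (simp add: algebra_simps)

text \<open>Logarithms of densities are linear in the counts, and the base 2 of
  \<open>growth\<close> majorizes linear functions. The constant increases with
  \<open>card T\<close>, so it serves integrability rather than estimates uniform in the block
  length.\<close>

definition ln_size :: "int set \<Rightarrow> real" where
  "ln_size T = real (card T) * (1 + peak) + log_size"

lemma ln_size_nonneg: "ln_size T \<ge> 0"
  using peak_pos log_size_nonneg by (simp add: ln_size_def)

lemma growth_ln_dens:
  assumes "laws \<sigma>"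
  shows "growth T (ln_size T) 2 (\<lambda>y. ln (dens \<sigma> T y))"
  unfolding growth_def
proof (intro conjI allI)
  show "(\<lambda>y. ln (dens \<sigma> T y)) \<in> borel_measurable SY" using assms by measurable
  fix y
  have "\<bar>ln (dens \<sigma> T y)\<bar> \<le> real (card T) * (1 + peak) + log_size * real (\<Sum>k\<in>T. y k)"
    using ln_mono[OF dens_bounds(1)[OF assms] exp_gt_zero, of T y]
      ln_mono[OF dens_bounds(2)[OF assms] dens_pos[OF assms], of T y] by simp
  also have "\<dots> \<le> ln_size T * 2 ^ (\<Sum>k\<in>T. y k)"
    unfolding ln_size_def using peak_pos log_size_nonneg by (intro linear_le_two_power) auto
  finally show "\<bar>ln (dens \<sigma> T y)\<bar> \<le> ln_size T * 2 ^ (\<Sum>k\<in>T. y k)" .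
qed

subsection \<open>Densities of the output law\<close>

text \<open>Outside \<open>T\<close> the outputs follow \<open>nu\<close>. This gives a density
  against \<open>nu\<close>, which infinitely many changed factors would in general destroy.\<close>

definition ext_law :: "int set \<Rightarrow> (int \<Rightarrow> real) \<Rightarrow> int \<Rightarrow> nat measure" where
  "ext_law T x k = measure_pmf (poisson_pmf (if k \<in> T then Z x k else 1))"

lemma PiM_ext_law:
  assumes "x \<in> inputs" "finite T"
  shows "PiM UNIV (ext_law T x) = density nu (\<lambda>y. ennreal (lik T x y))"
proof -
  have "PiM UNIV (ext_law T x)
      = density nu (\<lambda>y. \<Prod>k\<in>T. ennreal (exp (1 - Z x k) * Z x k ^ y k))"
    unfolding nu_def
    by (rule PiM_density[where r="\<lambda>k n. ennreal (exp (1 - Z x k) * Z x k ^ n)"])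
       (use assms Z_pos[OF assms(1)] in
         \<open>auto simp: ext_law_def prob_space_measure_pmf measure_pmf_poisson_density[symmetric]\<close>)
  also have "(\<lambda>y. \<Prod>k\<in>T. ennreal (exp (1 - Z x k) * Z x k ^ y k)) = (\<lambda>y. ennreal (lik T x y))"
    unfolding lik_def using Z_pos[OF assms(1)] by (subst prod_ennreal) (auto simp: less_imp_le)
  finally show ?thesis .
qed

lemma integral_K_lik:
  fixes u :: "_ \<Rightarrow> 'b::{banach, second_countable_topology}"
  assumes x: "x \<in> inputs" and T: "finite T" and u: "u \<in> borel_measurable SY" "depends_on T u"
  shows "(\<integral>y. u y \<partial>K x) = (\<integral>y. lik T x y *\<^sub>R u y \<partial>nu)"
    and "integrable (K x) u \<longleftrightarrow> integrable nu (\<lambda>y. lik T x y *\<^sub>R u y)"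
proof -
  have c: "prob_space (ext_law T x k)" "sets (ext_law T x k) = sets (count_space UNIV)" for k
    by (auto simp: ext_law_def prob_space_measure_pmf)
  have nu: "u \<in> borel_measurable nu" "lik T x \<in> borel_measurable nu" using u by simp_all
  have nn: "AE y in nu. 0 \<le> lik T x y" using lik_pos[OF x] by (auto simp: less_imp_le)
  have "(\<integral>y. u y \<partial>K x) = (\<integral>y. u y \<partial>PiM UNIV (ext_law T x))"
    unfolding output_kernel_def
    by (rule integral_PiM_cong_depends[OF _ _ _ _ u]) (use c in \<open>auto simp: ext_law_def prob_space_measure_pmf\<close>)
  then show "(\<integral>y. u y \<partial>K x) = (\<integral>y. lik T x y *\<^sub>R u y \<partial>nu)"
    using integral_density[OF nu nn] PiM_ext_law[OF x T] by simp
  have "integrable (K x) u \<longleftrightarrow> integrable (PiM UNIV (ext_law T x)) u"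
    unfolding output_kernel_def
    by (rule integrable_PiM_cong_depends[OF _ _ _ _ u]) (use c in \<open>auto simp: ext_law_def prob_space_measure_pmf\<close>)
  then show "integrable (K x) u \<longleftrightarrow> integrable nu (\<lambda>y. lik T x y *\<^sub>R u y)"
    using integrable_density[OF nu nn] PiM_ext_law[OF x T] by simp
qed

lemma integral_dens:
  assumes \<sigma>: "laws \<sigma>" and T: "finite T" and S: "finite S" "r \<ge> 1" "c \<ge> 0"
    and g: "growth S c r \<phi>" and d: "depends_on T \<phi>"
  shows "integrable nu (\<lambda>y. \<phi> y * dens \<sigma> T y)"
    and "(\<integral>x. \<integral>y. \<phi> y \<partial>K x \<partial>PiM UNIV \<sigma>) = (\<integral>y. \<phi> y * dens \<sigma> T y \<partial>nu)"
proof -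
  interpret X: prob_space "PiM UNIV \<sigma>" by (rule prob_PX[OF \<sigma>])
  interpret Y: prob_space nu by (rule prob_nu)
  interpret pair_sigma_finite "PiM UNIV \<sigma>" nu ..
  have \<phi>m [measurable]: "\<phi> \<in> borel_measurable SY" using g by (simp add: growth_def)
  have s: "sets (PiM UNIV \<sigma> \<Otimes>\<^sub>M nu) = sets (SX \<Otimes>\<^sub>M SY)"
    using sets_PX[OF \<sigma>] by (intro sets_pair_measure_cong) auto
  have "(\<lambda>p. \<phi> (snd p) * lik T (fst p) (snd p)) \<in> borel_measurable (SX \<Otimes>\<^sub>M SY)" by measurable
  then have m: "(\<lambda>(x, y). \<phi> y * lik T x y) \<in> borel_measurable (PiM UNIV \<sigma> \<Otimes>\<^sub>M nu)"
    by (simp add: split_beta' measurable_cong_sets[OF s refl])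
  have ga: "growth S c r (\<lambda>y. \<bar>\<phi> y\<bar>)" using g by (auto simp: growth_def)
  have da: "depends_on T (\<lambda>y. \<bar>\<phi> y\<bar>)" using d by (auto simp: depends_on_def) metis
  have i: "integrable (PiM UNIV \<sigma> \<Otimes>\<^sub>M nu) (\<lambda>(x, y). \<phi> y * lik T x y)"
  proof (rule Fubini_integrable[OF m])
    have "(\<integral>y. norm (case (x, y) of (x, y) \<Rightarrow> \<phi> y * lik T x y) \<partial>nu) = (\<integral>y. \<bar>\<phi> y\<bar> \<partial>K x)" if "x \<in> inputs" for x
      using integral_K_lik(1)[OF that T _ da] lik_pos[OF that, of T]
      by (simp add: abs_mult abs_of_pos mult.commute)
    then show "integrable (PiM UNIV \<sigma>) (\<lambda>x. \<integral>y. norm (case (x, y) of (x, y) \<Rightarrow> \<phi> y * lik T x y) \<partial>nu)"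
      using tame_integrable[OF tame_output_average[OF ga S] \<sigma>] space_PX[OF \<sigma>]
      by (subst Bochner_Integration.integrable_cong[OF refl, where g="\<lambda>x. \<integral>y. \<bar>\<phi> y\<bar> \<partial>K x"]) auto
    show "AE x in PiM UNIV \<sigma>. integrable nu (\<lambda>y. case (x, y) of (x, y) \<Rightarrow> \<phi> y * lik T x y)"
    proof (rule AE_I2)
      fix x assume "x \<in> space (PiM UNIV \<sigma>)"
      then have x: "x \<in> inputs" using space_PX[OF \<sigma>] by simp
      show "integrable nu (\<lambda>y. case (x, y) of (x, y) \<Rightarrow> \<phi> y * lik T x y)"
        using integral_K_lik(2)[OF x T \<phi>m d] growth_integral(1)[OF x S g] by (simp add: mult.commute)
    qed
  qed
  show "integrable nu (\<lambda>y. \<phi> y * dens \<sigma> T y)"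
    using integrable_snd[OF i] by (simp add: dens_def)
  have "(\<integral>x. \<integral>y. \<phi> y \<partial>K x \<partial>PiM UNIV \<sigma>) = (\<integral>x. \<integral>y. \<phi> y * lik T x y \<partial>nu \<partial>PiM UNIV \<sigma>)"
    using space_PX[OF \<sigma>]
    by (intro Bochner_Integration.integral_cong[OF refl]) (simp add: integral_K_lik(1)[OF _ T \<phi>m d] mult.commute)
  also have "\<dots> = (\<integral>y. \<phi> y * dens \<sigma> T y \<partial>nu)"
    using Fubini_integral[OF i] by (simp add: dens_def)
  finally show "(\<integral>x. \<integral>y. \<phi> y \<partial>K x \<partial>PiM UNIV \<sigma>) = (\<integral>y. \<phi> y * dens \<sigma> T y \<partial>nu)" .
qed

lemma integral_dens_1:
  assumes "laws \<sigma>" "finite T"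
  shows "integrable nu (dens \<sigma> T)" "(\<integral>y. dens \<sigma> T y \<partial>nu) = 1"
proof -
  interpret X: prob_space "PiM UNIV \<sigma>" by (rule prob_PX[OF assms(1)])
  have "(\<integral>y. (1::real) \<partial>K x) = 1" for x using prob_space.prob_space[OF prob_K, of x] by simp
  then show "integrable nu (dens \<sigma> T)" "(\<integral>y. dens \<sigma> T y \<partial>nu) = 1"
    using integral_dens[OF assms, of "{}" 1 1 "\<lambda>_. 1"]
    by (simp_all add: growth_def depends_on_def X.prob_space[simplified])
qed

subsection \<open>Locality of the densities\<close>

text \<open>Only factors in the window change, and each change costs at most
  \<open>c * q ^ y k\<close>. This cost is at least 1, so it may be charged to the whole window even
  if \<open>T\<close> contains only part of it.\<close>

lemma prod_window_le:
  fixes a b :: "int \<Rightarrow> real"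
  assumes "finite T" "q \<ge> 1" "c \<ge> 1"
    and nn: "\<And>k. k \<in> T \<Longrightarrow> 0 \<le> a k" "\<And>k. k \<in> T \<Longrightarrow> 0 \<le> b k"
    and le: "\<And>k. k \<in> T \<Longrightarrow> k \<in> win j \<Longrightarrow> a k \<le> c * q ^ y k * b k"
    and eq: "\<And>k. k \<in> T \<Longrightarrow> k \<notin> win j \<Longrightarrow> a k = b k"
  shows "(\<Prod>k\<in>T. a k) \<le> c ^ (L + 1) * q ^ (\<Sum>k\<in>win j. y k) * (\<Prod>k\<in>T. b k)"
proof -
  let ?d = "\<lambda>k. c * q ^ y k"
  have d1: "1 \<le> ?d k" for k
    using assms mult_mono[of 1 c 1 "q ^ y k"] by simp
  have "(\<Prod>k\<in>T. a k) \<le> (\<Prod>k\<in>T. (if k \<in> win j then ?d k else 1) * b k)"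
    using nn le eq by (intro prod_mono) auto
  also have "\<dots> = (\<Prod>k\<in>T \<inter> win j. ?d k) * (\<Prod>k\<in>T. b k)"
    unfolding prod.distrib[of _ b] prod.inter_restrict[OF \<open>finite T\<close>] ..
  also have "\<dots> \<le> (\<Prod>k\<in>win j. ?d k) * (\<Prod>k\<in>T. b k)"
    using d1 nn(2) by (intro mult_right_mono prod_mono2 prod_nonneg) (auto intro: order_trans[OF zero_le_one])
  also have "(\<Prod>k\<in>win j. ?d k) = c ^ (L + 1) * q ^ (\<Sum>k\<in>win j. y k)"
    by (simp add: prod.distrib power_sum)
  finally show ?thesis .
qed

text \<open>One factor \<open>exp A\<close> for each output of a window, since two intensities
  differ by at most \<open>A\<close>.\<close>

definition ratio_bound :: real where "ratio_bound = exp A ^ (L + 1)"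

lemma ratio_bound_nonneg: "ratio_bound \<ge> 0" by (simp add: ratio_bound_def)

text \<open>Two intensities have a quotient of at most \<open>peak / dark\<close>, which is raised
  to the counts. The hypothesis compares intensities instead of inputs, so that both a single update
  and a change of all inputs before the block are covered.\<close>

lemma lik_window_le:
  assumes x: "x \<in> inputs" and x': "x' \<in> inputs" and T: "finite T"
    and eq: "\<And>k. k \<in> T \<Longrightarrow> k \<notin> win j \<Longrightarrow> Z x' k = Z x k"
  shows "lik T x' y \<le> ratio_bound * (peak / dark) ^ (\<Sum>k\<in>win j. y k) * lik T x y"
  unfolding lik_def ratio_bound_def
proof (rule prod_window_le[OF T])
  show "1 \<le> peak / dark" using dark dark_le_peak by simp
  show "0 \<le> exp (1 - Z x' k) * Z x' k ^ y k" for k using Z_pos[OF x'] by (simp add: less_imp_le)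
  show "0 \<le> exp (1 - Z x k) * Z x k ^ y k" for k using Z_pos[OF x] by (simp add: less_imp_le)
  fix k
  have "exp (1 - Z x' k) \<le> exp A * exp (1 - Z x k)"
    using Z_lower[OF x', of k] Z_upper[OF x, of k] by (simp add: exp_add[symmetric] peak_def)
  moreover have "Z x' k ^ y k \<le> (peak / dark) ^ y k * Z x k ^ y k"
  proof -
    have "peak * dark \<le> peak * Z x k" using Z_lower[OF x, of k] peak_pos by (intro mult_left_mono) auto
    then have "peak \<le> (peak / dark) * Z x k" using dark by (simp add: field_simps)
    then have "Z x' k \<le> (peak / dark) * Z x k" using Z_upper[OF x', of k] by linarith
    then show ?thesis using Z_pos[OF x', of k] by (simp add: power_mult_distrib[symmetric] power_mono less_imp_le del: power_mult_distrib)
  qed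
  ultimately have "exp (1 - Z x' k) * Z x' k ^ y k
      \<le> (exp A * exp (1 - Z x k)) * ((peak / dark) ^ y k * Z x k ^ y k)"
    using Z_pos[OF x', of k] by (intro mult_mono) (auto simp: less_imp_le)
  then show "exp (1 - Z x' k) * Z x' k ^ y k
      \<le> exp A * (peak / dark) ^ y k * (exp (1 - Z x k) * Z x k ^ y k)" by (simp add: ac_simps)
qed (use A eq in auto)

lemma lik_upd_le:
  assumes x: "x \<in> inputs" and s: "0 \<le> s" "s \<le> A" and T: "finite T"
  shows "lik T (x(j := s)) y \<le> ratio_bound * (peak / dark) ^ (\<Sum>k\<in>win j. y k) * lik T x y"
  by (rule lik_window_le[OF x inputs_upd[OF x s] T]) (rule Z_upd_outside)

lemma dens_upd_le:
  assumes \<sigma>: "laws \<sigma>" and G: "G \<in> input_laws A" and T: "finite T"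
  shows "dens (\<sigma>(j := G)) T y \<le> ratio_bound * (peak / dark) ^ (\<Sum>k\<in>win j. y k) * dens \<sigma> T y"
proof -
  interpret G: prob_space G by (rule input_lawsD[OF G])
  let ?B = "ratio_bound * (peak / dark) ^ (\<Sum>k\<in>win j. y k)"
  have "dens (\<sigma>(j := G)) T y = (\<integral>x. \<integral>t. lik T (x(j := t)) y \<partial>G \<partial>PiM UNIV \<sigma>)"
    unfolding dens_def by (rule integral_upd[OF tame_lik \<sigma> G])
  also have "\<dots> \<le> (\<integral>x. ?B * lik T x y \<partial>PiM UNIV \<sigma>)"
  proof (rule integral_mono)
    show "integrable (PiM UNIV \<sigma>) (\<lambda>x. \<integral>t. lik T (x(j := t)) y \<partial>G)"
      by (rule tame_integrable[OF tame_integral_slice[OF tame_lik G] \<sigma>])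
    show "integrable (PiM UNIV \<sigma>) (\<lambda>x. ?B * lik T x y)"
      using tame_integrable[OF tame_lik \<sigma>] by simp
    fix x assume "x \<in> space (PiM UNIV \<sigma>)"
    then have x: "x \<in> inputs" using space_PX[OF \<sigma>] by simp
    have b: "AE t in G. lik T (x(j := t)) y \<le> ?B * lik T x y"
      using lik_upd_le[OF x _ _ T] input_lawsD[OF G] by (intro AE_I2) auto
    have p: "AE t in G. 0 \<le> lik T (x(j := t)) y"
      using lik_pos inputs_upd[OF x] input_lawsD[OF G] by (intro AE_I2) (auto simp: less_imp_le)
    have m: "(\<lambda>t. lik T (x(j := t)) y) \<in> borel_measurable G"
      using tame_slice_measurable[OF tame_lik x, of T j y] input_lawsD[OF G] by (simp cong: measurable_cong_sets)
    have "integrable G (\<lambda>t. lik T (x(j := t)) y)"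
      by (rule G.integrable_const_bound[where B="?B * lik T x y"]) (use b p m in auto)
    then show "(\<integral>t. lik T (x(j := t)) y \<partial>G) \<le> ?B * lik T x y" by (intro G.integral_le_const b)
  qed
  finally show ?thesis by (simp add: dens_def)
qed

lemma growth_dens_ratio:
  assumes "laws \<sigma>" "G \<in> input_laws A" "finite T"
  shows "growth (win j) ratio_bound (peak / dark) (\<lambda>y. dens (\<sigma>(j := G)) T y / dens \<sigma> T y)"
  unfolding growth_def
proof (intro conjI allI)
  note \<sigma>' = laws_upd[OF assms(1,2), of j]
  show "(\<lambda>y. dens (\<sigma>(j := G)) T y / dens \<sigma> T y) \<in> borel_measurable SY"
    using assms(1) \<sigma>' by measurable
  fix y
  show "\<bar>dens (\<sigma>(j := G)) T y / dens \<sigma> T y\<bar> \<le> ratio_bound * (peak / dark) ^ (\<Sum>k\<in>win j. y k)"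
    using dens_upd_le[OF assms, where j=j and y=y] dens_pos[OF assms(1), of T y] dens_pos[OF \<sigma>', of T y]
    by (simp add: abs_of_pos divide_le_eq)
qed

definition clr :: "int \<Rightarrow> (int \<Rightarrow> nat) \<Rightarrow> int \<Rightarrow> nat" where
  "clr j y = glue (- win j) y (\<lambda>_. 0)"

lemma measurable_clr [measurable]: "clr j \<in> SY \<rightarrow>\<^sub>M SY"
  unfolding clr_def by (rule measurable_PiM_single') (auto simp: glue_def space_PiM)

text \<open>Clearing an output changes only the factor \<open>Z x k ^ y k\<close>, and both this
  factor and its inverse are at most \<open>exp log_size ^ y k\<close>.\<close>

lemma lik_clr:
  assumes x: "x \<in> inputs" and T: "finite T"
  shows "lik T x y \<le> exp log_size ^ (\<Sum>k\<in>win j. y k) * lik T x (clr j y)"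
    and "lik T x (clr j y) \<le> exp log_size ^ (\<Sum>k\<in>win j. y k) * lik T x y"
proof -
  have q: "1 \<le> exp log_size" using log_size_nonneg by simp
  have nn: "0 \<le> exp (1 - Z x k) * Z x k ^ m" for k m using Z_pos[OF x] by (simp add: less_imp_le)
  have *: "exp log_size ^ m = exp (log_size * real m)" for m by (simp add: exp_of_nat2_mult)
  have up: "Z x k ^ m \<le> exp log_size ^ m" "1 \<le> exp log_size ^ m * Z x k ^ m" for k m
    using Z_power_bounds(2)[OF x, where n=m and k=k]
      mult_left_mono[OF Z_power_bounds(1)[OF x, where n=m and k=k], of "exp (log_size * real m)"]
    unfolding * by (auto simp: exp_minus_inverse)
  have "lik T x y \<le> 1 ^ (L + 1) * exp log_size ^ (\<Sum>k\<in>win j. y k) * lik T x (clr j y)"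
    unfolding lik_def
    by (rule prod_window_le[OF T q]) (use nn up in \<open>auto simp: clr_def glue_def ac_simps intro!: mult_left_mono\<close>)
  then show "lik T x y \<le> exp log_size ^ (\<Sum>k\<in>win j. y k) * lik T x (clr j y)" by simp
  have "lik T x (clr j y) \<le> 1 ^ (L + 1) * exp log_size ^ (\<Sum>k\<in>win j. y k) * lik T x y"
    unfolding lik_def
  proof (rule prod_window_le[OF T q])
    fix k assume "k \<in> win j"
    have "exp (1 - Z x k) * 1 \<le> exp (1 - Z x k) * (exp log_size ^ y k * Z x k ^ y k)"
      by (intro mult_left_mono up) simp
    then show "exp (1 - Z x k) * Z x k ^ clr j y k \<le> 1 * exp log_size ^ y k * (exp (1 - Z x k) * Z x k ^ y k)"
      using \<open>k \<in> win j\<close> by (simp add: clr_def glue_def ac_simps)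
  qed (use nn in \<open>auto simp: clr_def glue_def\<close>)
  then show "lik T x (clr j y) \<le> exp log_size ^ (\<Sum>k\<in>win j. y k) * lik T x y" by simp
qed

lemma dens_clr:
  assumes \<sigma>: "laws \<sigma>" and T: "finite T"
  shows "dens \<sigma> T y \<le> exp log_size ^ (\<Sum>k\<in>win j. y k) * dens \<sigma> T (clr j y)"
    and "dens \<sigma> T (clr j y) \<le> exp log_size ^ (\<Sum>k\<in>win j. y k) * dens \<sigma> T y"
  unfolding dens_def integral_mult_right_zero[symmetric]
  by (intro integral_mono integrable_mult_right tame_integrable[OF tame_lik \<sigma>] lik_clr T;
      simp add: space_PX[OF \<sigma>])+

text \<open>The part of the log density that can feel input \<open>j\<close>: the subtracted term
  reads only outputs outside the window of \<open>j\<close>. In contrast to the log density, it is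
  bounded in terms of the window alone.\<close>

definition ln_jump :: "(int \<Rightarrow> real measure) \<Rightarrow> int set \<Rightarrow> int \<Rightarrow> (int \<Rightarrow> nat) \<Rightarrow> real" where
  "ln_jump \<sigma> T j y = ln (dens \<sigma> T y) - ln (dens \<sigma> T (clr j y))"

lemma growth_ln_jump:
  assumes \<sigma>: "laws \<sigma>" and T: "finite T"
  shows "growth (win j) log_size 2 (ln_jump \<sigma> T j)"
  unfolding growth_def
proof (intro conjI allI)
  have "dens \<sigma> T \<in> borel_measurable SY" using \<sigma> by measurable
  then show "ln_jump \<sigma> T j \<in> borel_measurable SY"
    unfolding ln_jump_def
    by (intro borel_measurable_diff borel_measurable_ln measurable_compose[OF measurable_clr])
  fix y
  have *: "ln (exp log_size ^ n * d) = log_size * real n + ln d" if "d > 0" for n d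
    using that by (simp add: ln_mult ln_realpow mult.commute)
  have "ln (dens \<sigma> T y) \<le> log_size * real (\<Sum>k\<in>win j. y k) + ln (dens \<sigma> T (clr j y))"
    unfolding *[OF dens_pos[OF \<sigma>], symmetric] using dens_clr(1)[OF \<sigma> T, where y=y and j=j] dens_pos[OF \<sigma>, of T y] by (intro ln_mono) auto
  moreover have "ln (dens \<sigma> T (clr j y)) \<le> log_size * real (\<Sum>k\<in>win j. y k) + ln (dens \<sigma> T y)"
    unfolding *[OF dens_pos[OF \<sigma>], symmetric] using dens_clr(2)[OF \<sigma> T, where y=y and j=j] dens_pos[OF \<sigma>, of T "clr j y"] by (intro ln_mono) auto
  moreover have "log_size * real (\<Sum>k\<in>win j. y k) \<le> log_size * 2 ^ (\<Sum>k\<in>win j. y k)"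
    by (intro mult_left_mono real_le_two_power log_size_nonneg)
  ultimately show "\<bar>ln_jump \<sigma> T j y\<bar> \<le> log_size * 2 ^ (\<Sum>k\<in>win j. y k)"
    unfolding ln_jump_def by linarith
qed


subsection \<open>Factorization at a run of zeros\<close>

text \<open>For a zero output the likelihood is \<open>exp (1 - Z x k)\<close>, whose exponent is
  affine in the inputs. The contributions of inputs up to \<open>t\<close> are collected here, those
  of later inputs and the constant in \<open>lik_hi\<close>.\<close>

definition lik_lo :: "int set \<Rightarrow> int \<Rightarrow> (int \<Rightarrow> real) \<Rightarrow> (int \<Rightarrow> nat) \<Rightarrow> real" where
  "lik_lo T t x y = lik {k \<in> T. k \<le> t} x y *
     (\<Prod>k\<in>{k \<in> T. t < k \<and> k \<le> t + int L}. exp (- (\<Sum>l\<in>{l. l \<le> L \<and> k - int l \<le> t}. h l * x (k - int l))))"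

definition lik_hi :: "int set \<Rightarrow> int \<Rightarrow> (int \<Rightarrow> real) \<Rightarrow> (int \<Rightarrow> nat) \<Rightarrow> real" where
  "lik_hi T t x y = lik {k \<in> T. t + int L < k} x y *
     (\<Prod>k\<in>{k \<in> T. t < k \<and> k \<le> t + int L}. exp (1 - dark - (\<Sum>l\<in>{l. l \<le> L \<and> t < k - int l}. h l * x (k - int l))))"

text \<open>Outputs up to \<open>t\<close> see inputs up to \<open>t\<close>, outputs beyond
  \<open>t + L\<close> see later inputs only, and the \<open>L\<close> zeros in between split
  through the exponential.\<close>

lemma lik_split:
  assumes T: "finite T" and z: "\<And>k. t < k \<Longrightarrow> k \<le> t + int L \<Longrightarrow> y k = 0"
  shows "lik T x y = lik_lo T t x y * lik_hi T t x y"
proof -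
  let ?f = "\<lambda>k. exp (1 - Z x k) * Z x k ^ y k"
  let ?A = "{k \<in> T. k \<le> t}" and ?B = "{k \<in> T. t < k \<and> k \<le> t + int L}" and ?C = "{k \<in> T. t + int L < k}"
  have "lik T x y = (\<Prod>k\<in>?A \<union> (?B \<union> ?C). ?f k)"
    unfolding lik_def by (rule prod.cong) auto
  also have "\<dots> = (\<Prod>k\<in>?A. ?f k) * ((\<Prod>k\<in>?B. ?f k) * (\<Prod>k\<in>?C. ?f k))"
    using T by (subst prod.union_disjoint, simp, simp, force, subst prod.union_disjoint) auto
  also have "(\<Prod>k\<in>?B. ?f k) = (\<Prod>k\<in>?B. exp (- (\<Sum>l\<in>{l. l \<le> L \<and> k - int l \<le> t}. h l * x (k - int l))) *
      exp (1 - dark - (\<Sum>l\<in>{l. l \<le> L \<and> t < k - int l}. h l * x (k - int l))))"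
  proof (rule prod.cong[OF refl])
    fix k assume k: "k \<in> ?B"
    have "{..L} = {l. l \<le> L \<and> k - int l \<le> t} \<union> {l. l \<le> L \<and> t < k - int l}" by auto
    then have "(\<Sum>l\<le>L. h l * x (k - int l)) = (\<Sum>l\<in>{l. l \<le> L \<and> k - int l \<le> t}. h l * x (k - int l))
        + (\<Sum>l\<in>{l. l \<le> L \<and> t < k - int l}. h l * x (k - int l))"
      by (subst sum.union_disjoint[symmetric]) auto
    then show "?f k = exp (- (\<Sum>l\<in>{l. l \<le> L \<and> k - int l \<le> t}. h l * x (k - int l))) *
      exp (1 - dark - (\<Sum>l\<in>{l. l \<le> L \<and> t < k - int l}. h l * x (k - int l)))"
      using z[of k] k by (simp add: intensity_def exp_add[symmetric])
  qed
  finally show ?thesis by (simp add: lik_lo_def lik_hi_def lik_def prod.distrib ac_simps)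
qed

lemma depends_on_lik_lo: "depends_on {..t} (\<lambda>x. lik_lo T t x y)"
proof (rule depends_onI)
  fix x x' :: "int \<Rightarrow> real" assume eq: "\<And>i. i \<in> {..t} \<Longrightarrow> x i = x' i"
  have "lik {k \<in> T. k \<le> t} x y = lik {k \<in> T. k \<le> t} x' y"
    by (rule lik_cong, rule eq) auto
  moreover have "(\<Sum>l\<in>{l. l \<le> L \<and> k - int l \<le> t}. h l * x (k - int l)) = (\<Sum>l\<in>{l. l \<le> L \<and> k - int l \<le> t}. h l * x' (k - int l))" for k
    by (rule sum.cong) (auto simp: eq)
  ultimately show "lik_lo T t x y = lik_lo T t x' y" by (simp add: lik_lo_def)
qed

lemma depends_on_lik_hi: "depends_on {t<..} (\<lambda>x. lik_hi T t x y)"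
proof (rule depends_onI)
  fix x x' :: "int \<Rightarrow> real" assume eq: "\<And>i. i \<in> {t<..} \<Longrightarrow> x i = x' i"
  have "lik {k \<in> T. t + int L < k} x y = lik {k \<in> T. t + int L < k} x' y"
    by (rule lik_cong, rule eq) auto
  moreover have "(\<Sum>l\<in>{l. l \<le> L \<and> t < k - int l}. h l * x (k - int l)) = (\<Sum>l\<in>{l. l \<le> L \<and> t < k - int l}. h l * x' (k - int l))" for k
    by (rule sum.cong) (auto simp: eq)
  ultimately show "lik_hi T t x y = lik_hi T t x' y" by (simp add: lik_hi_def)
qed

lemma tame_mult: "tame \<Phi> \<Longrightarrow> tame \<Psi> \<Longrightarrow> tame (\<lambda>x. \<Phi> x * \<Psi> x)"
proof -
  assume a: "tame \<Phi>" "tame \<Psi>"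
  then obtain C D where C: "\<forall>x\<in>inputs. \<bar>\<Phi> x\<bar> \<le> C" and D: "\<forall>x\<in>inputs. \<bar>\<Psi> x\<bar> \<le> D" by (auto simp: tame_def)
  show ?thesis
  proof (rule tameI[where C="C * D"])
    show "(\<lambda>x. \<Phi> x * \<Psi> x) \<in> borel_measurable SX" using a unfolding tame_def by (intro borel_measurable_times) auto
    fix x assume "x \<in> inputs"
    then show "\<bar>\<Phi> x * \<Psi> x\<bar> \<le> C * D"
      unfolding abs_mult using C D by (intro mult_mono) (auto intro: order_trans[OF abs_ge_zero])
  qed
qed

lemma tame_lik_lo: "tame (\<lambda>x. lik_lo T t x y)"
  unfolding lik_lo_def
proof (intro tame_mult tame_lik tameI)
  fix x assume x: "x \<in> inputs"
  have "0 \<le> (\<Sum>l\<in>{l. l \<le> L \<and> k - int l \<le> t}. h l * x (k - int l))" for k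
    using x h_nonneg by (intro sum_nonneg mult_nonneg_nonneg) (auto simp: inputs_def)
  then have "(\<Prod>k\<in>{k \<in> T. t < k \<and> k \<le> t + int L}. exp (- (\<Sum>l\<in>{l. l \<le> L \<and> k - int l \<le> t}. h l * x (k - int l)))) \<le> 1"
    by (intro prod_le_1) auto
  then show "\<bar>\<Prod>k\<in>{k \<in> T. t < k \<and> k \<le> t + int L}. exp (- (\<Sum>l\<in>{l. l \<le> L \<and> k - int l \<le> t}. h l * x (k - int l)))\<bar> \<le> 1"
    by (simp add: abs_prod)
qed measurable

lemma tame_lik_hi: "tame (\<lambda>x. lik_hi T t x y)"
  unfolding lik_hi_def
proof (intro tame_mult tame_lik tameI)
  fix x assume x: "x \<in> inputs"
  have nn: "0 \<le> (\<Sum>l\<in>{l. l \<le> L \<and> t < k - int l}. h l * x (k - int l))" for k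
    using x h_nonneg by (intro sum_nonneg mult_nonneg_nonneg) (auto simp: inputs_def)
  have "1 - dark - (\<Sum>l\<in>{l. l \<le> L \<and> t < k - int l}. h l * x (k - int l)) \<le> 1" for k
    using dark nn[of k] by linarith
  then have "(\<Prod>k\<in>{k \<in> T. t < k \<and> k \<le> t + int L}. exp (1 - dark - (\<Sum>l\<in>{l. l \<le> L \<and> t < k - int l}. h l * x (k - int l))))
      \<le> (\<Prod>k\<in>{k \<in> T. t < k \<and> k \<le> t + int L}. exp 1)"
    by (intro prod_mono) auto
  then show "\<bar>\<Prod>k\<in>{k \<in> T. t < k \<and> k \<le> t + int L}. exp (1 - dark - (\<Sum>l\<in>{l. l \<le> L \<and> t < k - int l}. h l * x (k - int l)))\<bar>
      \<le> (\<Prod>k\<in>{k \<in> T. t < k \<and> k \<le> t + int L}. exp 1)"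
    by (simp add: abs_prod)
qed measurable

definition dens_lo :: "(int \<Rightarrow> real measure) \<Rightarrow> int set \<Rightarrow> int \<Rightarrow> (int \<Rightarrow> nat) \<Rightarrow> real" where
  "dens_lo \<sigma> T t y = (\<integral>x. lik_lo T t x y \<partial>PiM UNIV \<sigma>)"

definition dens_hi :: "(int \<Rightarrow> real measure) \<Rightarrow> int set \<Rightarrow> int \<Rightarrow> (int \<Rightarrow> nat) \<Rightarrow> real" where
  "dens_hi \<sigma> T t y = (\<integral>x. lik_hi T t x y \<partial>PiM UNIV \<sigma>)"

text \<open>The two factors of the likelihood read disjoint sets of independent inputs.\<close>

lemma dens_split:
  assumes \<sigma>: "laws \<sigma>" and T: "finite T" and z: "\<And>k. t < k \<Longrightarrow> k \<le> t + int L \<Longrightarrow> y k = 0"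
  shows "dens \<sigma> T y = dens_lo \<sigma> T t y * dens_hi \<sigma> T t y"
proof -
  have "dens \<sigma> T y = (\<integral>x. lik_lo T t x y * lik_hi T t x y \<partial>PiM UNIV \<sigma>)"
    using lik_split[OF T z] by (simp add: dens_def)
  also have "\<dots> = dens_lo \<sigma> T t y * dens_hi \<sigma> T t y"
    unfolding dens_lo_def dens_hi_def
    by (rule integral_PiM_mult[where I="{..t}" and J="{t<..}"])
      (auto intro!: lawsD(1)[OF \<sigma>] tame_integrable[OF _ \<sigma>] tame_lik_lo tame_lik_hi tame_mult depends_on_lik_lo depends_on_lik_hi)
  finally show ?thesis .
qed

lemma dens_lo_cong: "(\<And>k. k \<le> t \<Longrightarrow> y k = y' k) \<Longrightarrow> dens_lo \<sigma> T t y = dens_lo \<sigma> T t y'"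
  unfolding dens_lo_def lik_lo_def lik_def
  by (intro Bochner_Integration.integral_cong[OF refl] arg_cong2[where f="(*)"] prod.cong refl) simp

lemma dens_hi_cong: "(\<And>k. t + int L < k \<Longrightarrow> y k = y' k) \<Longrightarrow> dens_hi \<sigma> T t y = dens_hi \<sigma> T t y'"
  unfolding dens_hi_def lik_hi_def lik_def
  by (intro Bochner_Integration.integral_cong[OF refl] arg_cong2[where f="(*)"] prod.cong refl) simp

lemma dens_hi_upd:
  assumes "laws \<sigma>" "G \<in> input_laws A" "j \<le> t"
  shows "dens_hi (\<sigma>(j := G)) T t y = dens_hi \<sigma> T t y"
  unfolding dens_hi_def
  by (rule integral_PX_cong[OF tame_lik_hi depends_on_lik_hi laws_upd[OF assms(1,2)] assms(1)])
    (use assms in auto)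

text \<open>At a run of zeros starting after \<open>t\<close>, the factor \<open>dens_hi\<close>
  involves only sites after \<open>t\<close>, hence not the law at \<open>j\<close>, and cancels
  from the ratio. The remaining \<open>dens_lo\<close> reads outputs up to \<open>t\<close>.\<close>

lemma settled_dens_ratio:
  assumes \<sigma>: "laws \<sigma>" and G: "G \<in> input_laws A" and T: "finite T"
  shows "settled j (\<lambda>y. dens (\<sigma>(j := G)) T y / dens \<sigma> T y)"
  unfolding settled_def
proof (intro allI impI)
  fix t and y y' :: "int \<Rightarrow> nat"
  assume t: "j + int L \<le> t" and eq: "\<forall>k\<le>t + int L. y k = y' k" and z: "\<forall>k\<in>{t + 1..t + int L}. y k = 0"
  note \<sigma>' = laws_upd[OF \<sigma> G, of j]
  have *: "dens (\<sigma>(j := G)) T u / dens \<sigma> T u = dens_lo (\<sigma>(j := G)) T t u / dens_lo \<sigma> T t u"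
    if u: "\<And>k. t < k \<Longrightarrow> k \<le> t + int L \<Longrightarrow> u k = 0" for u
    using dens_split[OF \<sigma> T u] dens_split[OF \<sigma>' T u] dens_pos[OF \<sigma>, of T u] dens_hi_upd[OF \<sigma> G, of j t T u] t
    by auto
  have "dens_lo (\<sigma>(j := G)) T t y = dens_lo (\<sigma>(j := G)) T t y'" "dens_lo \<sigma> T t y = dens_lo \<sigma> T t y'"
    using eq by (auto intro!: dens_lo_cong)
  moreover have "y' k = 0" if "t < k" "k \<le> t + int L" for k using z eq that by auto
  ultimately show "dens (\<sigma>(j := G)) T y / dens \<sigma> T y = dens (\<sigma>(j := G)) T y' / dens \<sigma> T y'"
    using *[of y] *[of y'] z by auto
qed

text \<open>The same cancellation, now between an output sequence and its cleared version: the
  window of \<open>j\<close> ends at or before \<open>t\<close>, so clearing leaves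
  \<open>dens_hi\<close> unchanged.\<close>

lemma settled_ln_jump:
  assumes \<sigma>: "laws \<sigma>" and T: "finite T"
  shows "settled j (ln_jump \<sigma> T j)"
  unfolding settled_def
proof (intro allI impI)
  fix t and y y' :: "int \<Rightarrow> nat"
  assume t: "j + int L \<le> t" and eq: "\<forall>k\<le>t + int L. y k = y' k" and z: "\<forall>k\<in>{t + 1..t + int L}. y k = 0"
  have *: "ln_jump \<sigma> T j u = ln (dens_lo \<sigma> T t u / dens_lo \<sigma> T t (clr j u))"
    if u: "\<And>k. t < k \<Longrightarrow> k \<le> t + int L \<Longrightarrow> u k = 0" for u
  proof -
    have cu: "\<And>k. t < k \<Longrightarrow> k \<le> t + int L \<Longrightarrow> clr j u k = 0" using u by (auto simp: clr_def glue_def)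
    have "dens_hi \<sigma> T t (clr j u) = dens_hi \<sigma> T t u"
      by (rule dens_hi_cong) (use t in \<open>auto simp: clr_def glue_def win_def\<close>)
    then have "dens \<sigma> T u / dens \<sigma> T (clr j u) = dens_lo \<sigma> T t u / dens_lo \<sigma> T t (clr j u)"
      using dens_split[OF \<sigma> T u] dens_split[OF \<sigma> T cu] dens_pos[OF \<sigma>, of T u] by auto
    moreover have "ln_jump \<sigma> T j u = ln (dens \<sigma> T u / dens \<sigma> T (clr j u))"
      using dens_pos[OF \<sigma>, of T u] dens_pos[OF \<sigma>, of T "clr j u"] by (simp add: ln_jump_def ln_div)
    ultimately show ?thesis by simp
  qed
  have "dens_lo \<sigma> T t y = dens_lo \<sigma> T t y'" "dens_lo \<sigma> T t (clr j y) = dens_lo \<sigma> T t (clr j y')"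
    using eq by (auto intro!: dens_lo_cong simp: clr_def glue_def)
  moreover have "y' k = 0" if "t < k" "k \<le> t + int L" for k using z eq that by auto
  ultimately show "ln_jump \<sigma> T j y = ln_jump \<sigma> T j y'"
    using *[of y] *[of y'] z by auto
qed


text \<open>\<open>eta z\<close> is the relative entropy of a Poisson variable of mean \<open>z\<close> with respect to one of mean \<open>1\<close>. Hence the
  mean of \<open>score F n\<close> under \<open>F\<close> is the mutual information of the outputs \<open>Y\<^sub>1, \<dots>, Y\<^sub>n\<close> and all inputs
  \<open>X\<^sub>1\<^sub>-\<^sub>L, \<dots>, X\<^sub>n\<close> on which they depend.\<close>

definition eta :: "real \<Rightarrow> real" where "eta z = 1 - z + z * ln z"

definition eta_size :: real where "eta_size = 1 + peak + peak * log_size"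

definition outs :: "nat \<Rightarrow> int set" where "outs n = {1..int n}"

text \<open>All inputs that reach the output block: output 1 looks back as far as
  \<open>1 - int L\<close>.\<close>

definition sites :: "nat \<Rightarrow> int set" where "sites n = {1 - int L..int n}"

abbreviation iid :: "real measure \<Rightarrow> int \<Rightarrow> real measure" where "iid F \<equiv> (\<lambda>_. F)"

definition score :: "real measure \<Rightarrow> nat \<Rightarrow> (int \<Rightarrow> real) \<Rightarrow> real" where
  "score F n x = (\<Sum>k\<in>outs n. eta (Z x k)) - (\<integral>y. ln (dens (iid F) (outs n) y) \<partial>K x)"

lemma finite_outs [simp]: "finite (outs n)" and card_outs [simp]: "card (outs n) = n"
  and finite_sites [simp]: "finite (sites n)" and card_sites [simp]: "card (sites n) = n + L"
  by (simp_all add: outs_def sites_def)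

lemma laws_iid: "F \<in> input_laws A \<Longrightarrow> laws (iid F)"
  by (simp add: laws_def)

lemma eta_size_nonneg: "eta_size \<ge> 0"
  using peak_pos log_size_nonneg by (simp add: eta_size_def)

lemma eta_bound: assumes "x \<in> inputs" shows "\<bar>eta (Z x k)\<bar> \<le> eta_size"
proof -
  have "ln dark \<le> ln (Z x k)" "ln (Z x k) \<le> ln peak"
    using Z_lower[OF assms, of k] Z_upper[OF assms, of k] dark by auto
  then have "\<bar>ln (Z x k)\<bar> \<le> log_size" by (auto simp: log_size_def)
  then have "\<bar>Z x k * ln (Z x k)\<bar> \<le> peak * log_size"
    using Z_pos[OF assms, of k] Z_upper[OF assms, of k] unfolding abs_mult by (intro mult_mono) auto
  then show ?thesis
    using Z_pos[OF assms, of k] Z_upper[OF assms, of k] unfolding eta_def eta_size_def by linarith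
qed

lemma measurable_eta [measurable]: "(\<lambda>x. eta (Z x k)) \<in> borel_measurable SX"
  unfolding eta_def by measurable

lemma tame_sum_eta: "tame (\<lambda>x. \<Sum>k\<in>T. eta (Z x k))"
proof (rule tameI)
  fix x assume x: "x \<in> inputs"
  show "\<bar>\<Sum>k\<in>T. eta (Z x k)\<bar> \<le> (\<Sum>k\<in>T. eta_size)"
    by (rule order_trans[OF sum_abs]) (intro sum_mono eta_bound x)
qed measurable

lemma tame_score: assumes "F \<in> input_laws A" shows "tame (score F n)"
  unfolding score_def
  by (intro tame_diff tame_sum_eta tame_output_average[OF growth_ln_dens[OF laws_iid[OF assms]]])
    (auto simp: ln_size_nonneg)

lemma outs_sites: "k \<in> outs n \<Longrightarrow> {k - int L..k} \<subseteq> sites n"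
  by (auto simp: outs_def sites_def)

lemma depends_on_score:
  assumes "F \<in> input_laws A"
  shows "depends_on (sites n) (score F n)"
proof (rule depends_onI)
  fix x x' :: "int \<Rightarrow> real" assume eq: "\<And>i. i \<in> sites n \<Longrightarrow> x i = x' i"
  have "depends_on (sites n) (\<lambda>x. \<integral>y. ln (dens (iid F) (outs n) y) \<partial>K x)"
  proof (rule depends_on_output_average[where T="outs n"])
    show "(\<lambda>y. ln (dens (iid F) (outs n) y)) \<in> borel_measurable SY"
      using growth_ln_dens[OF laws_iid[OF assms], of "outs n"] by (simp add: growth_def)
    show "depends_on (outs n) (\<lambda>y. ln (dens (iid F) (outs n) y))"
      by (rule depends_onI, rule arg_cong[where f=ln], rule depends_onD[OF depends_on_dens])
  qed (rule outs_sites)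
  then have "(\<integral>y. ln (dens (iid F) (outs n) y) \<partial>K x) = (\<integral>y. ln (dens (iid F) (outs n) y) \<partial>K x')"
    by (rule depends_onD) (rule eq)
  moreover have "(\<Sum>k\<in>outs n. eta (Z x k)) = (\<Sum>k\<in>outs n. eta (Z x' k))"
  proof (rule sum.cong[OF refl])
    fix k assume "k \<in> outs n"
    then have "Z x k = Z x' k" by (intro Z_cong eq) (auto simp: outs_def sites_def)
    then show "eta (Z x k) = eta (Z x' k)" by simp
  qed
  ultimately show "score F n x = score F n x'" by (simp add: score_def)
qed

subsection \<open>The influence of one and of two inputs\<close>

text \<open>The log density after clearing the window of \<open>j\<close> has the same mean for both
  values of input \<open>j\<close>, so it may be subtracted on both sides; \<open>ln_jump\<close>
  takes the place of the full logarithm.\<close>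

lemma score_diff:
  assumes F: "F \<in> input_laws A" and x: "x \<in> inputs" and s: "0 \<le> s" "s \<le> A"
  shows "score F n (x(j := s)) - score F n (x(j := 0)) =
    (\<Sum>k\<in>outs n. eta (Z (x(j := s)) k) - eta (Z (x(j := 0)) k))
    - ((\<integral>y. ln_jump (iid F) (outs n) j y \<partial>K (x(j := s))) - (\<integral>y. ln_jump (iid F) (outs n) j y \<partial>K (x(j := 0))))"
proof -
  note \<sigma> = laws_iid[OF F]
  let ?f = "\<lambda>y. ln (dens (iid F) (outs n) y)"
  have eq: "(\<integral>y. ln_jump (iid F) (outs n) j y \<partial>K x') = (\<integral>y. ?f y \<partial>K x') - (\<integral>y. ?f (clr j y) \<partial>K x')"
    if x': "x' \<in> inputs" for x'
  proof -
    have i: "integrable (K x') ?f"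
      by (rule growth_integral(1)[OF x' _ _ _ growth_ln_dens[OF \<sigma>]]) (auto simp: ln_size_nonneg)
    have j: "integrable (K x') (ln_jump (iid F) (outs n) j)"
      by (rule growth_integral(1)[OF x' _ _ _ growth_ln_jump[OF \<sigma>]]) (auto simp: log_size_nonneg)
    have "integrable (K x') (\<lambda>y. ?f y - ln_jump (iid F) (outs n) j y)" using i j by simp
    then have "integrable (K x') (\<lambda>y. ?f (clr j y))" by (simp add: ln_jump_def)
    then show ?thesis using i by (simp add: ln_jump_def)
  qed
  have "(\<integral>y. ?f (clr j y) \<partial>K (x(j := s))) = (\<integral>y. ?f (clr j y) \<partial>K (x(j := 0)))"
  proof (rule integral_K_cong[where I="- win j"])
    have "dens (iid F) (outs n) \<in> borel_measurable SY" using \<sigma> by measurable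
    then show "(\<lambda>y. ?f (clr j y)) \<in> borel_measurable SY"
      by (intro borel_measurable_ln measurable_compose[OF measurable_clr])
    show "depends_on (- win j) (\<lambda>y. ?f (clr j y))"
    proof (rule depends_onI)
      fix y y' :: "int \<Rightarrow> nat" assume "\<And>i. i \<in> - win j \<Longrightarrow> y i = y' i"
      then have "clr j y = clr j y'" by (auto simp: clr_def glue_def)
      then show "?f (clr j y) = ?f (clr j y')" by simp
    qed
  qed (simp add: Z_upd_outside)
  then show ?thesis
    using eq[OF inputs_upd[OF x s]] eq[OF inputs_upd[OF x order_refl A]]
    by (simp add: score_def sum_subtractf)
qed

lemma sum_window_le:
  fixes a :: "int \<Rightarrow> real"
  assumes "finite T" "\<And>k. k \<in> T \<Longrightarrow> k \<notin> win j \<Longrightarrow> a k = 0" "\<And>k. k \<in> T \<Longrightarrow> \<bar>a k\<bar> \<le> c" "c \<ge> 0"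
  shows "\<bar>\<Sum>k\<in>T. a k\<bar> \<le> real (L + 1) * c"
proof -
  have "(\<Sum>k\<in>T. a k) = (\<Sum>k\<in>T \<inter> win j. a k)"
    using assms by (intro sum.mono_neutral_right) auto
  also have "\<bar>\<dots>\<bar> \<le> (\<Sum>k\<in>T \<inter> win j. c)"
    by (rule order_trans[OF sum_abs]) (intro sum_mono, use assms in auto)
  also have "\<dots> \<le> (\<Sum>k\<in>win j. c)"
    using assms by (intro sum_mono2) auto
  finally show ?thesis by simp
qed

definition step_size :: real where
  "step_size = 2 * real (L + 1) * eta_size + 2 * log_size * mgf 2 ^ (L + 1)"

lemma step_size_nonneg: "step_size \<ge> 0"
  using eta_size_nonneg log_size_nonneg by (simp add: step_size_def mgf_def)

lemma score_step:
  assumes F: "F \<in> input_laws A" and x: "x \<in> inputs" and s: "0 \<le> s" "s \<le> A"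
  shows "\<bar>score F n (x(j := s)) - score F n (x(j := 0))\<bar> \<le> step_size"
proof -
  note xs = inputs_upd[OF x s, of j] and x0 = inputs_upd[OF x order_refl A, of j]
  note g = growth_ln_jump[OF laws_iid[OF F] finite_outs, of j n]
  have b: "\<bar>\<integral>y. ln_jump (iid F) (outs n) j y \<partial>K x'\<bar> \<le> log_size * mgf 2 ^ (L + 1)" if "x' \<in> inputs" for x'
    using growth_integral(2)[OF that finite_win _ log_size_nonneg g] by simp
  have "\<bar>\<Sum>k\<in>outs n. eta (Z (x(j := s)) k) - eta (Z (x(j := 0)) k)\<bar> \<le> real (L + 1) * (2 * eta_size)"
  proof (rule sum_window_le[where j=j])
    show "\<bar>eta (Z (x(j := s)) k) - eta (Z (x(j := 0)) k)\<bar> \<le> 2 * eta_size" for k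
      using eta_bound[OF xs, of k] eta_bound[OF x0, of k] by linarith
  qed (use eta_size_nonneg in \<open>auto simp: Z_upd_outside\<close>)
  then show ?thesis
    using b[OF xs] b[OF x0] unfolding score_diff[OF F x s] step_size_def by (simp add: algebra_simps)
qed

text \<open>The \<open>eta\<close> terms interact only up to distance \<open>L\<close>, and division
  by \<open>rho ^ L\<close> puts them under the same geometric decay. The second summand accounts
  for the four means of \<open>ln_jump\<close>.\<close>

definition pair_size :: real where
  "pair_size = 4 * real (L + 1) * eta_size / rho ^ L + 4 * decay log_size 2"

lemma pair_size_nonneg: "pair_size \<ge> 0"
  using eta_size_nonneg rho decay_nonneg[OF log_size_nonneg] by (simp add: pair_size_def)

text \<open>Through \<open>ln_jump\<close> the difference at the earlier site \<open>i\<close>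
  becomes the mean of a function settled at \<open>i\<close>, and the later input \<open>j\<close>
  influences such a mean only with geometric decay.\<close>

lemma score_pair:
  assumes F: "F \<in> input_laws A" and x: "x \<in> inputs" and s: "0 \<le> s" "s \<le> A" and t: "0 \<le> t" "t \<le> A" and ij: "i < j"
  shows "\<bar>(score F n (x(j := s, i := t)) - score F n (x(j := s, i := 0)))
      - (score F n (x(j := 0, i := t)) - score F n (x(j := 0, i := 0)))\<bar> \<le> pair_size * rho ^ nat (j - i)"
proof -
  let ?J = "\<lambda>x. \<integral>y. ln_jump (iid F) (outs n) i y \<partial>K x"
  let ?e = "\<lambda>k. (eta (Z (x(j := s, i := t)) k) - eta (Z (x(j := s, i := 0)) k))
      - (eta (Z (x(j := 0, i := t)) k) - eta (Z (x(j := 0, i := 0)) k))"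
  note x0 = inputs_upd[OF x order_refl A] and xs = inputs_upd[OF x s]
  \<comment> \<open>\<open>influence_decay\<close> compares a sequence with its update at the later
    site, so the update at \<open>j\<close> has to come last.\<close>
  have tw: "x(j := a, i := b) = x(i := b, j := a)" for a b using ij by (auto simp: fun_eq_iff)
  have d: "\<bar>?J (x(i := b)) - ?J (x(i := b, j := a))\<bar> \<le> decay log_size 2 * rho ^ nat (j - i)"
    if "0 \<le> a" "a \<le> A" "0 \<le> b" "b \<le> A" for a b
    by (rule influence_decay[OF inputs_upd[OF x that(3,4)] that(1,2) _ log_size_nonneg
          growth_ln_jump[OF laws_iid[OF F] finite_outs] settled_ln_jump[OF laws_iid[OF F] finite_outs]]) simp
  have J: "\<bar>(?J (x(j := s, i := t)) - ?J (x(j := s, i := 0))) - (?J (x(j := 0, i := t)) - ?J (x(j := 0, i := 0)))\<bar>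
      \<le> 4 * decay log_size 2 * rho ^ nat (j - i)"
    unfolding tw using d[OF s t] d[OF s order_refl A] d[OF order_refl A t] d[OF order_refl A order_refl A] by linarith
  have E: "\<bar>\<Sum>k\<in>outs n. ?e k\<bar> \<le> real (L + 1) * (4 * eta_size / rho ^ L * rho ^ nat (j - i))"
  proof (cases "j \<le> i + int L")
    case True
    then have "rho ^ L \<le> rho ^ nat (j - i)" using rho by (intro power_decreasing) auto
    then have "4 * eta_size * rho ^ L \<le> 4 * eta_size * rho ^ nat (j - i)"
      using eta_size_nonneg by (intro mult_left_mono) auto
    then have le: "4 * eta_size \<le> 4 * eta_size / rho ^ L * rho ^ nat (j - i)"
      using rho by (simp add: field_simps)
    show ?thesis
    proof (rule sum_window_le[where j=i])
      show "\<bar>?e k\<bar> \<le> 4 * eta_size / rho ^ L * rho ^ nat (j - i)" for k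
      proof -
        have "\<bar>?e k\<bar> \<le> 4 * eta_size"
          using eta_bound[OF inputs_upd[OF xs t], of j i k] eta_bound[OF inputs_upd[OF xs order_refl A], of j i k]
            eta_bound[OF inputs_upd[OF x0 t], of j i k] eta_bound[OF inputs_upd[OF x0 order_refl A], of j i k]
          by linarith
        then show ?thesis using le by linarith
      qed
    qed (use eta_size_nonneg rho in \<open>auto simp: Z_upd_outside\<close>)
  next
    case False
    \<comment> \<open>No output lies in both windows, so each summand ignores one of the two inputs
      and its mixed difference vanishes.\<close>
    have "?e k = 0" for k
    proof (cases "k \<in> win i")
      case True
      then have "k \<notin> win j" using False by (auto simp: win_def)
      then show ?thesis unfolding tw by (simp add: Z_upd_outside)
    qed (simp add: Z_upd_outside)
    then show ?thesis using eta_size_nonneg rho by (simp del: of_nat_add)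
  qed
  have "(score F n (x(j := s, i := t)) - score F n (x(j := s, i := 0)))
      - (score F n (x(j := 0, i := t)) - score F n (x(j := 0, i := 0)))
    = (\<Sum>k\<in>outs n. ?e k) - ((?J (x(j := s, i := t)) - ?J (x(j := s, i := 0))) - (?J (x(j := 0, i := t)) - ?J (x(j := 0, i := 0))))"
    unfolding score_diff[OF F xs t] score_diff[OF F x0 t] by (simp add: sum_subtractf)
  also have "\<bar>\<dots>\<bar> \<le> real (L + 1) * (4 * eta_size / rho ^ L * rho ^ nat (j - i)) + 4 * decay log_size 2 * rho ^ nat (j - i)"
    using E J by linarith
  also have "\<dots> = pair_size * rho ^ nat (j - i)" by (simp add: pair_size_def algebra_simps)
  finally show ?thesis .
qed

subsection \<open>Exchanging the input law site by site\<close>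

definition hybrid :: "real measure \<Rightarrow> real measure \<Rightarrow> int \<Rightarrow> int \<Rightarrow> real measure" where
  "hybrid H F m = (\<lambda>k. if k < m then H else F)"

lemma laws_hybrid: "H \<in> input_laws A \<Longrightarrow> F \<in> input_laws A \<Longrightarrow> laws (hybrid H F m)"
  by (simp add: laws_def hybrid_def)

lemma hybrid_step: "hybrid H F (m + 1) = (hybrid H F m)(m := H)" "(hybrid H F m)(m := F) = hybrid H F m"
  by (auto simp: hybrid_def fun_eq_iff)

text \<open>The integral is affine in the law of a single site, so putting the mixture there adds
  \<open>\<epsilon>\<close> times the effect of putting \<open>G\<close> there.\<close>

lemma hybrid_telescope:
  assumes \<Phi>: "tame \<Phi>" and FG: "F \<in> input_laws A" "G \<in> input_laws A" and e: "0 \<le> \<epsilon>" "\<epsilon> \<le> 1" and "a \<le> b"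
  shows "(\<integral>x. \<Phi> x \<partial>PiM UNIV (hybrid (mixture \<epsilon> F G) F b)) - (\<integral>x. \<Phi> x \<partial>PiM UNIV (hybrid (mixture \<epsilon> F G) F a))
    = \<epsilon> * (\<Sum>i\<in>{a..<b}. (\<integral>x. \<Phi> x \<partial>PiM UNIV ((hybrid (mixture \<epsilon> F G) F i)(i := G)))
        - (\<integral>x. \<Phi> x \<partial>PiM UNIV (hybrid (mixture \<epsilon> F G) F i)))"
  using \<open>a \<le> b\<close>
proof (induction b rule: int_ge_induct)
  case (step b)
  let ?H = "mixture \<epsilon> F G"
  have l: "laws (hybrid ?H F b)" by (intro laws_hybrid mixture_in_input_laws FG e)
  have "(\<integral>x. \<Phi> x \<partial>PiM UNIV (hybrid ?H F (b + 1)))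
      = (1 - \<epsilon>) * (\<integral>x. \<Phi> x \<partial>PiM UNIV (hybrid ?H F b)) + \<epsilon> * (\<integral>x. \<Phi> x \<partial>PiM UNIV ((hybrid ?H F b)(b := G)))"
    unfolding hybrid_step(1) integral_upd_mixture[OF \<Phi> l FG e] hybrid_step(2) ..
  moreover have "(\<Sum>i\<in>{a..<b + 1}. d i) = (\<Sum>i\<in>{a..<b}. d i) + d b" for d :: "int \<Rightarrow> real"
  proof -
    have "{a..<b + 1} = insert b {a..<b}" using step.hyps by auto
    then show ?thesis by simp
  qed
  ultimately show ?case using step.IH by (simp add: algebra_simps del: fun_upd_apply)
qed simp

text \<open>Source of the second factor \<open>\<epsilon>\<close> in both second-order estimates: it
  controls how far a mean moves when the environment changes from one hybrid to another.\<close>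

lemma hybrid_drift:
  assumes \<Phi>: "tame \<Phi>" and FG: "F \<in> input_laws A" "G \<in> input_laws A" and e: "0 \<le> \<epsilon>" "\<epsilon> \<le> 1" and "a \<le> b"
    and c: "\<And>i x t. i \<in> {a..<b} \<Longrightarrow> x \<in> inputs \<Longrightarrow> 0 \<le> t \<Longrightarrow> t \<le> A \<Longrightarrow> \<bar>\<Phi> (x(i := t)) - \<Phi> (x(i := 0))\<bar> \<le> c i"
  shows "\<bar>(\<integral>x. \<Phi> x \<partial>PiM UNIV (hybrid (mixture \<epsilon> F G) F b)) - (\<integral>x. \<Phi> x \<partial>PiM UNIV (hybrid (mixture \<epsilon> F G) F a))\<bar>
    \<le> \<epsilon> * (\<Sum>i\<in>{a..<b}. 2 * c i)"
proof -
  let ?H = "mixture \<epsilon> F G"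
  let ?d = "\<lambda>i. (\<integral>x. \<Phi> x \<partial>PiM UNIV ((hybrid ?H F i)(i := G))) - (\<integral>x. \<Phi> x \<partial>PiM UNIV (hybrid ?H F i))"
  have "\<bar>?d i\<bar> \<le> 2 * c i" if "i \<in> {a..<b}" for i
    using integral_upd_diff[OF \<Phi> laws_hybrid[OF mixture_in_input_laws[OF FG e] FG(1)] FG, where j=i and c="c i" and m1=i] c[OF that]
    unfolding hybrid_step(2) by blast
  then have "\<bar>\<Sum>i\<in>{a..<b}. ?d i\<bar> \<le> (\<Sum>i\<in>{a..<b}. 2 * c i)"
    by (intro order_trans[OF sum_abs] sum_mono)
  then show ?thesis
    unfolding hybrid_telescope[OF \<Phi> FG e \<open>a \<le> b\<close>] abs_mult using e by (simp add: mult_left_mono)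
qed

end

section \<open>Fekete's lemma and telescoping sums\<close>

text \<open>Fekete's lemma: fix \<open>m\<close> with \<open>u m / real m\<close> close to the
  infimum and divide \<open>n\<close> by \<open>m\<close>; \<open>u n\<close> is then at most the
  linear term plus a constant. The lower bound on \<open>u\<close> keeps the infimum finite.\<close>

lemma subadditive_convergent:
  fixes u :: "nat \<Rightarrow> real"
  assumes sub: "\<And>m n. u (m + n) \<le> u m + u n" and lb: "\<And>n. - B * real n \<le> u n"
  shows "convergent (\<lambda>n. u n / real n)"
proof -
  define l where "l = (INF n\<in>{1..}. u n / real n)"
  have bdd: "bdd_below ((\<lambda>n. u n / real n) ` {1..})"
    using lb by (intro bdd_belowI[where m="- B"]) (auto simp: field_simps)
  have u0: "0 \<le> u 0" using sub[of 0 0] by simp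
  have mult: "u (q * m) \<le> u 0 + real q * u m" for q m
  proof (induction q)
    case (Suc q)
    then show ?case using sub[of m "q * m"] by (simp add: algebra_simps)
  qed simp
  have "(\<lambda>n. u n / real n) \<longlonglongrightarrow> l"
  proof (rule LIMSEQ_I)
    fix e :: real assume e: "e > 0"
    obtain m where m: "m \<ge> 1" "u m / real m < l + e / 2"
      using cINF_less_iff[OF _ bdd, of "l + e / 2"] e unfolding l_def by auto
    define a where "a = u m / real m"
    \<comment> \<open>Pays for \<open>u 0\<close>, for the remainder \<open>u (n mod m)\<close>, and
      for replacing \<open>n div m * m\<close> by \<open>n\<close> in the linear term.\<close>
    define C where "C = u 0 + (\<Sum>r<m. \<bar>u r\<bar>) + real m * \<bar>a\<bar>"
    have C: "C \<ge> 0" using u0 by (auto simp: C_def intro!: add_nonneg_nonneg sum_nonneg)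
    have up: "u n \<le> real n * a + C" for n
    proof -
      have 1: "u n \<le> u (n div m * m) + u (n mod m)" using sub[of "n div m * m" "n mod m"] by simp
      have 2: "u (n mod m) \<le> (\<Sum>r<m. \<bar>u r\<bar>)"
        using m by (intro order_trans[OF abs_ge_self member_le_sum[where f="\<lambda>r. \<bar>u r\<bar>"]]) auto
      have 3: "u (n div m * m) \<le> u 0 + real (n div m) * u m" by (rule mult)
      have 4: "real (n div m) * u m = real (n div m * m) * a" using m by (simp add: a_def)
      have "real n = real (n div m * m) + real (n mod m)" unfolding of_nat_add[symmetric] by simp
      then have 5: "real (n div m * m) * a = real n * a - real (n mod m) * a" by (simp add: algebra_simps)
      have "- (real (n mod m) * a) \<le> real (n mod m) * \<bar>a\<bar>" by (metis abs_ge_minus_self abs_mult abs_of_nat)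
      also have "\<dots> \<le> real m * \<bar>a\<bar>" using m by (intro mult_right_mono) auto
      finally have 6: "- (real (n mod m) * a) \<le> real m * \<bar>a\<bar>" .
      show ?thesis unfolding C_def using 1 2 3 4 5 6 by linarith
    qed
    obtain N where N: "N \<ge> 1" "C / real N < e / 2"
    proof -
      obtain N where "real N > C / (e / 2)" using reals_Archimedean2 by blast
      then have "C / real (Suc N) < e / 2" using e C by (simp add: field_simps)
      then show ?thesis using that[of "Suc N"] by auto
    qed
    have "norm (u n / real n - l) < e" if n: "n \<ge> N" for n
    proof -
      have n0: "real n > 0" using n N by simp
      have "l \<le> u n / real n" unfolding l_def using n N by (intro cINF_lower[OF bdd]) auto
      moreover have "u n / real n \<le> a + C / real n" using up[of n] n0 by (simp add: field_simps)
      moreover have "C / real n \<le> C / real N" using n N C by (intro divide_left_mono) auto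
      ultimately show ?thesis using m(2) N(2) unfolding a_def real_norm_def abs_less_iff by linarith
    qed
    then show "\<exists>N. \<forall>n\<ge>N. norm (u n / real n - l) < e" by blast
  qed
  then show ?thesis by (auto simp: convergent_def)
qed

lemma sum_int_telescope:
  fixes f :: "int \<Rightarrow> 'a::ab_group_add"
  assumes "a \<le> b" shows "(\<Sum>i\<in>{a..<b}. f (i + 1) - f i) = f b - f a"
  using assms
proof (induction b rule: int_ge_induct)
  case (step b)
  then have "{a..<b + 1} = insert b {a..<b}" by auto
  then show ?case using step by simp
qed simp

section \<open>Second-order expansion of the information\<close>

context poisson_channel
begin

definition info :: "real measure \<Rightarrow> nat \<Rightarrow> real" where
  "info F n = (\<integral>x. score F n x \<partial>PiM UNIV (iid F))"

text \<open>The derivative at zero of the mean of the fixed score along the mixture, by the product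
  rule over the sites.\<close>

definition slope :: "real measure \<Rightarrow> real measure \<Rightarrow> nat \<Rightarrow> real" where
  "slope F G n = (\<Sum>j\<in>sites n. (\<integral>x. score F n x \<partial>PiM UNIV ((iid F)(j := G))) - info F n)"

text \<open>The relative entropy of the output block under \<open>H\<close> with respect to the
  output block under \<open>F\<close>.\<close>

definition kl :: "real measure \<Rightarrow> real measure \<Rightarrow> nat \<Rightarrow> real" where
  "kl H F n = (\<integral>x. \<integral>y. ln (dens (iid H) (outs n) y) - ln (dens (iid F) (outs n) y) \<partial>K x \<partial>PiM UNIV (iid H))"

lemma hybrid_ends:
  assumes \<Phi>: "tame \<Phi>" "depends_on (sites n) \<Phi>" and HF: "H \<in> input_laws A" "F \<in> input_laws A"
  shows "(\<integral>x. \<Phi> x \<partial>PiM UNIV (hybrid H F (int n + 1))) = (\<integral>x. \<Phi> x \<partial>PiM UNIV (iid H))"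
    and "(\<integral>x. \<Phi> x \<partial>PiM UNIV (hybrid H F (1 - int L))) = (\<integral>x. \<Phi> x \<partial>PiM UNIV (iid F))"
    and "G \<in> input_laws A \<Longrightarrow> (\<integral>x. \<Phi> x \<partial>PiM UNIV ((hybrid H F (1 - int L))(j := G))) = (\<integral>x. \<Phi> x \<partial>PiM UNIV ((iid F)(j := G)))"
  by (intro integral_PX_cong[OF \<Phi>] laws_hybrid laws_iid laws_upd HF; auto simp: hybrid_def sites_def)+

lemma input_average_close:
  fixes q :: "real \<Rightarrow> real"
  assumes G: "G \<in> input_laws A" and q: "q \<in> borel_measurable (input_space A)"
    and c: "\<And>s. 0 \<le> s \<Longrightarrow> s \<le> A \<Longrightarrow> \<bar>q s - q0\<bar> \<le> c"
  shows "integrable G q" "\<bar>(\<integral>s. q s \<partial>G) - q0\<bar> \<le> c"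
proof -
  interpret prob_space G by (rule input_lawsD[OF G])
  have m: "q \<in> borel_measurable G" using q input_lawsD[OF G] by (simp cong: measurable_cong_sets)
  have b: "AE s in G. \<bar>q s - q0\<bar> \<le> c" using c input_lawsD[OF G] by (intro AE_I2) auto
  have i: "integrable G (\<lambda>s. q s - q0)" by (rule integrable_const_bound[where B=c]) (use b m in auto)
  then have "integrable G (\<lambda>s. (q s - q0) + q0)" by (intro Bochner_Integration.integrable_add) auto
  then show i2: "integrable G q" by simp
  have "(\<integral>s. q s \<partial>G) - q0 = (\<integral>s. q s - q0 \<partial>G)" using i2 by (simp add: prob_space)
  also have "\<bar>\<dots>\<bar> \<le> (\<integral>s. \<bar>q s - q0\<bar> \<partial>G)" by (rule integral_abs_bound)
  also have "\<dots> \<le> c" using i b by (intro integral_le_const) auto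
  finally show "\<bar>(\<integral>s. q s \<partial>G) - q0\<bar> \<le> c" .
qed

text \<open>Telescoping produces \<open>w j\<close>, the effect of site \<open>j\<close> when the
  earlier sites already carry the mixture; the slope contains \<open>s j\<close>, where they still
  carry \<open>F\<close>. The difference is a sum of pair interactions with earlier sites, each
  carrying another \<open>\<epsilon>\<close> and decaying geometrically, so it is bounded uniformly
  in \<open>j\<close>.\<close>

lemma first_order:
  assumes F: "F \<in> input_laws A" and G: "G \<in> input_laws A" and e: "0 \<le> \<epsilon>" "\<epsilon> \<le> 1"
  shows "\<bar>(\<integral>x. score F n x \<partial>PiM UNIV (iid (mixture \<epsilon> F G))) - info F n - \<epsilon> * slope F G n\<bar>
    \<le> \<epsilon>\<^sup>2 * real (n + L) * (4 * pair_size / (1 - rho))"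
proof -
  let ?H = "mixture \<epsilon> F G" and ?a = "1 - int L" and ?\<Phi> = "score F n"
  let ?hy = "hybrid ?H F"
  note \<Phi> = tame_score[OF F, of n] and dep = depends_on_score[OF F, of n]
  note H = mixture_in_input_laws[OF F G e]
  \<comment> \<open>The exchange at \<open>j\<close> as a function of the other inputs: its mean can
    be followed from one environment to another by \<open>hybrid_drift\<close>.\<close>
  define \<Xi> where "\<Xi> j x = (\<integral>t. ?\<Phi> (x(j := t)) \<partial>G) - (\<integral>t. ?\<Phi> (x(j := t)) \<partial>F)" for j x
  have \<Xi>t: "tame (\<Xi> j)" for j
    unfolding \<Xi>_def by (intro tame_diff tame_integral_slice \<Phi> F G)
  have \<Xi>i: "(\<integral>x. \<Xi> j x \<partial>PiM UNIV \<sigma>) = (\<integral>x. ?\<Phi> x \<partial>PiM UNIV (\<sigma>(j := G))) - (\<integral>x. ?\<Phi> x \<partial>PiM UNIV (\<sigma>(j := F)))"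
    if "laws \<sigma>" for \<sigma> j
    using tame_integrable[OF tame_integral_slice[OF \<Phi> G] that] tame_integrable[OF tame_integral_slice[OF \<Phi> F] that]
    by (simp add: \<Xi>_def integral_upd[OF \<Phi> that F] integral_upd[OF \<Phi> that G])
  have sites: "sites n = {?a..<int n + 1}" by (auto simp: sites_def)
  define s where "s j = (\<integral>x. ?\<Phi> x \<partial>PiM UNIV ((iid F)(j := G))) - info F n" for j
  define w where "w j = (\<integral>x. ?\<Phi> x \<partial>PiM UNIV ((?hy j)(j := G))) - (\<integral>x. ?\<Phi> x \<partial>PiM UNIV (?hy j))" for j
  have close: "\<bar>w j - s j\<bar> \<le> \<epsilon> * (4 * pair_size / (1 - rho))" if j: "j \<in> sites n" for j
  proof -
    have w: "w j = (\<integral>x. \<Xi> j x \<partial>PiM UNIV (?hy j))"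
      unfolding w_def \<Xi>i[OF laws_hybrid[OF H F]] hybrid_step(2) ..
    have "(\<integral>x. \<Xi> j x \<partial>PiM UNIV (?hy ?a)) = (\<integral>x. ?\<Phi> x \<partial>PiM UNIV ((?hy ?a)(j := G))) - (\<integral>x. ?\<Phi> x \<partial>PiM UNIV ((?hy ?a)(j := F)))"
      by (rule \<Xi>i[OF laws_hybrid[OF H F]])
    also have "(iid F)(j := F) = iid F" by auto
    then have "(\<integral>x. ?\<Phi> x \<partial>PiM UNIV ((?hy ?a)(j := G))) - (\<integral>x. ?\<Phi> x \<partial>PiM UNIV ((?hy ?a)(j := F))) = s j"
      unfolding hybrid_ends(3)[OF \<Phi> dep H F G] hybrid_ends(3)[OF \<Phi> dep H F F] by (simp add: s_def info_def)
    finally have s: "s j = (\<integral>x. \<Xi> j x \<partial>PiM UNIV (?hy ?a))" ..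
    have "\<bar>w j - s j\<bar> \<le> \<epsilon> * (\<Sum>i\<in>{?a..<j}. 2 * (2 * pair_size * rho ^ nat (j - i)))"
      unfolding w s
    proof (rule hybrid_drift[OF \<Xi>t F G e])
      show "?a \<le> j" using j by (simp add: sites_def)
      fix i x t assume i: "i \<in> {?a..<j}" and x: "x \<in> inputs" and t: "0 \<le> t" "t \<le> A"
      \<comment> \<open>The effect of input \<open>i\<close> as a function of the value at
        \<open>j\<close>. Its variation is the mixed difference of \<open>score_pair\<close>, so its
        means under \<open>F\<close> and \<open>G\<close> are at most twice that apart.\<close>
      define q where "q v = ?\<Phi> (x(i := t, j := v)) - ?\<Phi> (x(i := 0, j := v))" for v
      note xt = inputs_upd[OF x t, of i] and x0 = inputs_upd[OF x order_refl A, of i]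
      have qm: "q \<in> borel_measurable (input_space A)"
        unfolding q_def using tame_slice_measurable[OF \<Phi> xt, of j] tame_slice_measurable[OF \<Phi> x0, of j] by measurable
      have qc: "\<bar>q v - q 0\<bar> \<le> pair_size * rho ^ nat (j - i)" if v: "0 \<le> v" "v \<le> A" for v
      proof -
        have tw: "x(i := b, j := c) = x(j := c, i := b)" for b c using i by (auto simp: fun_eq_iff)
        have ij: "i < j" using i by simp
        show ?thesis unfolding q_def tw using score_pair[OF F x v t ij, of n] by simp
      qed
      have int: "integrable M (\<lambda>v. ?\<Phi> (x(i := b, j := v)))" if M: "M \<in> input_laws A" and b: "0 \<le> b" "b \<le> A" for M b
        by (rule input_average_close(1)[OF M tame_slice_measurable[OF \<Phi> inputs_upd[OF x b]],
              where c=step_size, OF score_step[OF F inputs_upd[OF x b]]])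
      have "\<Xi> j (x(i := t)) - \<Xi> j (x(i := 0)) = (\<integral>v. q v \<partial>G) - (\<integral>v. q v \<partial>F)"
        using int[OF F t] int[OF G t] int[OF F order_refl A] int[OF G order_refl A] by (simp add: \<Xi>_def q_def)
      then show "\<bar>\<Xi> j (x(i := t)) - \<Xi> j (x(i := 0))\<bar> \<le> 2 * pair_size * rho ^ nat (j - i)"
        using input_average_close(2)[OF F qm qc] input_average_close(2)[OF G qm qc] by linarith
    qed
    also have "(\<Sum>i\<in>{?a..<j}. 2 * (2 * pair_size * rho ^ nat (j - i))) = 4 * pair_size * (\<Sum>i\<in>{?a..<j}. rho ^ nat (j - i))"
      by (simp add: sum_distrib_left algebra_simps)
    also have "\<dots> \<le> 4 * pair_size * (1 / (1 - rho))"
      using pair_size_nonneg by (intro mult_left_mono sum_rho_le') auto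
    finally show ?thesis using e by (simp add: mult_left_mono)
  qed
  have "(\<integral>x. ?\<Phi> x \<partial>PiM UNIV (iid ?H)) - info F n = \<epsilon> * (\<Sum>j\<in>sites n. w j)"
    using hybrid_telescope[OF \<Phi> F G e, of ?a "int n + 1"]
    unfolding hybrid_ends(1)[OF \<Phi> dep H F] hybrid_ends(2)[OF \<Phi> dep H F] sites w_def info_def by simp
  then have "(\<integral>x. ?\<Phi> x \<partial>PiM UNIV (iid ?H)) - info F n - \<epsilon> * slope F G n = \<epsilon> * (\<Sum>j\<in>sites n. w j - s j)"
    by (simp add: slope_def s_def[symmetric] sum_subtractf right_diff_distrib)
  also have "\<bar>\<dots>\<bar> \<le> \<epsilon> * (\<Sum>j\<in>sites n. \<epsilon> * (4 * pair_size / (1 - rho)))"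
    unfolding abs_mult using e close by (intro mult_mono order_trans[OF sum_abs] sum_mono) auto
  also have "\<dots> = \<epsilon>\<^sup>2 * real (n + L) * (4 * pair_size / (1 - rho))"
    by (simp add: power2_eq_square)
  finally show ?thesis .
qed

lemma growth_diff:
  assumes "growth S c r \<phi>" "growth S d r \<psi>"
  shows "growth S (c + d) r (\<lambda>y. \<phi> y - \<psi> y)"
  unfolding growth_def
proof (intro conjI allI)
  show "(\<lambda>y. \<phi> y - \<psi> y) \<in> borel_measurable SY"
    using assms unfolding growth_def by (intro borel_measurable_diff) auto
  fix y
  have "\<bar>\<phi> y\<bar> \<le> c * r ^ (\<Sum>k\<in>S. y k)" "\<bar>\<psi> y\<bar> \<le> d * r ^ (\<Sum>k\<in>S. y k)"
    using assms by (auto simp: growth_def)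
  then show "\<bar>\<phi> y - \<psi> y\<bar> \<le> (c + d) * r ^ (\<Sum>k\<in>S. y k)"
    unfolding distrib_right by linarith
qed

text \<open>The scores of \<open>F\<close> and \<open>H\<close> share their \<open>eta\<close>
  terms; the difference of their log densities has mean \<open>kl H F n\<close> under
  \<open>H\<close>.\<close>

lemma score_average:
  assumes F: "F \<in> input_laws A" and H: "H \<in> input_laws A"
  shows "(\<integral>x. score F n x \<partial>PiM UNIV (iid H)) = info H n + kl H F n"
proof -
  have gi: "integrable (K x) (\<lambda>y. ln (dens (iid M) (outs n) y))" if "x \<in> inputs" "M \<in> input_laws A" for x M
    using growth_integral(1)[OF that(1) _ _ _ growth_ln_dens[OF laws_iid[OF that(2)]]] by (simp add: ln_size_nonneg)
  have eq: "(\<integral>y. ln (dens (iid H) (outs n) y) - ln (dens (iid F) (outs n) y) \<partial>K x) = score F n x - score H n x"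
    if "x \<in> inputs" for x using gi[OF that F] gi[OF that H] by (simp add: score_def)
  have "kl H F n = (\<integral>x. score F n x - score H n x \<partial>PiM UNIV (iid H))"
    unfolding kl_def using space_PX[OF laws_iid[OF H]] eq by (intro Bochner_Integration.integral_cong) auto
  then show ?thesis
    using tame_integrable[OF tame_score[OF F] laws_iid[OF H]] tame_integrable[OF tame_score[OF H] laws_iid[OF H]]
    by (simp add: info_def)
qed

lemma kl_nonneg:
  assumes F: "F \<in> input_laws A" and H: "H \<in> input_laws A"
  shows "kl H F n \<ge> 0"
proof -
  let ?p = "dens (iid H) (outs n)" and ?q = "dens (iid F) (outs n)"
  note l = laws_iid[OF F] laws_iid[OF H]
  have g: "growth (outs n) (ln_size (outs n) + ln_size (outs n)) 2 (\<lambda>y. ln (?p y) - ln (?q y))"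
    by (intro growth_diff growth_ln_dens l)
  have d: "depends_on (outs n) (\<lambda>y. ln (?p y) - ln (?q y))"
    by (rule depends_onI, intro arg_cong2[where f=minus] arg_cong[where f=ln])
      (erule depends_onD[OF depends_on_dens])+
  have *: "integrable nu (\<lambda>y. (ln (?p y) - ln (?q y)) * ?p y)" "kl H F n = (\<integral>y. (ln (?p y) - ln (?q y)) * ?p y \<partial>nu)"
    unfolding kl_def using ln_size_nonneg by (intro integral_dens[OF l(2) _ _ _ _ g d]; simp)+
  have "0 \<le> (\<integral>y. ?p y * (ln (?p y) - ln (?q y)) \<partial>nu)"
    by (rule gibbs) (use * integral_dens_1[OF l(1)] integral_dens_1[OF l(2)] dens_pos[OF l(1)] dens_pos[OF l(2)]
        in \<open>auto simp: mult.commute\<close>)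
  then show ?thesis using * by (simp add: mult.commute)
qed

definition ratio_decay :: real where "ratio_decay = decay ratio_bound (peak / dark)"

text \<open>By \<open>ln u <= u - 1\<close>, exchanging site \<open>j\<close> raises the log density
  by at most \<open>\<epsilon> * (R j y - 1)\<close>. Under the hybrid of step \<open>j\<close> the
  ratio \<open>R j\<close> has mean exactly 1, because multiplying it by its denominator leaves a
  probability density. Exchanging the sites from \<open>j\<close> on moves this mean by only
  \<open>\<epsilon>\<close> times a geometric sum, and the two factors \<open>\<epsilon>\<close>
  multiply.\<close>

lemma kl_upper:
  assumes F: "F \<in> input_laws A" and G: "G \<in> input_laws A" and e: "0 \<le> \<epsilon>" "\<epsilon> \<le> 1"
  shows "kl (mixture \<epsilon> F G) F n \<le> \<epsilon>\<^sup>2 * real (n + L) * (4 * ratio_decay / (1 - rho))"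
proof -
  let ?H = "mixture \<epsilon> F G" and ?a = "1 - int L" and ?T = "outs n"
  let ?hy = "hybrid ?H F"
  note H = mixture_in_input_laws[OF F G e]
  note lh = laws_hybrid[OF H F]
  have q1: "peak / dark \<ge> 1" using dark dark_le_peak by simp
  have sites: "sites n = {?a..<int n + 1}" by (auto simp: sites_def)
  define R where "R j y = dens ((?hy j)(j := G)) ?T y / dens (?hy j) ?T y" for j y
  have Rg: "growth (win j) ratio_bound (peak / dark) (R j)" for j
    unfolding R_def by (rule growth_dens_ratio[OF lh G]) simp
  have Rs: "settled j (R j)" for j unfolding R_def by (rule settled_dens_ratio[OF lh G]) simp
  have Rd: "depends_on ?T (R j)" for j
    unfolding R_def by (rule depends_onI, intro arg_cong2[where f=divide]) (erule depends_onD[OF depends_on_dens])+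
  define \<Phi> where "\<Phi> j x = (\<integral>y. R j y \<partial>K x)" for j x
  have \<Phi>t: "tame (\<Phi> j)" for j
    unfolding \<Phi>_def using q1 ratio_bound_nonneg by (intro tame_output_average[OF Rg]) auto
  have \<Phi>d: "depends_on (sites n) (\<Phi> j)" for j
    unfolding \<Phi>_def by (rule depends_on_output_average[OF _ Rd outs_sites]) (use Rg in \<open>simp add: growth_def\<close>)
  have ln_step: "ln (dens (iid ?H) ?T y) - ln (dens (iid F) ?T y) \<le> (\<Sum>j\<in>sites n. \<epsilon> * (R j y - 1))" for y
  proof -
    have dl: "depends_on (sites n) (\<lambda>x. lik ?T x y)"
    proof (rule depends_onI)
      fix x x' :: "int \<Rightarrow> real" assume "\<And>i. i \<in> sites n \<Longrightarrow> x i = x' i"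
      then show "lik ?T x y = lik ?T x' y" by (intro lik_cong) (auto simp: sites_def outs_def)
    qed
    have ends: "dens (?hy (int n + 1)) ?T y = dens (iid ?H) ?T y" "dens (?hy ?a) ?T y = dens (iid F) ?T y"
      unfolding dens_def by (rule hybrid_ends[OF tame_lik dl H F])+
    have "ln (dens (?hy (j + 1)) ?T y) - ln (dens (?hy j) ?T y) \<le> \<epsilon> * (R j y - 1)" for j
    proof -
      have p: "dens (?hy j) ?T y > 0" "dens (?hy (j + 1)) ?T y > 0" by (rule dens_pos[OF lh])+
      have "dens (?hy (j + 1)) ?T y = (1 - \<epsilon>) * dens (?hy j) ?T y + \<epsilon> * dens ((?hy j)(j := G)) ?T y"
        unfolding dens_def hybrid_step(1) integral_upd_mixture[OF tame_lik lh F G e] hybrid_step(2) ..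
      then have "dens (?hy (j + 1)) ?T y / dens (?hy j) ?T y - 1 = \<epsilon> * (R j y - 1)"
        using p by (simp add: R_def field_simps)
      then show ?thesis
        using ln_le_minus_one[of "dens (?hy (j + 1)) ?T y / dens (?hy j) ?T y"] p by (simp add: ln_div)
    qed
    then have "(\<Sum>j\<in>{?a..<int n + 1}. ln (dens (?hy (j + 1)) ?T y) - ln (dens (?hy j) ?T y)) \<le> (\<Sum>j\<in>{?a..<int n + 1}. \<epsilon> * (R j y - 1))"
      by (intro sum_mono)
    then show ?thesis
      using sum_int_telescope[of ?a "int n + 1" "\<lambda>j. ln (dens (?hy j) ?T y)"] by (simp add: ends sites)
  qed
  have avg: "(\<integral>x. \<Phi> j x \<partial>PiM UNIV (iid ?H)) - 1 \<le> \<epsilon> * (4 * ratio_decay / (1 - rho))" if j: "j \<in> sites n" for j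
  proof -
    have "(\<integral>x. \<Phi> j x \<partial>PiM UNIV (?hy j)) = (\<integral>y. R j y * dens (?hy j) ?T y \<partial>nu)"
      unfolding \<Phi>_def using q1 ratio_bound_nonneg by (intro integral_dens(2)[OF lh _ _ _ _ Rg Rd]) auto
    also have "\<dots> = (\<integral>y. dens ((?hy j)(j := G)) ?T y \<partial>nu)"
    proof (rule Bochner_Integration.integral_cong[OF refl])
      show "R j y * dens (?hy j) ?T y = dens ((?hy j)(j := G)) ?T y" for y
        using dens_pos[OF lh, of j ?T y] by (simp add: R_def del: fun_upd_apply)
    qed
    also have "\<dots> = 1" by (rule integral_dens_1[OF laws_upd[OF lh G]]) simp
    finally have one: "(\<integral>x. \<Phi> j x \<partial>PiM UNIV (?hy j)) = 1" .
    have "\<bar>(\<integral>x. \<Phi> j x \<partial>PiM UNIV (?hy (int n + 1))) - (\<integral>x. \<Phi> j x \<partial>PiM UNIV (?hy j))\<bar>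
        \<le> \<epsilon> * (\<Sum>i\<in>{j..<int n + 1}. 2 * (2 * ratio_decay * rho ^ nat (i - j)))"
    proof (rule hybrid_drift[OF \<Phi>t F G e])
      show "j \<le> int n + 1" using j by (simp add: sites_def)
      fix i x t assume x: "x \<in> inputs" and t: "0 \<le> t" "t \<le> A"
      have "\<bar>\<Phi> j x - \<Phi> j (x(i := s))\<bar> \<le> ratio_decay * rho ^ nat (i - j)" if "0 \<le> s" "s \<le> A" for s
        unfolding \<Phi>_def ratio_decay_def by (rule influence_decay[OF x that q1 ratio_bound_nonneg Rg Rs])
      from this[OF t] this[OF order_refl A]
      show "\<bar>\<Phi> j (x(i := t)) - \<Phi> j (x(i := 0))\<bar> \<le> 2 * ratio_decay * rho ^ nat (i - j)" by linarith
    qed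
    also have "(\<Sum>i\<in>{j..<int n + 1}. 2 * (2 * ratio_decay * rho ^ nat (i - j))) = 4 * ratio_decay * (\<Sum>i\<in>{j..<int n + 1}. rho ^ nat (i - j))"
      by (simp add: sum_distrib_left algebra_simps)
    also have "\<dots> \<le> 4 * ratio_decay * (1 / (1 - rho))"
      using decay_nonneg[OF ratio_bound_nonneg] by (intro mult_left_mono sum_rho_le) (auto simp: ratio_decay_def)
    finally show ?thesis
      unfolding one hybrid_ends(1)[OF \<Phi>t \<Phi>d H F] using e by (simp add: mult_left_mono)
  qed
  have Ri: "integrable (K x) (R j)" if "x \<in> inputs" for x j
    using q1 ratio_bound_nonneg by (intro growth_integral(1)[OF that _ _ _ Rg]) auto
  have inner: "(\<integral>y. ln (dens (iid ?H) ?T y) - ln (dens (iid F) ?T y) \<partial>K x) \<le> (\<Sum>j\<in>sites n. \<epsilon> * (\<Phi> j x - 1))"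
    if x: "x \<in> inputs" for x
  proof -
    interpret Kx: prob_space "K x" by (rule prob_K)
    have "(\<integral>y. ln (dens (iid ?H) ?T y) - ln (dens (iid F) ?T y) \<partial>K x) \<le> (\<integral>y. (\<Sum>j\<in>sites n. \<epsilon> * (R j y - 1)) \<partial>K x)"
    proof (rule integral_mono)
      have "growth ?T (ln_size ?T + ln_size ?T) 2 (\<lambda>y. ln (dens (iid ?H) ?T y) - ln (dens (iid F) ?T y))"
        by (intro growth_diff growth_ln_dens laws_iid H F)
      then show "integrable (K x) (\<lambda>y. ln (dens (iid ?H) ?T y) - ln (dens (iid F) ?T y))"
        using ln_size_nonneg by (intro growth_integral(1)[OF x]) auto
      show "integrable (K x) (\<lambda>y. \<Sum>j\<in>sites n. \<epsilon> * (R j y - 1))"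
        using Ri[OF x] by (intro Bochner_Integration.integrable_sum integrable_mult_right Bochner_Integration.integrable_diff) auto
    qed (rule ln_step)
    also have "\<dots> = (\<Sum>j\<in>sites n. \<epsilon> * (\<Phi> j x - 1))"
      using Ri[OF x] Kx.prob_space by (simp add: \<Phi>_def)
    finally show ?thesis .
  qed
  interpret X: prob_space "PiM UNIV (iid ?H)" by (rule prob_PX[OF laws_iid[OF H]])
  note \<Phi>i = tame_integrable[OF \<Phi>t laws_iid[OF H]]
  have "kl ?H F n \<le> (\<integral>x. (\<Sum>j\<in>sites n. \<epsilon> * (\<Phi> j x - 1)) \<partial>PiM UNIV (iid ?H))"
    unfolding kl_def
  proof (rule integral_mono)
    have "growth ?T (ln_size ?T + ln_size ?T) 2 (\<lambda>y. ln (dens (iid ?H) ?T y) - ln (dens (iid F) ?T y))"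
      by (intro growth_diff growth_ln_dens laws_iid H F)
    then show "integrable (PiM UNIV (iid ?H)) (\<lambda>x. \<integral>y. ln (dens (iid ?H) ?T y) - ln (dens (iid F) ?T y) \<partial>K x)"
      using ln_size_nonneg by (intro tame_integrable[OF _ laws_iid[OF H]] tame_output_average) auto
    show "integrable (PiM UNIV (iid ?H)) (\<lambda>x. \<Sum>j\<in>sites n. \<epsilon> * (\<Phi> j x - 1))"
      using \<Phi>i by (intro Bochner_Integration.integrable_sum integrable_mult_right Bochner_Integration.integrable_diff) auto
  qed (use inner space_PX[OF laws_iid[OF H]] in auto)
  also have "\<dots> = (\<Sum>j\<in>sites n. \<epsilon> * ((\<integral>x. \<Phi> j x \<partial>PiM UNIV (iid ?H)) - 1))"
    using \<Phi>i X.prob_space by simp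
  also have "\<dots> \<le> (\<Sum>j\<in>sites n. \<epsilon> * (\<epsilon> * (4 * ratio_decay / (1 - rho))))"
    using e avg by (intro sum_mono mult_left_mono) auto
  also have "\<dots> = \<epsilon>\<^sup>2 * real (n + L) * (4 * ratio_decay / (1 - rho))"
    by (simp add: power2_eq_square)
  finally show ?thesis .
qed

definition curvature :: real where
  "curvature = (4 * pair_size + 4 * ratio_decay) / (1 - rho)"

text \<open>By \<open>score_average\<close>, the information is the mean of the fixed score minus a
  relative entropy; the first is expanded by \<open>first_order\<close>, the second lies between
  zero and its quadratic bound.\<close>

lemma info_expansion:
  assumes F: "F \<in> input_laws A" and G: "G \<in> input_laws A" and e: "0 \<le> \<epsilon>" "\<epsilon> \<le> 1"
  shows "\<bar>info (mixture \<epsilon> F G) n - info F n - \<epsilon> * slope F G n\<bar> \<le> \<epsilon>\<^sup>2 * real (n + L) * curvature"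
proof -
  note H = mixture_in_input_laws[OF F G e]
  have "\<epsilon>\<^sup>2 * real (n + L) * curvature
      = \<epsilon>\<^sup>2 * real (n + L) * (4 * pair_size / (1 - rho)) + \<epsilon>\<^sup>2 * real (n + L) * (4 * ratio_decay / (1 - rho))"
    by (simp add: curvature_def add_divide_distrib distrib_left)
  then show ?thesis
    using first_order[OF assms, of n] kl_upper[OF assms, of n] kl_nonneg[OF F H, of n]
    unfolding score_average[OF F H] by linarith
qed

end

lemma depends_on_comp: "depends_on I u \<Longrightarrow> depends_on I (\<lambda>y. f (u y))"
  unfolding depends_on_def by metis

lemma depends_on_comp2: "depends_on I u \<Longrightarrow> depends_on I v \<Longrightarrow> depends_on I (\<lambda>y. f (u y) (v y))"
  unfolding depends_on_def by metis

context poisson_channel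
begin

subsection \<open>Stationarity and existence of the rate\<close>

definition shift :: "int \<Rightarrow> (int \<Rightarrow> 'a) \<Rightarrow> int \<Rightarrow> 'a" where
  "shift m x = (\<lambda>k. x (k + m))"

lemma Z_shift: "Z (shift m x) k = Z x (k + m)"
  unfolding intensity_def shift_def
  by (intro arg_cong2[where f="(+)"] sum.cong refl arg_cong2[where f="(*)"] arg_cong[where f=x]) simp

lemma distr_shift:
  fixes M :: "int \<Rightarrow> 'a measure"
  assumes "\<And>k. prob_space (M k)"
  shows "distr (PiM UNIV M) (PiM UNIV (\<lambda>k. M (k + m))) (shift m) = PiM UNIV (\<lambda>k. M (k + m))"
proof -
  have "shift m = (\<lambda>\<omega> :: int \<Rightarrow> 'a. \<lambda>n\<in>UNIV. \<omega> (n + m))" by (auto simp: shift_def fun_eq_iff)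
  then show ?thesis using distr_PiM_reindex[of UNIV M "\<lambda>k. k + m" UNIV] assms by simp
qed

lemma measurable_shift: "shift m \<in> PiM UNIV M \<rightarrow>\<^sub>M PiM UNIV (\<lambda>k. M (k + m))"
  by (rule measurable_PiM_single') (auto simp: shift_def space_PiM)

lemma integral_PX_shift:
  assumes F: "F \<in> input_laws A" and \<Phi>: "tame \<Phi>"
  shows "(\<integral>x. \<Phi> (shift m x) \<partial>PiM UNIV (iid F)) = (\<integral>x. \<Phi> x \<partial>PiM UNIV (iid F))"
  using integral_distr[OF measurable_shift[of m "iid F"] tame_measurable[OF \<Phi> laws_iid[OF F]]]
    distr_shift[of "iid F" m] input_lawsD[OF F] by simp

lemma integral_K_shift:
  fixes \<phi> :: "_ \<Rightarrow> real"
  assumes \<phi>: "\<phi> \<in> borel_measurable SY"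
  shows "(\<integral>y. \<phi> (shift m y) \<partial>K x) = (\<integral>y. \<phi> y \<partial>K (shift m x))"
proof -
  let ?M = "\<lambda>k. measure_pmf (poisson_pmf (Z x k))"
  have K': "K (shift m x) = PiM UNIV (\<lambda>k. ?M (k + m))" by (simp add: output_kernel_def Z_shift)
  have \<phi>': "\<phi> \<in> borel_measurable (PiM UNIV (\<lambda>k. ?M (k + m)))"
    using \<phi> unfolding K'[symmetric] measurable_cong_sets[OF sets_K refl] .
  show ?thesis
    using integral_distr[OF measurable_shift[of m ?M] \<phi>']
    unfolding K' distr_shift[of ?M m, OF prob_space_measure_pmf] by (simp add: output_kernel_def)
qed

lemma lik_shift: "lik ((\<lambda>k. k + m) ` T) x y = lik T (shift m x) (shift m y)"
  unfolding lik_def Z_shift by (subst prod.reindex) (auto simp: shift_def inj_on_def)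

lemma dens_shift:
  assumes "F \<in> input_laws A"
  shows "dens (iid F) ((\<lambda>k. k + m) ` T) y = dens (iid F) T (shift m y)"
  unfolding dens_def lik_shift by (rule integral_PX_shift[OF assms tame_lik])

text \<open>The relative entropy with respect to \<open>nu\<close> of the outputs in
  \<open>T\<close>: the mean of their log density under their own law.\<close>

definition log_loss :: "real measure \<Rightarrow> int set \<Rightarrow> real" where
  "log_loss F T = (\<integral>x. \<integral>y. ln (dens (iid F) T y) \<partial>K x \<partial>PiM UNIV (iid F))"

lemma tame_log_loss:
  assumes "F \<in> input_laws A" "finite T"
  shows "tame (\<lambda>x. \<integral>y. ln (dens (iid F) T y) \<partial>K x)"
  using ln_size_nonneg assms by (intro tame_output_average[OF growth_ln_dens[OF laws_iid]]) auto

lemma log_loss_shift: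
  assumes F: "F \<in> input_laws A" and "finite T"
  shows "log_loss F ((\<lambda>k. k + m) ` T) = log_loss F T"
proof -
  have "(\<lambda>y. ln (dens (iid F) T y)) \<in> borel_measurable SY"
    using growth_ln_dens[OF laws_iid[OF F]] by (simp add: growth_def)
  then show ?thesis
    unfolding log_loss_def dens_shift[OF F]
    by (subst integral_K_shift, assumption) (rule integral_PX_shift[OF F tame_log_loss[OF assms]])
qed

lemma growth_add:
  assumes "growth S c r \<phi>" "growth S d r \<psi>"
  shows "growth S (c + d) r (\<lambda>y. \<phi> y + \<psi> y)"
proof -
  have "growth S d r (\<lambda>y. - \<psi> y)" using assms(2) by (simp add: growth_def)
  from growth_diff[OF assms(1) this] show ?thesis by simp
qed

text \<open>The gap is the mutual information of the two groups of outputs, a relative entropy of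
  the joint density to the product of the marginal ones. That product has mass 1 because disjoint
  coordinates are independent under \<open>nu\<close>.\<close>

lemma log_loss_superadditive:
  assumes F: "F \<in> input_laws A" and T: "finite T" "finite T'" "T \<inter> T' = {}"
  shows "log_loss F T + log_loss F T' \<le> log_loss F (T \<union> T')"
proof -
  note l = laws_iid[OF F]
  let ?p = "dens (iid F) (T \<union> T')" and ?q = "dens (iid F) T" and ?q' = "dens (iid F) T'"
  let ?S = "T \<union> T'" and ?c = "\<lambda>T. ln_size T"
  let ?f = "\<lambda>T y. ln (dens (iid F) T y)"
  have fS: "finite ?S" using T by simp
  have g: "growth ?S (?c V) 2 (?f V)" if "V \<subseteq> ?S" for V
    using growth_mono[OF growth_ln_dens[OF l, of V] that fS] ln_size_nonneg by auto
  have g2: "growth ?S (?c T + ?c T') 2 (\<lambda>y. ?f T y + ?f T' y)" by (intro growth_add g) auto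
  have g3: "growth ?S (?c ?S + (?c T + ?c T')) 2 (\<lambda>y. ?f ?S y - (?f T y + ?f T' y))" by (intro growth_diff g g2) auto
  have dd: "depends_on ?S (?f V)" if "V \<subseteq> ?S" for V
    by (rule depends_on_comp[where f=ln, OF depends_on_mono[OF depends_on_dens that]])
  have d: "depends_on ?S (\<lambda>y. ?f ?S y - (?f T y + ?f T' y))"
    by (rule depends_on_comp2[where f=minus, OF dd[OF order_refl]
          depends_on_comp2[where f=plus, OF dd[OF Un_upper1] dd[OF Un_upper2]]])
  have eq: "ln (?p y) - ln (?q y * ?q' y) = ?f ?S y - (?f T y + ?f T' y)" for y
    using dens_pos[OF l, of T y] dens_pos[OF l, of T' y] by (simp add: ln_mult)
  have nn: "0 \<le> ?c T" "0 \<le> ?c T'" "0 \<le> ?c ?S" by (rule ln_size_nonneg)+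
  note i = integral_dens[OF l fS fS _ _ g3 d]
  have q: "(\<integral>\<^sup>+y. ennreal (dens (iid F) V y) \<partial>nu) = 1" if "finite V" for V
    using nn_integral_eq_integral[OF integral_dens_1(1)[OF l that]] integral_dens_1(2)[OF l that] dens_pos[OF l]
    by (simp add: less_imp_le)
  have meas: "dens (iid F) V \<in> borel_measurable SY" for V using l by measurable
  have qq: "(\<integral>\<^sup>+y. ennreal (?q y * ?q' y) \<partial>nu) = 1"
  proof -
    have "(\<integral>\<^sup>+y. ennreal (?q y * ?q' y) \<partial>nu) = (\<integral>\<^sup>+y. ennreal (?q y) * ennreal (?q' y) \<partial>nu)"
      using dens_pos[OF l] by (simp add: ennreal_mult less_imp_le)
    also have "\<dots> = (\<integral>\<^sup>+y. ennreal (?q y) \<partial>nu) * (\<integral>\<^sup>+y. ennreal (?q' y) \<partial>nu)"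
    proof -
      have "sets (\<Pi>\<^sub>M k\<in>UNIV. measure_pmf (poisson_pmf 1)) = sets SY" using sets_nu by (simp add: nu_def)
      then have m: "(\<lambda>y. ennreal (dens (iid F) V y)) \<in> borel_measurable (\<Pi>\<^sub>M k\<in>UNIV. measure_pmf (poisson_pmf 1))" for V
        using meas[of V] by (simp cong: measurable_cong_sets)
      have de: "depends_on V (\<lambda>y. ennreal (dens (iid F) V y))" for V
        by (rule depends_on_comp[where f=ennreal, OF depends_on_dens])
      show ?thesis unfolding nu_def
        by (rule nn_integral_PiM_mult[OF prob_space_measure_pmf m de m de T(3)])
    qed
    finally show ?thesis using q T by simp
  qed
  have qi: "integrable nu (\<lambda>y. ?q y * ?q' y)"
    by (rule integrableI_nonneg) (use meas qq dens_pos[OF l] in \<open>auto simp: less_imp_le\<close>)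
  have q1: "(\<integral>y. ?q y * ?q' y \<partial>nu) = 1"
    using integral_eq_nn_integral[of "\<lambda>y. ?q y * ?q' y" nu] qq dens_pos[OF l] meas by (simp add: less_imp_le)
  have "0 \<le> (\<integral>y. ?p y * (ln (?p y) - ln (?q y * ?q' y)) \<partial>nu)"
  proof (rule gibbs)
    show "integrable nu (\<lambda>y. ?p y * (ln (?p y) - ln (?q y * ?q' y)))"
      unfolding eq using i(1) nn by (simp add: mult.commute del: Un_iff)
  qed (use integral_dens_1[OF l fS] qi q1 dens_pos[OF l] in auto)
  also have "\<dots> = (\<integral>x. \<integral>y. ?f ?S y - (?f T y + ?f T' y) \<partial>K x \<partial>PiM UNIV (iid F))"
    unfolding eq using i(2) nn by (simp add: mult.commute)
  also have "\<dots> = (\<integral>x. (\<integral>y. ?f ?S y \<partial>K x) - ((\<integral>y. ?f T y \<partial>K x) + (\<integral>y. ?f T' y \<partial>K x)) \<partial>PiM UNIV (iid F))"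
  proof (rule Bochner_Integration.integral_cong[OF refl])
    fix x assume "x \<in> space (PiM UNIV (iid F))"
    then have x: "x \<in> inputs" using space_PX[OF l] by simp
    have "integrable (K x) (?f V)" if "V \<subseteq> ?S" for V
      by (rule growth_integral(1)[OF x fS _ ln_size_nonneg g[OF that]]) simp
    then show "(\<integral>y. ?f ?S y - (?f T y + ?f T' y) \<partial>K x) = (\<integral>y. ?f ?S y \<partial>K x) - ((\<integral>y. ?f T y \<partial>K x) + (\<integral>y. ?f T' y \<partial>K x))"
      by simp
  qed
  also have "\<dots> = log_loss F ?S - (log_loss F T + log_loss F T')"
    unfolding log_loss_def using tame_integrable[OF tame_log_loss[OF F fS] l]
      tame_integrable[OF tame_log_loss[OF F T(1)] l] tame_integrable[OF tame_log_loss[OF F T(2)] l] by simp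
  finally show ?thesis by simp
qed

lemma growth_output: "growth {k} 1 2 (\<lambda>y. real (y k))"
  using real_le_two_power by (auto simp: growth_def intro!: measurable_compose[OF measurable_component_singleton])

text \<open>Integrating the linear bound itself, not its exponential majorant, keeps the estimate
  proportional to \<open>card T\<close>, as Fekete's lemma requires.\<close>

lemma ln_dens_average_bound:
  assumes F: "F \<in> input_laws A" and T: "finite T" and x: "x \<in> inputs"
  shows "\<bar>\<integral>y. ln (dens (iid F) T y) \<partial>K x\<bar> \<le> real (card T) * (1 + peak + log_size * mgf 2)"
proof -
  note l = laws_iid[OF F]
  interpret prob_space "K x" by (rule prob_K)
  have yi: "integrable (K x) (\<lambda>y. real (y k))" for k
    by (rule growth_integral(1)[OF x _ _ _ growth_output]) auto
  have yb: "(\<integral>y. real (y k) \<partial>K x) \<le> mgf 2" for k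
    using growth_integral(2)[OF x _ _ _ growth_output[of k]] by simp
  have fi: "integrable (K x) (\<lambda>y. ln (dens (iid F) T y))"
    by (rule growth_integral(1)[OF x T _ _ growth_ln_dens[OF l]]) (auto simp: ln_size_nonneg)
  have "\<bar>\<integral>y. ln (dens (iid F) T y) \<partial>K x\<bar> \<le> (\<integral>y. \<bar>ln (dens (iid F) T y)\<bar> \<partial>K x)" by (rule integral_abs_bound)
  also have "\<dots> \<le> (\<integral>y. real (card T) * (1 + peak) + log_size * (\<Sum>k\<in>T. real (y k)) \<partial>K x)"
  proof (rule integral_mono)
    show "integrable (K x) (\<lambda>y. real (card T) * (1 + peak) + log_size * (\<Sum>k\<in>T. real (y k)))"
      using yi by (intro Bochner_Integration.integrable_add integrable_mult_right Bochner_Integration.integrable_sum) auto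
    show "\<bar>ln (dens (iid F) T y)\<bar> \<le> real (card T) * (1 + peak) + log_size * (\<Sum>k\<in>T. real (y k))" for y
      using ln_mono[OF dens_bounds(1)[OF l] exp_gt_zero, of T y]
        ln_mono[OF dens_bounds(2)[OF l] dens_pos[OF l], of T y] by simp
  qed (use fi in simp)
  also have "\<dots> = real (card T) * (1 + peak) + log_size * (\<Sum>k\<in>T. \<integral>y. real (y k) \<partial>K x)"
    using yi prob_space by (simp add: integrable_sum)
  also have "\<dots> \<le> real (card T) * (1 + peak) + log_size * (\<Sum>k\<in>T. mgf 2)"
    using yb log_size_nonneg by (intro add_left_mono mult_left_mono sum_mono) auto
  finally show ?thesis by (simp add: algebra_simps)
qed

lemma info_eq:
  assumes F: "F \<in> input_laws A"
  shows "info F n = real n * (\<integral>x. eta (Z x 0) \<partial>PiM UNIV (iid F)) - log_loss F (outs n)"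
proof -
  note l = laws_iid[OF F]
  have te: "tame (\<lambda>x. eta (Z x k))" for k using tame_sum_eta[of "{k}"] by simp
  have "info F n = (\<integral>x. (\<Sum>k\<in>outs n. eta (Z x k)) \<partial>PiM UNIV (iid F)) - log_loss F (outs n)"
    unfolding info_def score_def log_loss_def
    using tame_integrable[OF tame_sum_eta[of "outs n"] l] tame_integrable[OF tame_log_loss[OF F finite_outs[of n]] l] by simp
  also have "(\<integral>x. (\<Sum>k\<in>outs n. eta (Z x k)) \<partial>PiM UNIV (iid F)) = (\<Sum>k\<in>outs n. \<integral>x. eta (Z x k) \<partial>PiM UNIV (iid F))"
    using tame_integrable[OF te l] by simp
  also have "\<dots> = (\<Sum>k\<in>outs n. \<integral>x. eta (Z x 0) \<partial>PiM UNIV (iid F))"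
    using integral_PX_shift[OF F te[of 0]] by (intro sum.cong refl) (simp add: Z_shift)
  finally show ?thesis by simp
qed

definition rate :: "real measure \<Rightarrow> real" where "rate F = lim (\<lambda>n. info F n / real n)"

lemma info_rate_limit:
  assumes F: "F \<in> input_laws A"
  shows "(\<lambda>n. info F n / real n) \<longlonglongrightarrow> rate F"
proof -
  define u where "u n = - log_loss F (outs n)" for n
  let ?B = "1 + peak + log_size * mgf 2"
  note l = laws_iid[OF F]
  have "convergent (\<lambda>n. u n / real n)"
  proof (rule subadditive_convergent)
    fix m n
    have "outs (m + n) = outs m \<union> (\<lambda>k. k + int m) ` outs n"
    proof -
      have "k \<in> (\<lambda>k. k + int m) ` outs n" if "k \<in> {int m + 1..int (m + n)}" for k
        using that by (intro image_eqI[of _ _ "k - int m"]) (auto simp: outs_def)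
      then show ?thesis by (auto simp: outs_def)
    qed
    moreover have "outs m \<inter> (\<lambda>k. k + int m) ` outs n = {}" by (auto simp: outs_def)
    ultimately have "log_loss F (outs m) + log_loss F ((\<lambda>k. k + int m) ` outs n) \<le> log_loss F (outs (m + n))"
      using log_loss_superadditive[OF F, of "outs m" "(\<lambda>k. k + int m) ` outs n"] by simp
    then show "u (m + n) \<le> u m + u n" by (simp add: u_def log_loss_shift[OF F])
  next
    fix n
    have "\<bar>log_loss F (outs n)\<bar> \<le> real n * ?B"
      unfolding log_loss_def
      using ln_dens_average_bound[OF F finite_outs[of n]]
      by (intro tame_integral_bound[OF tame_log_loss[OF F finite_outs] l]) simp
    then have "log_loss F (outs n) \<le> real n * ?B" by linarith
    then show "- ?B * real n \<le> u n" by (simp add: u_def algebra_simps)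
  qed
  then obtain v where v: "(\<lambda>n. u n / real n) \<longlonglongrightarrow> v" by (auto simp: convergent_def)
  define e where "e = (\<integral>x. eta (Z x 0) \<partial>PiM UNIV (iid F))"
  have "(\<lambda>n. e + u n / real n) \<longlonglongrightarrow> e + v" by (intro tendsto_intros v)
  moreover have "eventually (\<lambda>n. e + u n / real n = info F n / real n) sequentially"
    using eventually_gt_at_top[of 0] by eventually_elim (simp add: info_eq[OF F] u_def e_def field_simps)
  ultimately have "(\<lambda>n. info F n / real n) \<longlonglongrightarrow> e + v" by (rule Lim_transform_eventually)
  then show ?thesis unfolding rate_def by (simp add: limI)
qed

end

lemma nn_integral_poisson_mean:
  assumes "z > 0"
  shows "(\<integral>\<^sup>+n. ennreal (real n) \<partial>measure_pmf (poisson_pmf z)) = ennreal z"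
proof -
  let ?f = "\<lambda>n. exp (- z) * (real n * z ^ n / fact n)"
  have "(\<integral>\<^sup>+n. ennreal (real n) \<partial>measure_pmf (poisson_pmf z))
      = (\<integral>\<^sup>+n. ennreal (pmf (poisson_pmf z) n) * ennreal (real n) \<partial>count_space UNIV)"
    by (simp add: measure_pmf_eq_density nn_integral_density)
  also have "\<dots> = (\<Sum>n. ennreal (?f n))"
    using assms by (simp add: nn_integral_count_space_nat ennreal_mult[symmetric] field_simps)
  also have "\<dots> = ennreal z"
  proof (rule suminf_ennreal_eq)
    have "(\<lambda>n. exp (- z) * z * (z ^ n /\<^sub>R fact n)) sums (exp (- z) * z * exp z)"
      by (intro sums_mult exp_converges)
    then have "(\<lambda>n. ?f (Suc n)) sums z"
      by (simp add: exp_minus field_simps del: of_nat_Suc)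
    then show "?f sums z" by (subst (asm) sums_Suc_iff) simp
  qed (use assms in auto)
  finally show ?thesis .
qed

context poisson_channel
begin

subsection \<open>Mutual information of a block\<close>

lemma integral_output: assumes "x \<in> inputs" shows "(\<integral>y. real (y k) \<partial>K x) = Z x k"
proof -
  have "(\<integral>y. real (y k) \<partial>K x) = (\<integral>n. real n \<partial>measure_pmf (poisson_pmf (Z x k)))"
    unfolding output_kernel_def
    by (rule integral_PiM_component[where M="\<lambda>k. measure_pmf (poisson_pmf (Z x k))", OF prob_space_measure_pmf]) simp
  also have "\<dots> = Z x k"
    using integral_eq_nn_integral[of real "measure_pmf (poisson_pmf (Z x k))"] nn_integral_poisson_mean[OF Z_pos[OF assms]]
      Z_pos[OF assms] by (simp add: less_imp_le)
  finally show ?thesis .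
qed

lemma ln_lik: assumes "x \<in> inputs" shows "ln (lik T x y) = (\<Sum>k\<in>T. 1 - Z x k + real (y k) * ln (Z x k))"
proof -
  have "lik T x y = exp (\<Sum>k\<in>T. 1 - Z x k + real (y k) * ln (Z x k))"
    unfolding lik_def
  proof (induction T rule: infinite_finite_induct)
    case (insert k T)
    then show ?case using Z_pos[OF assms, of k] by (simp add: exp_add exp_of_nat_mult)
  qed simp_all
  then show ?thesis by simp
qed

text \<open>As \<open>y k\<close> has mean \<open>Z x k\<close>, the mean of
  \<open>1 - Z x k + real (y k) * ln (Z x k)\<close> is \<open>eta (Z x k)\<close>.\<close>

lemma integral_ln_lik:
  assumes "x \<in> inputs" "finite T"
  shows "integrable (K x) (\<lambda>y. ln (lik T x y))" "(\<integral>y. ln (lik T x y) \<partial>K x) = (\<Sum>k\<in>T. eta (Z x k))"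
proof -
  interpret prob_space "K x" by (rule prob_K)
  have yi: "integrable (K x) (\<lambda>y. real (y k))" for k
    by (rule growth_integral(1)[OF assms(1) _ _ _ growth_output]) auto
  then show "integrable (K x) (\<lambda>y. ln (lik T x y))"
    unfolding ln_lik[OF assms(1)] by (intro Bochner_Integration.integrable_sum Bochner_Integration.integrable_add integrable_mult_left) auto
  have i: "integrable (K x) (\<lambda>y. 1 - Z x k + real (y k) * ln (Z x k))" for k
    using yi by (intro Bochner_Integration.integrable_add integrable_mult_left) auto
  have "(\<integral>y. ln (lik T x y) \<partial>K x) = (\<Sum>k\<in>T. \<integral>y. 1 - Z x k + real (y k) * ln (Z x k) \<partial>K x)"
    unfolding ln_lik[OF assms(1)] by (rule Bochner_Integration.integral_sum[OF i])
  also have "\<dots> = (\<Sum>k\<in>T. eta (Z x k))"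
    using yi prob_space integral_output[OF assms(1)] by (simp add: eta_def)
  finally show "(\<integral>y. ln (lik T x y) \<partial>K x) = (\<Sum>k\<in>T. eta (Z x k))" .
qed

lemma nn_integral_K_lik:
  fixes u :: "_ \<Rightarrow> ennreal"
  assumes x: "x \<in> inputs" and T: "finite T" and u: "u \<in> borel_measurable SY" "depends_on T u"
  shows "(\<integral>\<^sup>+y. u y \<partial>K x) = (\<integral>\<^sup>+y. ennreal (lik T x y) * u y \<partial>nu)"
proof -
  have c: "prob_space (ext_law T x k)" "sets (ext_law T x k) = sets (count_space UNIV)" for k
    by (auto simp: ext_law_def prob_space_measure_pmf)
  have "(\<integral>\<^sup>+y. u y \<partial>K x) = (\<integral>\<^sup>+y. u y \<partial>PiM UNIV (ext_law T x))"
    unfolding output_kernel_def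
    by (rule nn_integral_PiM_cong_depends[OF _ _ _ _ u]) (use c in \<open>auto simp: ext_law_def prob_space_measure_pmf\<close>)
  also have "\<dots> = (\<integral>\<^sup>+y. ennreal (lik T x y) * u y \<partial>nu)"
    unfolding PiM_ext_law[OF x T] using u by (intro nn_integral_density) auto
  finally show ?thesis .
qed

lemma nn_integral_dens:
  fixes u :: "_ \<Rightarrow> ennreal"
  assumes \<sigma>: "laws \<sigma>" and T: "finite T" and u: "u \<in> borel_measurable SY" "depends_on T u"
  shows "(\<integral>\<^sup>+x. \<integral>\<^sup>+y. u y \<partial>K x \<partial>PiM UNIV \<sigma>) = (\<integral>\<^sup>+y. ennreal (dens \<sigma> T y) * u y \<partial>nu)"
proof -
  interpret X: prob_space "PiM UNIV \<sigma>" by (rule prob_PX[OF \<sigma>])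
  interpret Y: prob_space nu by (rule prob_nu)
  interpret pair_sigma_finite "PiM UNIV \<sigma>" nu ..
  have [measurable]: "u \<in> borel_measurable SY" by fact
  have s: "sets (PiM UNIV \<sigma> \<Otimes>\<^sub>M nu) = sets (SX \<Otimes>\<^sub>M SY)"
    using sets_PX[OF \<sigma>] by (intro sets_pair_measure_cong) auto
  have "(\<lambda>p. ennreal (lik T (fst p) (snd p)) * u (snd p)) \<in> borel_measurable (SX \<Otimes>\<^sub>M SY)" by measurable
  then have m: "(\<lambda>(x, y). ennreal (lik T x y) * u y) \<in> borel_measurable (PiM UNIV \<sigma> \<Otimes>\<^sub>M nu)"
    by (simp add: split_beta' measurable_cong_sets[OF s refl])
  have "(\<integral>\<^sup>+x. \<integral>\<^sup>+y. u y \<partial>K x \<partial>PiM UNIV \<sigma>) = (\<integral>\<^sup>+x. \<integral>\<^sup>+y. ennreal (lik T x y) * u y \<partial>nu \<partial>PiM UNIV \<sigma>)"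
    using space_PX[OF \<sigma>] by (intro nn_integral_cong) (simp add: nn_integral_K_lik[OF _ T u])
  also have "\<dots> = (\<integral>\<^sup>+y. \<integral>\<^sup>+x. ennreal (lik T x y) * u y \<partial>PiM UNIV \<sigma> \<partial>nu)"
    using Fubini[OF m] by simp
  also have "\<dots> = (\<integral>\<^sup>+y. ennreal (dens \<sigma> T y) * u y \<partial>nu)"
  proof (rule nn_integral_cong)
    fix y
    have "(\<integral>\<^sup>+x. ennreal (lik T x y) \<partial>PiM UNIV \<sigma>) = ennreal (dens \<sigma> T y)"
      unfolding dens_def using lik_pos space_PX[OF \<sigma>]
      by (intro nn_integral_eq_integral tame_integrable[OF tame_lik \<sigma>] AE_I2) (auto simp: less_imp_le)
    then show "(\<integral>\<^sup>+x. ennreal (lik T x y) * u y \<partial>PiM UNIV \<sigma>) = ennreal (dens \<sigma> T y) * u y"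
      using tame_measurable[OF tame_lik \<sigma>, of T y] by (subst nn_integral_multc) auto
  qed
  finally show ?thesis .
qed

abbreviation PL :: "real measure \<Rightarrow> ((int \<Rightarrow> real) \<times> (int \<Rightarrow> nat)) measure" where
  "PL \<equiv> process_law dark L h A"

lemma process_law_facts:
  assumes F: "F \<in> input_laws A"
  shows "prob_space (PL F)" "sets (PL F) = sets (SX \<Otimes>\<^sub>M SY)"
  using process_law_in_prob_algebra[OF dark h_nonneg F] by (auto simp: space_prob_algebra path_space_def)

lemma nn_integral_process:
  assumes F: "F \<in> input_laws A" and u: "u \<in> borel_measurable (SX \<Otimes>\<^sub>M SY)"
  shows "(\<integral>\<^sup>+\<omega>. u \<omega> \<partial>PL F) = (\<integral>\<^sup>+x. \<integral>\<^sup>+y. u (x, y) \<partial>K x \<partial>PiM UNIV (iid F))"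
proof -
  have "(\<lambda>x. distr (K x) (path_space A) (Pair x)) \<in> PiM UNIV (iid F) \<rightarrow>\<^sub>M prob_algebra (path_space A)"
    using measurable_joint_kernel[OF dark h_nonneg] sets_PX[OF laws_iid[OF F]] by (simp cong: measurable_cong_sets)
  then have k: "(\<lambda>x. distr (K x) (path_space A) (Pair x)) \<in> PiM UNIV (iid F) \<rightarrow>\<^sub>M subprob_algebra (path_space A)"
    by (rule measurable_prob_algebraD)
  have u': "u \<in> borel_measurable (path_space A)" using u by (simp add: path_space_def)
  show ?thesis unfolding process_law_def nn_integral_bind[OF u' k]
  proof (rule nn_integral_cong)
    fix x assume "x \<in> space (PiM UNIV (iid F))"
    then have "x \<in> space SX" using space_PX[OF laws_iid[OF F]] space_SX by simp
    then have "Pair x \<in> SY \<rightarrow>\<^sub>M path_space A" unfolding path_space_def by (rule measurable_Pair1')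
    then have "Pair x \<in> K x \<rightarrow>\<^sub>M path_space A" by (simp cong: measurable_cong_sets)
    then show "(\<integral>\<^sup>+\<omega>. u \<omega> \<partial>distr (K x) (path_space A) (Pair x)) = (\<integral>\<^sup>+y. u (x, y) \<partial>K x)"
      using u' by (intro nn_integral_distr) auto
  qed
qed

lemma tame_joint_average:
  assumes v: "v \<in> borel_measurable (SX \<Otimes>\<^sub>M SY)" and S: "finite S" "r \<ge> 1" "c \<ge> 0"
    and b: "\<And>x y. x \<in> inputs \<Longrightarrow> \<bar>v (x, y)\<bar> \<le> c * r ^ (\<Sum>k\<in>S. y k)"
  shows "tame (\<lambda>x. \<integral>y. v (x, y) \<partial>K x)" "x \<in> inputs \<Longrightarrow> integrable (K x) (\<lambda>y. v (x, y))"
proof -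
  have g: "growth S c r (\<lambda>y. v (x, y))" if "x \<in> inputs" for x
    using b[OF that] measurable_compose[OF measurable_Pair1' v, of x] that by (simp add: growth_def space_SX)
  show "x \<in> inputs \<Longrightarrow> integrable (K x) (\<lambda>y. v (x, y))"
    by (rule growth_integral(1)[OF _ S g])
  \<comment> \<open>The integrand depends on \<open>x\<close> too; integrating over the joint kernel
    turns it into a fixed function and makes the result measurable in \<open>x\<close>.\<close>
  have "(\<lambda>x. distr (K x) (SX \<Otimes>\<^sub>M SY) (Pair x)) \<in> SX \<rightarrow>\<^sub>M subprob_algebra (SX \<Otimes>\<^sub>M SY)"
    using measurable_prob_algebraD[OF measurable_joint_kernel[OF dark h_nonneg]] by (simp add: path_space_def)
  then have "(\<lambda>x. \<integral>\<omega>. v \<omega> \<partial>distr (K x) (SX \<Otimes>\<^sub>M SY) (Pair x)) \<in> borel_measurable SX"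
    by (rule measurable_compose[OF _ integral_measurable_subprob_algebra[OF v]])
  also have "?this \<longleftrightarrow> (\<lambda>x. \<integral>y. v (x, y) \<partial>K x) \<in> borel_measurable SX"
  proof (rule measurable_cong)
    fix x assume "x \<in> space SX"
    then have "Pair x \<in> K x \<rightarrow>\<^sub>M SX \<Otimes>\<^sub>M SY" using measurable_Pair1'[of x SX SY] by (simp cong: measurable_cong_sets)
    then show "(\<integral>\<omega>. v \<omega> \<partial>distr (K x) (SX \<Otimes>\<^sub>M SY) (Pair x)) = (\<integral>y. v (x, y) \<partial>K x)"
      using v by (intro integral_distr) auto
  qed
  finally show "tame (\<lambda>x. \<integral>y. v (x, y) \<partial>K x)"
    using growth_integral(2)[OF _ S g] by (rule tameI)
qed

lemma integral_process:
  fixes v :: "_ \<Rightarrow> real"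
  assumes F: "F \<in> input_laws A" and v: "v \<in> borel_measurable (SX \<Otimes>\<^sub>M SY)" and S: "finite S" "r \<ge> 1" "c \<ge> 0"
    and b: "\<And>x y. x \<in> inputs \<Longrightarrow> \<bar>v (x, y)\<bar> \<le> c * r ^ (\<Sum>k\<in>S. y k)"
  shows "(\<integral>\<omega>. v \<omega> \<partial>PL F) = (\<integral>x. \<integral>y. v (x, y) \<partial>K x \<partial>PiM UNIV (iid F))"
proof -
  note l = laws_iid[OF F]
  have *: "integrable (PL F) w \<and> (\<integral>\<omega>. w \<omega> \<partial>PL F) = (\<integral>x. \<integral>y. w (x, y) \<partial>K x \<partial>PiM UNIV (iid F))"
    if w: "w \<in> borel_measurable (SX \<Otimes>\<^sub>M SY)" and nn: "\<And>\<omega>. 0 \<le> w \<omega>"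
      and wb: "\<And>x y. x \<in> inputs \<Longrightarrow> \<bar>w (x, y)\<bar> \<le> c * r ^ (\<Sum>k\<in>S. y k)" for w :: "_ \<Rightarrow> real"
  proof -
    note t = tame_joint_average[OF w S wb]
    have wm: "w \<in> borel_measurable (PL F)" using w process_law_facts[OF F] by (simp cong: measurable_cong_sets)
    have "(\<integral>\<^sup>+\<omega>. ennreal (w \<omega>) \<partial>PL F) = (\<integral>\<^sup>+x. \<integral>\<^sup>+y. ennreal (w (x, y)) \<partial>K x \<partial>PiM UNIV (iid F))"
      by (rule nn_integral_process[OF F]) (use w in measurable)
    also have "\<dots> = (\<integral>\<^sup>+x. ennreal (\<integral>y. w (x, y) \<partial>K x) \<partial>PiM UNIV (iid F))"
      using t(2) nn space_PX[OF l] by (intro nn_integral_cong nn_integral_eq_integral) auto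
    also have "\<dots> = ennreal (\<integral>x. \<integral>y. w (x, y) \<partial>K x \<partial>PiM UNIV (iid F))"
      using nn by (intro nn_integral_eq_integral tame_integrable[OF t(1) l]) auto
    finally have eq: "(\<integral>\<^sup>+\<omega>. ennreal (w \<omega>) \<partial>PL F) = ennreal (\<integral>x. \<integral>y. w (x, y) \<partial>K x \<partial>PiM UNIV (iid F))" .
    have "0 \<le> (\<integral>x. \<integral>y. w (x, y) \<partial>K x \<partial>PiM UNIV (iid F))" using nn by simp
    then show ?thesis
      using eq nn wm integral_eq_nn_integral[of w "PL F"] by (auto intro!: integrableI_nonneg)
  qed
  \<comment> \<open>Positive and negative parts satisfy the same bound as \<open>v\<close>, so the
    nonnegative case applies to each.\<close>
  define p where "p \<omega> = max (v \<omega>) 0" for \<omega>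
  define q where "q \<omega> = max (- v \<omega>) 0" for \<omega>
  have vpq: "v \<omega> = p \<omega> - q \<omega>" for \<omega> by (auto simp: p_def q_def)
  have pm: "p \<in> borel_measurable (SX \<Otimes>\<^sub>M SY)" "q \<in> borel_measurable (SX \<Otimes>\<^sub>M SY)"
    unfolding p_def q_def using v by measurable
  have pb: "\<bar>p (x, y)\<bar> \<le> c * r ^ (\<Sum>k\<in>S. y k)" "\<bar>q (x, y)\<bar> \<le> c * r ^ (\<Sum>k\<in>S. y k)" if "x \<in> inputs" for x y
    using b[OF that, of y] by (auto simp: p_def q_def)
  have P: "integrable (PL F) p \<and> (\<integral>\<omega>. p \<omega> \<partial>PL F) = (\<integral>x. \<integral>y. p (x, y) \<partial>K x \<partial>PiM UNIV (iid F))"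
    by (rule *[OF pm(1) _ pb(1)]) (auto simp: p_def)
  have Q: "integrable (PL F) q \<and> (\<integral>\<omega>. q \<omega> \<partial>PL F) = (\<integral>x. \<integral>y. q (x, y) \<partial>K x \<partial>PiM UNIV (iid F))"
    by (rule *[OF pm(2) _ pb(2)]) (auto simp: q_def)
  note tp = tame_joint_average[OF pm(1) S pb(1)] and tq = tame_joint_average[OF pm(2) S pb(2)]
  have "(\<integral>\<omega>. v \<omega> \<partial>PL F) = (\<integral>x. \<integral>y. p (x, y) \<partial>K x \<partial>PiM UNIV (iid F)) - (\<integral>x. \<integral>y. q (x, y) \<partial>K x \<partial>PiM UNIV (iid F))"
    using P Q by (simp add: vpq)
  also have "\<dots> = (\<integral>x. (\<integral>y. p (x, y) \<partial>K x) - (\<integral>y. q (x, y) \<partial>K x) \<partial>PiM UNIV (iid F))"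
    using tame_integrable[OF tp(1) l] tame_integrable[OF tq(1) l] by simp
  also have "\<dots> = (\<integral>x. \<integral>y. v (x, y) \<partial>K x \<partial>PiM UNIV (iid F))"
    using tp(2) tq(2) space_PX[OF l] by (intro Bochner_Integration.integral_cong refl) (simp add: vpq)
  finally show ?thesis .
qed


text \<open>The conditional density of the outputs in \<open>T\<close> given the inputs in
  \<open>T\<close>: the inputs outside are redrawn and averaged out.\<close>

definition cond_lik :: "real measure \<Rightarrow> int set \<Rightarrow> (int \<Rightarrow> real) \<Rightarrow> (int \<Rightarrow> nat) \<Rightarrow> real" where
  "cond_lik F T x y = (\<integral>x'. lik T (glue T x x') y \<partial>PiM UNIV (iid F))"

lemma glue_inputs: "x \<in> inputs \<Longrightarrow> x' \<in> inputs \<Longrightarrow> glue T x x' \<in> inputs"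
  by (simp add: inputs_def glue_def)

lemma measurable_glue_SX: "(\<lambda>p. glue T (fst p) (snd p)) \<in> SX \<Otimes>\<^sub>M SX \<rightarrow>\<^sub>M SX"
  by (rule measurable_glue) auto

lemma lik_glue_joint:
  "(\<lambda>p. lik T (glue T (fst (fst p)) (snd p)) (snd (fst p))) \<in> borel_measurable ((SX \<Otimes>\<^sub>M SY) \<Otimes>\<^sub>M SX)"
proof -
  have "(\<lambda>p. (fst (fst p), snd p)) \<in> (SX \<Otimes>\<^sub>M SY) \<Otimes>\<^sub>M SX \<rightarrow>\<^sub>M SX \<Otimes>\<^sub>M SX" by measurable
  from measurable_compose[OF this measurable_glue_SX[of T]]
  have "(\<lambda>p. glue T (fst (fst p)) (snd p)) \<in> (SX \<Otimes>\<^sub>M SY) \<Otimes>\<^sub>M SX \<rightarrow>\<^sub>M SX" by simp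
  then have "(\<lambda>p. (glue T (fst (fst p)) (snd p), snd (fst p))) \<in> (SX \<Otimes>\<^sub>M SY) \<Otimes>\<^sub>M SX \<rightarrow>\<^sub>M SX \<Otimes>\<^sub>M SY"
    by (intro measurable_Pair measurable_compose[OF measurable_fst measurable_snd])
  from measurable_compose[OF this measurable_lik[of T]] show ?thesis by simp
qed

lemma measurable_cond_lik:
  assumes F: "F \<in> input_laws A"
  shows "(\<lambda>p. cond_lik F T (fst p) (snd p)) \<in> borel_measurable (SX \<Otimes>\<^sub>M SY)"
proof -
  interpret X: prob_space "PiM UNIV (iid F)" by (rule prob_PX[OF laws_iid[OF F]])
  have "sets ((SX \<Otimes>\<^sub>M SY) \<Otimes>\<^sub>M PiM UNIV (iid F)) = sets ((SX \<Otimes>\<^sub>M SY) \<Otimes>\<^sub>M SX)"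
    using sets_PX[OF laws_iid[OF F]] by (intro sets_pair_measure_cong) auto
  then have "(\<lambda>(p, x'). lik T (glue T (fst p) x') (snd p)) \<in> borel_measurable ((SX \<Otimes>\<^sub>M SY) \<Otimes>\<^sub>M PiM UNIV (iid F))"
    using lik_glue_joint by (simp add: split_beta' cong: measurable_cong_sets)
  then show ?thesis unfolding cond_lik_def by (rule X.borel_measurable_lebesgue_integral)
qed

lemma cond_lik_cong:
  assumes "\<And>k. k \<in> T \<Longrightarrow> x k = x' k" "\<And>k. k \<in> T \<Longrightarrow> y k = y' k"
  shows "cond_lik F T x y = cond_lik F T x' y'"
proof -
  have "glue T x = glue T x'" using assms by (auto simp: glue_def fun_eq_iff)
  then show ?thesis using assms(2) by (simp add: cond_lik_def lik_def)
qed

lemma tame_lik_glue: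
  assumes x: "x \<in> inputs"
  shows "tame (\<lambda>x'. lik T (glue T x x') y)"
proof (rule tameI)
  have "(\<lambda>x'. (x, x')) \<in> SX \<rightarrow>\<^sub>M SX \<Otimes>\<^sub>M SX" using x by (intro measurable_Pair1') (simp add: space_SX)
  from measurable_compose[OF this measurable_glue_SX[of T]] have "(\<lambda>x'. glue T x x') \<in> SX \<rightarrow>\<^sub>M SX" by simp
  then show "(\<lambda>x'. lik T (glue T x x') y) \<in> borel_measurable SX" by (rule measurable_compose) measurable
  fix x' assume "x' \<in> inputs"
  then show "\<bar>lik T (glue T x x') y\<bar> \<le> exp (real (card T) * (1 + peak) + log_size * real (\<Sum>k\<in>T. y k))"
    using lik_bounds(2)[OF glue_inputs[OF x]] lik_pos[OF glue_inputs[OF x]] by (simp add: abs_of_pos)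
qed

definition edge_bound :: "(int \<Rightarrow> nat) \<Rightarrow> real" where
  "edge_bound y = ratio_bound * (peak / dark) ^ (\<Sum>k\<in>win 1. y k)"

lemma edge_bound_pos: "edge_bound y > 0"
  using dark peak_pos by (simp add: edge_bound_def ratio_bound_def)

lemma Z_glue_outs:
  assumes "k \<in> outs n" "k \<notin> win 1"
  shows "Z (glue (outs n) x x') k = Z x k"
  by (rule Z_cong) (use assms in \<open>auto simp: glue_def outs_def win_def\<close>)

text \<open>The window of \<open>1\<close> covers all outputs of the block that depend on inputs preceding the block.\<close>

lemma cond_lik_bounds:
  assumes F: "F \<in> input_laws A" and x: "x \<in> inputs"
  shows "cond_lik F (outs n) x y \<le> edge_bound y * lik (outs n) x y"
    and "lik (outs n) x y \<le> edge_bound y * cond_lik F (outs n) x y"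
proof -
  note l = laws_iid[OF F]
  interpret X: prob_space "PiM UNIV (iid F)" by (rule prob_PX[OF l])
  note i = tame_integrable[OF tame_lik_glue[OF x] l, of "outs n" y]
  have up: "lik (outs n) (glue (outs n) x x') y \<le> edge_bound y * lik (outs n) x y" if "x' \<in> inputs" for x'
    unfolding edge_bound_def by (rule lik_window_le[OF x glue_inputs[OF x that] finite_outs Z_glue_outs])
  have lo: "lik (outs n) x y \<le> edge_bound y * lik (outs n) (glue (outs n) x x') y" if "x' \<in> inputs" for x'
    unfolding edge_bound_def
    by (rule lik_window_le[OF glue_inputs[OF x that] x finite_outs Z_glue_outs[symmetric]])
  show "cond_lik F (outs n) x y \<le> edge_bound y * lik (outs n) x y"
    unfolding cond_lik_def
    by (rule X.integral_le_const[OF i], rule AE_I2, rule up) (simp add: space_PX[OF l])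
  have "lik (outs n) x y \<le> (\<integral>x'. edge_bound y * lik (outs n) (glue (outs n) x x') y \<partial>PiM UNIV (iid F))"
    by (rule X.integral_ge_const[OF integrable_mult_right[OF i]], rule AE_I2, rule lo) (simp add: space_PX[OF l])
  then show "lik (outs n) x y \<le> edge_bound y * cond_lik F (outs n) x y"
    unfolding cond_lik_def integral_mult_right_zero .
qed

lemma cond_lik_pos:
  assumes "F \<in> input_laws A" "x \<in> inputs"
  shows "cond_lik F (outs n) x y > 0"
proof -
  have "0 < edge_bound y * cond_lik F (outs n) x y"
    using cond_lik_bounds(2)[OF assms, of n y] lik_pos[OF assms(2), of "outs n" y] by linarith
  then show ?thesis using edge_bound_pos[of y] by (simp add: zero_less_mult_iff)
qed

definition edge_size :: real where "edge_size = real (L + 1) * A + ln (peak / dark)"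

lemma edge_size_nonneg: "edge_size \<ge> 0"
  using A dark dark_le_peak by (simp add: edge_size_def)

text \<open>Forgetting the inputs before the block changes the log likelihood by an amount
  controlled by a single window, for every \<open>n\<close>. Hence block information and
  \<open>info\<close> stay at bounded distance.\<close>

lemma ln_cond_lik:
  assumes F: "F \<in> input_laws A" and x: "x \<in> inputs"
  shows "\<bar>ln (cond_lik F (outs n) x y) - ln (lik (outs n) x y)\<bar> \<le> edge_size * 2 ^ (\<Sum>k\<in>win 1. y k)"
proof -
  note p = cond_lik_pos[OF F x, of n y] lik_pos[OF x, of "outs n" y] edge_bound_pos[of y]
  have eb: "ln (edge_bound y) = real (L + 1) * A + ln (peak / dark) * real (\<Sum>k\<in>win 1. y k)"
    using dark peak_pos by (simp add: edge_bound_def ratio_bound_def ln_mult ln_realpow algebra_simps del: of_nat_sum)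
  also have "\<dots> \<le> edge_size * 2 ^ (\<Sum>k\<in>win 1. y k)"
    unfolding edge_size_def using A dark dark_le_peak by (intro linear_le_two_power) auto
  finally have eb: "ln (edge_bound y) \<le> edge_size * 2 ^ (\<Sum>k\<in>win 1. y k)" .
  have "ln (cond_lik F (outs n) x y) \<le> ln (edge_bound y) + ln (lik (outs n) x y)"
    using ln_mono[OF cond_lik_bounds(1)[OF F x] p(1)] p by (simp add: ln_mult)
  moreover have "ln (lik (outs n) x y) \<le> ln (edge_bound y) + ln (cond_lik F (outs n) x y)"
    using ln_mono[OF cond_lik_bounds(2)[OF F x] p(2)] p by (simp add: ln_mult)
  ultimately show ?thesis using eb by linarith
qed

text \<open>Lets functions of two-sided sequences be evaluated on blocks. The filling value zero is
  itself an admissible input.\<close>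

abbreviation embed :: "int set \<Rightarrow> (int \<Rightarrow> 'a::zero) \<Rightarrow> int \<Rightarrow> 'a" where
  "embed T a \<equiv> glue T a (\<lambda>_. 0)"

lemma measurable_embed:
  assumes "\<And>k. 0 \<in> space (M k)"
  shows "embed T \<in> PiM T M \<rightarrow>\<^sub>M PiM UNIV M"
proof (rule measurable_PiM_single')
  show "(\<lambda>a. embed T a k) \<in> PiM T M \<rightarrow>\<^sub>M M k" for k
    using assms by (cases "k \<in> T") (simp_all add: glue_def)
qed (use assms in \<open>auto simp: glue_def space_PiM PiE_iff\<close>)

text \<open>The density of the joint law of the block with respect to the product of its marginals,
  read on full sequences.\<close>

definition info_density :: "real measure \<Rightarrow> nat \<Rightarrow> (int \<Rightarrow> real) \<times> (int \<Rightarrow> nat) \<Rightarrow> real" where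
  "info_density F n p = cond_lik F (outs n) (fst p) (snd p) / dens (iid F) (outs n) (snd p)"

lemma measurable_info_density:
  assumes F: "F \<in> input_laws A"
  shows "info_density F n \<in> borel_measurable (SX \<Otimes>\<^sub>M SY)"
  unfolding info_density_def
  using measurable_cond_lik[OF F, of "outs n"] measurable_compose[OF measurable_snd measurable_dens[OF laws_iid[OF F], of "outs n"]]
  by (intro borel_measurable_divide) auto

lemma info_density_embed:
  "info_density F n (embed (outs n) (restrict x (outs n)), embed (outs n) (restrict y (outs n))) = info_density F n (x, y)"
  unfolding info_density_def
  by (intro arg_cong2[where f=divide] cond_lik_cong depends_onD[OF depends_on_dens]) (auto simp: glue_def)

lemma ln_info_density_bound:
  assumes F: "F \<in> input_laws A" and x: "x \<in> inputs"
  shows "\<bar>ln (info_density F n (x, y))\<bar> \<le> (edge_size + 2 * ln_size (outs n)) * 2 ^ (\<Sum>k\<in>outs n \<union> win 1. y k)"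
proof -
  let ?T = "outs n" and ?S = "outs n \<union> win 1"
  have "\<bar>ln (lik ?T x y)\<bar> \<le> real (card ?T) * (1 + peak) + log_size * real (\<Sum>k\<in>?T. y k)"
    using ln_mono[OF lik_bounds(1)[OF x] exp_gt_zero, of ?T y]
      ln_mono[OF lik_bounds(2)[OF x] lik_pos[OF x], of ?T y] by simp
  also have "\<dots> \<le> ln_size ?T * 2 ^ (\<Sum>k\<in>?T. y k)"
    unfolding ln_size_def using peak_pos log_size_nonneg by (intro linear_le_two_power) auto
  finally have 1: "\<bar>ln (lik ?T x y)\<bar> \<le> ln_size ?T * 2 ^ (\<Sum>k\<in>?T. y k)" .
  have 2: "\<bar>ln (dens (iid F) ?T y)\<bar> \<le> ln_size ?T * 2 ^ (\<Sum>k\<in>?T. y k)"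
    using growth_ln_dens[OF laws_iid[OF F], of ?T] by (simp add: growth_def)
  have mono: "a * 2 ^ (\<Sum>k\<in>V. y k) \<le> a * 2 ^ (\<Sum>k\<in>?S. y k)" if "V \<subseteq> ?S" "0 \<le> a" for V and a :: real
    using that by (intro mult_left_mono power_increasing sum_mono2) auto
  have "ln (info_density F n (x, y)) = ln (cond_lik F ?T x y) - ln (dens (iid F) ?T y)"
    using cond_lik_pos[OF F x, of n y] dens_pos[OF laws_iid[OF F], of ?T y] by (simp add: info_density_def ln_div)
  then show ?thesis
    using ln_cond_lik[OF F x, of n y] 1 2 mono[of "win 1", OF _ edge_size_nonneg] mono[of ?T, OF _ ln_size_nonneg[of ?T]]
    by (simp add: distrib_right)
qed

lemma restrict_measurable:
  "(\<lambda>\<omega>. restrict (fst \<omega>) T) \<in> SX \<Otimes>\<^sub>M SY \<rightarrow>\<^sub>M PiM T (\<lambda>_. input_space A)"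
  "(\<lambda>\<omega>. restrict (snd \<omega>) T) \<in> SX \<Otimes>\<^sub>M SY \<rightarrow>\<^sub>M PiM T (\<lambda>_. count_space UNIV)"
  by (auto intro!: measurable_restrict measurable_compose[OF measurable_fst measurable_component_singleton]
      measurable_compose[OF measurable_snd measurable_component_singleton])

text \<open>For a measurable set both sides become the same integral of \<open>cond_lik\<close> over
  inputs and \<open>nu\<close>. On the joint side the inputs outside the block are resampled by
  gluing, which the indicator does not notice; on the product side the output density cancels the
  denominator of \<open>info_density\<close>.\<close>

lemma block_density:
  fixes n :: nat
  assumes F: "F \<in> input_laws A"
  defines "T \<equiv> outs n"
  defines "SXn \<equiv> (\<Pi>\<^sub>M k\<in>T. input_space A)" and "SYn \<equiv> (\<Pi>\<^sub>M k\<in>T. count_space (UNIV :: nat set))"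
  defines "rx \<equiv> (\<lambda>\<omega> :: (int \<Rightarrow> real) \<times> (int \<Rightarrow> nat). restrict (fst \<omega>) T)"
    and "ry \<equiv> (\<lambda>\<omega> :: (int \<Rightarrow> real) \<times> (int \<Rightarrow> nat). restrict (snd \<omega>) T)"
  defines "r \<equiv> (\<lambda>p. info_density F n (embed T (fst p), embed T (snd p)))"
  shows "r \<in> borel_measurable (SXn \<Otimes>\<^sub>M SYn)"
    and "distr (PL F) (SXn \<Otimes>\<^sub>M SYn) (\<lambda>\<omega>. (rx \<omega>, ry \<omega>))
      = density (distr (PL F) SXn rx \<Otimes>\<^sub>M distr (PL F) SYn ry) (\<lambda>p. ennreal (r p))"
proof -
  note l = laws_iid[OF F]
  interpret P: prob_space "PL F" by (rule process_law_facts[OF F])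
  interpret X: prob_space "PiM UNIV (iid F)" by (rule prob_PX[OF l])
  interpret N: prob_space nu by (rule prob_nu)
  interpret XN: pair_sigma_finite "PiM UNIV (iid F)" nu ..
  have fT [simp]: "finite T" by (simp add: T_def)
  have rxm: "rx \<in> SX \<Otimes>\<^sub>M SY \<rightarrow>\<^sub>M SXn" and rym: "ry \<in> SX \<Otimes>\<^sub>M SY \<rightarrow>\<^sub>M SYn"
    unfolding rx_def ry_def SXn_def SYn_def by (rule restrict_measurable)+
  have sPL: "sets (PL F) = sets (SX \<Otimes>\<^sub>M SY)" by (rule process_law_facts[OF F])
  have rxP: "rx \<in> PL F \<rightarrow>\<^sub>M SXn" and ryP: "ry \<in> PL F \<rightarrow>\<^sub>M SYn"
    using rxm rym sPL by (simp_all cong: measurable_cong_sets)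
  interpret MY: prob_space "distr (PL F) SYn ry" by (rule P.prob_space_distr[OF ryP])
  have ex: "embed T \<in> SXn \<rightarrow>\<^sub>M SX" "embed T \<in> SYn \<rightarrow>\<^sub>M SY"
    unfolding SXn_def SYn_def using A by (auto intro!: measurable_embed simp: space_input_space)
  have "(\<lambda>p. (embed T (fst p), embed T (snd p))) \<in> SXn \<Otimes>\<^sub>M SYn \<rightarrow>\<^sub>M SX \<Otimes>\<^sub>M SY"
    by (intro measurable_Pair measurable_compose[OF measurable_fst ex(1)] measurable_compose[OF measurable_snd ex(2)])
  from measurable_compose[OF this measurable_info_density[OF F]]
  show rm: "r \<in> borel_measurable (SXn \<Otimes>\<^sub>M SYn)" by (simp add: r_def)
  have r_eq: "r (rx (x, y), ry (x', y)) = info_density F n (x, y)" for x x' y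
    using info_density_embed[of F n x y] by (simp add: r_def rx_def ry_def T_def)
  let ?P = "distr (PL F) SXn rx \<Otimes>\<^sub>M distr (PL F) SYn ry"
  have sP: "sets ?P = sets (SXn \<Otimes>\<^sub>M SYn)" by (intro sets_pair_measure_cong) auto
  show "distr (PL F) (SXn \<Otimes>\<^sub>M SYn) (\<lambda>\<omega>. (rx \<omega>, ry \<omega>)) = density ?P (\<lambda>p. ennreal (r p))"
  proof (rule measure_eqI)
    show "sets (distr (PL F) (SXn \<Otimes>\<^sub>M SYn) (\<lambda>\<omega>. (rx \<omega>, ry \<omega>))) = sets (density ?P (\<lambda>p. ennreal (r p)))"
      using sP by simp
    fix B assume "B \<in> sets (distr (PL F) (SXn \<Otimes>\<^sub>M SYn) (\<lambda>\<omega>. (rx \<omega>, ry \<omega>)))"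
    then have B: "B \<in> sets (SXn \<Otimes>\<^sub>M SYn)" by simp
    define b where "b x y = (indicator B (restrict x T, restrict y T) :: ennreal)" for x :: "int \<Rightarrow> real" and y :: "int \<Rightarrow> nat"
    have bm: "(\<lambda>p. b (fst p) (snd p)) \<in> borel_measurable (SX \<Otimes>\<^sub>M SY)"
      using measurable_compose[OF measurable_Pair[OF rxm rym] borel_measurable_indicator[OF B]]
      by (simp add: b_def rx_def ry_def)
    have bdep: "b x y = b x' y'" if "\<And>k. k \<in> T \<Longrightarrow> x k = x' k" "\<And>k. k \<in> T \<Longrightarrow> y k = y' k" for x x' y y'
    proof -
      have "restrict x T = restrict x' T" "restrict y T = restrict y' T" using that by (auto simp: restrict_def fun_eq_iff)
      then show ?thesis by (simp add: b_def)
    qed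
    have bsec: "b x \<in> borel_measurable SY" if "x \<in> inputs" for x
      using measurable_compose[OF measurable_Pair1' bm, of x] that by (simp add: space_SX)
    have byd: "depends_on T (b x)" for x by (rule depends_onI, rule bdep) auto

    have "emeasure (distr (PL F) (SXn \<Otimes>\<^sub>M SYn) (\<lambda>\<omega>. (rx \<omega>, ry \<omega>))) B
        = (\<integral>\<^sup>+p. indicator B p \<partial>distr (PL F) (SXn \<Otimes>\<^sub>M SYn) (\<lambda>\<omega>. (rx \<omega>, ry \<omega>)))"
      using B by simp
    also have "\<dots> = (\<integral>\<^sup>+\<omega>. b (fst \<omega>) (snd \<omega>) \<partial>PL F)"
      using B by (subst nn_integral_distr[OF measurable_Pair[OF rxP ryP]]) (auto simp: b_def rx_def ry_def)
    also have "\<dots> = (\<integral>\<^sup>+x. \<integral>\<^sup>+y. b x y \<partial>K x \<partial>PiM UNIV (iid F))"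
      using nn_integral_process[OF F bm] by simp
    also have "\<dots> = (\<integral>\<^sup>+x. \<integral>\<^sup>+y. ennreal (lik T x y) * b x y \<partial>nu \<partial>PiM UNIV (iid F))"
      using space_PX[OF l] by (intro nn_integral_cong nn_integral_K_lik bsec byd fT) auto
    also have "\<dots> = (\<integral>\<^sup>+x. \<integral>\<^sup>+x'. \<integral>\<^sup>+y. ennreal (lik T (glue T x x') y) * b x y \<partial>nu \<partial>PiM UNIV (iid F) \<partial>PiM UNIV (iid F))"
    proof -
      have "(\<lambda>p. ennreal (lik T (fst p) (snd p)) * b (fst p) (snd p)) \<in> borel_measurable (SX \<Otimes>\<^sub>M SY)"
        using bm by measurable
      moreover have "sets (SX \<Otimes>\<^sub>M nu) = sets (SX \<Otimes>\<^sub>M SY)" by (intro sets_pair_measure_cong) auto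
      ultimately have "(\<lambda>p. ennreal (lik T (fst p) (snd p)) * b (fst p) (snd p)) \<in> borel_measurable (SX \<Otimes>\<^sub>M nu)"
        by (simp cong: measurable_cong_sets)
      from N.borel_measurable_nn_integral_fst[OF this]
      have m: "(\<lambda>x. \<integral>\<^sup>+y. ennreal (lik T x y) * b x y \<partial>nu) \<in> borel_measurable SX" by simp
      have "b (glue T x x') y = b x y" for x x' y by (rule bdep) (auto simp: glue_def)
      then show ?thesis
        using nn_integral_glue[of "iid F" "iid F" "\<lambda>_. input_space A", OF _ _ _ _ m, of T] input_lawsD[OF F] by simp
    qed
    also have "\<dots> = (\<integral>\<^sup>+x. \<integral>\<^sup>+y. ennreal (cond_lik F T x y) * b x y \<partial>nu \<partial>PiM UNIV (iid F))"
    proof (rule nn_integral_cong)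
      fix x assume "x \<in> space (PiM UNIV (iid F))"
      then have x: "x \<in> inputs" using space_PX[OF l] by simp
      have "(\<lambda>p. ((x, snd p), fst p)) \<in> SX \<Otimes>\<^sub>M SY \<rightarrow>\<^sub>M (SX \<Otimes>\<^sub>M SY) \<Otimes>\<^sub>M SX"
        using x by (intro measurable_Pair measurable_const measurable_fst measurable_snd) (simp add: space_SX)
      from measurable_compose[OF this lik_glue_joint[of T]] bsec[OF x]
      have m: "(\<lambda>p. ennreal (lik T (glue T x (fst p)) (snd p)) * b x (snd p)) \<in> borel_measurable (SX \<Otimes>\<^sub>M SY)"
        by (intro borel_measurable_times_ennreal measurable_compose[OF _ measurable_ennreal] measurable_compose[OF measurable_snd]) auto
      have "sets (PiM UNIV (iid F) \<Otimes>\<^sub>M nu) = sets (SX \<Otimes>\<^sub>M SY)"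
        using sets_PX[OF l] by (intro sets_pair_measure_cong) auto
      then have m': "(\<lambda>(x', y). ennreal (lik T (glue T x x') y) * b x y) \<in> borel_measurable (PiM UNIV (iid F) \<Otimes>\<^sub>M nu)"
        using m by (simp add: split_beta' cong: measurable_cong_sets)
      have "(\<integral>\<^sup>+x'. \<integral>\<^sup>+y. ennreal (lik T (glue T x x') y) * b x y \<partial>nu \<partial>PiM UNIV (iid F))
          = (\<integral>\<^sup>+y. \<integral>\<^sup>+x'. ennreal (lik T (glue T x x') y) * b x y \<partial>PiM UNIV (iid F) \<partial>nu)"
        using XN.Fubini[OF m'] by simp
      also have "\<dots> = (\<integral>\<^sup>+y. ennreal (cond_lik F T x y) * b x y \<partial>nu)"
      proof (rule nn_integral_cong)
        fix y
        have "(\<integral>\<^sup>+x'. ennreal (lik T (glue T x x') y) \<partial>PiM UNIV (iid F)) = ennreal (cond_lik F T x y)"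
          unfolding cond_lik_def using lik_pos[OF glue_inputs[OF x]] space_PX[OF l]
          by (intro nn_integral_eq_integral tame_integrable[OF tame_lik_glue[OF x] l] AE_I2) (auto simp: less_imp_le)
        then show "(\<integral>\<^sup>+x'. ennreal (lik T (glue T x x') y) * b x y \<partial>PiM UNIV (iid F)) = ennreal (cond_lik F T x y) * b x y"
          using tame_measurable[OF tame_lik_glue[OF x] l, of T y] by (subst nn_integral_multc) auto
      qed
      finally show "(\<integral>\<^sup>+x'. \<integral>\<^sup>+y. ennreal (lik T (glue T x x') y) * b x y \<partial>nu \<partial>PiM UNIV (iid F))
          = (\<integral>\<^sup>+y. ennreal (cond_lik F T x y) * b x y \<partial>nu)" .
    qed
    finally have lhs: "emeasure (distr (PL F) (SXn \<Otimes>\<^sub>M SYn) (\<lambda>\<omega>. (rx \<omega>, ry \<omega>))) B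
        = (\<integral>\<^sup>+x. \<integral>\<^sup>+y. ennreal (cond_lik F T x y) * b x y \<partial>nu \<partial>PiM UNIV (iid F))" .

    have wm: "(\<lambda>p. ennreal (r p) * indicator B p) \<in> borel_measurable (SXn \<Otimes>\<^sub>M SYn)"
      using rm B by measurable
    then have wm': "(\<lambda>p. ennreal (r p) * indicator B p) \<in> borel_measurable ?P"
      using sP by (simp cong: measurable_cong_sets)
    have sY: "sets (SXn \<Otimes>\<^sub>M distr (PL F) SYn ry) = sets (SXn \<Otimes>\<^sub>M SYn)" by (intro sets_pair_measure_cong) auto
    have inner_m: "(\<lambda>a. \<integral>\<^sup>+c. ennreal (r (a, c)) * indicator B (a, c) \<partial>distr (PL F) SYn ry) \<in> borel_measurable SXn"
      using MY.borel_measurable_nn_integral_fst[of "\<lambda>p. ennreal (r p) * indicator B p" SXn] wm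
      by (simp add: measurable_cong_sets[OF sY refl])
    have inner: "(\<integral>\<^sup>+c. ennreal (r (restrict x T, c)) * indicator B (restrict x T, c) \<partial>distr (PL F) SYn ry)
        = (\<integral>\<^sup>+y. ennreal (cond_lik F T x y) * b x y \<partial>nu)" if x: "x \<in> inputs" for x
    proof -
      have rxs: "restrict x T \<in> space SXn"
        using x by (auto simp: SXn_def space_PiM space_input_space inputs_def)
      have cm: "(\<lambda>c. ennreal (r (restrict x T, c)) * indicator B (restrict x T, c)) \<in> borel_measurable SYn"
        using measurable_compose[OF measurable_Pair1'[OF rxs] wm] by simp
      have idm: "(\<lambda>y. ennreal (info_density F n (x, y)) * b x y) \<in> borel_measurable SY"
        using measurable_compose[OF measurable_Pair1' measurable_info_density[OF F], of x] bsec[OF x] x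
        by (intro borel_measurable_times_ennreal measurable_compose[OF _ measurable_ennreal]) (auto simp: space_SX)
      have idd: "depends_on T (\<lambda>y. ennreal (info_density F n (x, y)) * b x y)"
      proof (rule depends_onI)
        fix y y' :: "int \<Rightarrow> nat" assume eq: "\<And>i. i \<in> T \<Longrightarrow> y i = y' i"
        have "info_density F n (x, y) = info_density F n (x, y')"
          unfolding info_density_def using eq
          by (intro arg_cong2[where f=divide] cond_lik_cong depends_onD[OF depends_on_dens]) (auto simp: T_def)
        moreover have "b x y = b x y'" using eq by (intro bdep) auto
        ultimately show "ennreal (info_density F n (x, y)) * b x y = ennreal (info_density F n (x, y')) * b x y'" by simp
      qed
      have "(\<integral>\<^sup>+c. ennreal (r (restrict x T, c)) * indicator B (restrict x T, c) \<partial>distr (PL F) SYn ry)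
          = (\<integral>\<^sup>+\<omega>. ennreal (r (restrict x T, ry \<omega>)) * indicator B (restrict x T, ry \<omega>) \<partial>PL F)"
        using cm by (intro nn_integral_distr[OF ryP]) simp
      also have "\<dots> = (\<integral>\<^sup>+\<omega>. ennreal (info_density F n (x, snd \<omega>)) * b x (snd \<omega>) \<partial>PL F)"
      proof (rule nn_integral_cong)
        fix \<omega> :: "(int \<Rightarrow> real) \<times> (int \<Rightarrow> nat)"
        show "ennreal (r (restrict x T, ry \<omega>)) * indicator B (restrict x T, ry \<omega>)
          = ennreal (info_density F n (x, snd \<omega>)) * b x (snd \<omega>)"
          using r_eq[of x "snd \<omega>" "fst \<omega>"] by (simp add: rx_def ry_def b_def)
      qed
      also have "\<dots> = (\<integral>\<^sup>+x'. \<integral>\<^sup>+y. ennreal (info_density F n (x, y)) * b x y \<partial>K x' \<partial>PiM UNIV (iid F))"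
        using nn_integral_process[OF F measurable_compose[OF measurable_snd idm]] by simp
      also have "\<dots> = (\<integral>\<^sup>+y. ennreal (dens (iid F) T y) * (ennreal (info_density F n (x, y)) * b x y) \<partial>nu)"
        by (rule nn_integral_dens[OF l fT idm idd])
      also have "\<dots> = (\<integral>\<^sup>+y. ennreal (cond_lik F T x y) * b x y \<partial>nu)"
      proof (rule nn_integral_cong)
        fix y
        have "ennreal (dens (iid F) T y) * ennreal (info_density F n (x, y)) = ennreal (cond_lik F T x y)"
          using dens_pos[OF l, of T y] cond_lik_pos[OF F x, of n y]
          by (simp add: info_density_def T_def ennreal_mult[symmetric])
        then show "ennreal (dens (iid F) T y) * (ennreal (info_density F n (x, y)) * b x y) = ennreal (cond_lik F T x y) * b x y"
          by (simp add: mult.assoc[symmetric])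
      qed
      finally show ?thesis .
    qed
    have "emeasure (density ?P (\<lambda>p. ennreal (r p))) B = (\<integral>\<^sup>+p. ennreal (r p) * indicator B p \<partial>?P)"
      using rm B sP by (intro emeasure_density) (auto cong: measurable_cong_sets)
    also have "\<dots> = (\<integral>\<^sup>+a. \<integral>\<^sup>+c. ennreal (r (a, c)) * indicator B (a, c) \<partial>distr (PL F) SYn ry \<partial>distr (PL F) SXn rx)"
      using MY.nn_integral_fst[OF wm'] by simp
    also have "\<dots> = (\<integral>\<^sup>+\<omega>. \<integral>\<^sup>+c. ennreal (r (rx \<omega>, c)) * indicator B (rx \<omega>, c) \<partial>distr (PL F) SYn ry \<partial>PL F)"
      using inner_m by (intro nn_integral_distr[OF rxP]) simp
    also have "\<dots> = (\<integral>\<^sup>+x. \<integral>\<^sup>+y. \<integral>\<^sup>+c. ennreal (r (rx (x, y), c)) * indicator B (rx (x, y), c) \<partial>distr (PL F) SYn ry \<partial>K x \<partial>PiM UNIV (iid F))"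
      by (rule nn_integral_process[OF F measurable_compose[OF rxm inner_m]])
    also have "\<dots> = (\<integral>\<^sup>+x. \<integral>\<^sup>+y. ennreal (cond_lik F T x y) * b x y \<partial>nu \<partial>PiM UNIV (iid F))"
    proof (rule nn_integral_cong)
      fix x assume "x \<in> space (PiM UNIV (iid F))"
      then have x: "x \<in> inputs" using space_PX[OF l] by simp
      show "(\<integral>\<^sup>+y. \<integral>\<^sup>+c. ennreal (r (rx (x, y), c)) * indicator B (rx (x, y), c) \<partial>distr (PL F) SYn ry \<partial>K x)
        = (\<integral>\<^sup>+y. ennreal (cond_lik F T x y) * b x y \<partial>nu)"
        using inner[OF x] prob_space.emeasure_space_1[OF prob_K, of x] by (simp add: rx_def)
    qed
    finally show "emeasure (distr (PL F) (SXn \<Otimes>\<^sub>M SYn) (\<lambda>\<omega>. (rx \<omega>, ry \<omega>))) B = emeasure (density ?P (\<lambda>p. ennreal (r p))) B"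
      using lhs by simp
  qed
qed

lemma block_information_eq:
  assumes F: "F \<in> input_laws A"
  shows "block_information dark L h A F n = (\<integral>x. \<integral>y. ln (info_density F n (x, y)) \<partial>K x \<partial>PiM UNIV (iid F))"
proof -
  let ?T = "outs n"
  let ?SX = "\<Pi>\<^sub>M k\<in>?T. input_space A" and ?SY = "\<Pi>\<^sub>M k\<in>?T. count_space (UNIV :: nat set)"
  let ?rx = "\<lambda>\<omega> :: (int \<Rightarrow> real) \<times> (int \<Rightarrow> nat). restrict (fst \<omega>) ?T"
  let ?ry = "\<lambda>\<omega> :: (int \<Rightarrow> real) \<times> (int \<Rightarrow> nat). restrict (snd \<omega>) ?T"
  let ?r = "\<lambda>p. info_density F n (embed ?T (fst p), embed ?T (snd p))"
  let ?P = "distr (PL F) ?SX ?rx \<Otimes>\<^sub>M distr (PL F) ?SY ?ry"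
  interpret P: prob_space "PL F" by (rule process_law_facts[OF F])
  have sPL: "sets (PL F) = sets (SX \<Otimes>\<^sub>M SY)" by (rule process_law_facts[OF F])
  have rxP: "?rx \<in> PL F \<rightarrow>\<^sub>M ?SX" and ryP: "?ry \<in> PL F \<rightarrow>\<^sub>M ?SY"
    using restrict_measurable sPL by (simp_all cong: measurable_cong_sets)
  interpret MX: prob_space "distr (PL F) ?SX ?rx" by (rule P.prob_space_distr[OF rxP])
  interpret MY: prob_space "distr (PL F) ?SY ?ry" by (rule P.prob_space_distr[OF ryP])
  interpret XY: pair_prob_space "distr (PL F) ?SX ?rx" "distr (PL F) ?SY ?ry" ..
  note bd = block_density[OF F, of n]
  have sP: "sets ?P = sets (?SX \<Otimes>\<^sub>M ?SY)" by (intro sets_pair_measure_cong) auto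
  have rm: "?r \<in> borel_measurable ?P" using bd(1) sP by (simp cong: measurable_cong_sets)
  have nn: "AE p in ?P. 0 \<le> ?r p"
  proof (rule AE_I2)
    fix p assume "p \<in> space ?P"
    then have "fst p \<in> space ?SX" by (auto simp: space_pair_measure)
    then have "embed ?T (fst p) \<in> inputs"
      using A by (auto simp: space_PiM space_input_space inputs_def glue_def PiE_iff)
    then show "0 \<le> ?r p"
      using cond_lik_pos[OF F, of "embed ?T (fst p)" n "embed ?T (snd p)"] dens_pos[OF laws_iid[OF F], of ?T "embed ?T (snd p)"]
      by (simp add: info_density_def)
  qed
  have "block_information dark L h A F n
      = KL_divergence (exp 1) ?P (distr (PL F) (?SX \<Otimes>\<^sub>M ?SY) (\<lambda>\<omega>. (?rx \<omega>, ?ry \<omega>)))"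
    unfolding block_information_def P.mutual_information_def outs_def[symmetric] ..
  also have "\<dots> = KL_divergence (exp 1) ?P (density ?P (\<lambda>p. ennreal (?r p)))"
    unfolding bd(2) ..
  also have "\<dots> = (\<integral>p. ?r p * ln (?r p) \<partial>?P)"
    using XY.P.KL_density[OF _ rm nn, of "exp 1"] by (simp add: log_def)
  also have "\<dots> = (\<integral>p. ln (?r p) \<partial>density ?P (\<lambda>p. ennreal (?r p)))"
    using rm nn by (subst integral_density) auto
  also have "\<dots> = (\<integral>p. ln (?r p) \<partial>distr (PL F) (?SX \<Otimes>\<^sub>M ?SY) (\<lambda>\<omega>. (?rx \<omega>, ?ry \<omega>)))"
    unfolding bd(2) ..
  also have "\<dots> = (\<integral>\<omega>. ln (?r (?rx \<omega>, ?ry \<omega>)) \<partial>PL F)"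
    using bd(1) by (intro integral_distr measurable_Pair rxP ryP) auto
  also have "\<dots> = (\<integral>\<omega>. ln (info_density F n \<omega>) \<partial>PL F)"
    using info_density_embed[of F n] by (intro Bochner_Integration.integral_cong refl) (metis fst_conv snd_conv prod.collapse)
  also have "\<dots> = (\<integral>x. \<integral>y. ln (info_density F n (x, y)) \<partial>K x \<partial>PiM UNIV (iid F))"
    using edge_size_nonneg ln_size_nonneg measurable_info_density[OF F]
    by (intro integral_process[OF F _ _ _ _ ln_info_density_bound[OF F]]) auto
  finally show ?thesis .
qed

lemma block_information_close:
  assumes F: "F \<in> input_laws A"
  shows "\<bar>block_information dark L h A F n - info F n\<bar> \<le> edge_size * mgf 2 ^ (L + 1)"
proof -
  note l = laws_iid[OF F]
  let ?T = "outs n"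
  have t: "tame (\<lambda>x. \<integral>y. ln (info_density F n (x, y)) \<partial>K x)"
    and i: "x \<in> inputs \<Longrightarrow> integrable (K x) (\<lambda>y. ln (info_density F n (x, y)))" for x
    using edge_size_nonneg ln_size_nonneg measurable_info_density[OF F]
    by (intro tame_joint_average[OF _ _ _ _ ln_info_density_bound[OF F]]; auto)+
  have close: "\<bar>(\<integral>y. ln (info_density F n (x, y)) \<partial>K x) - score F n x\<bar> \<le> edge_size * mgf 2 ^ (L + 1)"
    if x: "x \<in> inputs" for x
  proof -
    have il: "integrable (K x) (\<lambda>y. ln (lik ?T x y))" by (rule integral_ln_lik[OF x]) simp
    have id: "integrable (K x) (\<lambda>y. ln (dens (iid F) ?T y))"
      using ln_size_nonneg by (intro growth_integral(1)[OF x _ _ _ growth_ln_dens[OF l]]) auto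
    have eq: "ln (info_density F n (x, y)) - (ln (lik ?T x y) - ln (dens (iid F) ?T y))
        = ln (cond_lik F ?T x y) - ln (lik ?T x y)" for y
      using cond_lik_pos[OF F x, of n y] dens_pos[OF l, of ?T y] by (simp add: info_density_def ln_div)
    have ii: "integrable (K x) (\<lambda>y. ln (info_density F n (x, y)) - (ln (lik ?T x y) - ln (dens (iid F) ?T y)))"
      using i[OF x] il id by simp
    have "score F n x = (\<integral>y. ln (lik ?T x y) \<partial>K x) - (\<integral>y. ln (dens (iid F) ?T y) \<partial>K x)"
      unfolding score_def integral_ln_lik(2)[OF x finite_outs] ..
    then have "(\<integral>y. ln (info_density F n (x, y)) \<partial>K x) - score F n x
        = (\<integral>y. ln (cond_lik F ?T x y) - ln (lik ?T x y) \<partial>K x)"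
      unfolding eq[symmetric] using i[OF x] il id by simp
    moreover have "growth (win 1) edge_size 2 (\<lambda>y. ln (cond_lik F ?T x y) - ln (lik ?T x y))"
      using borel_measurable_integrable[OF ii] ln_cond_lik[OF F x, of n] unfolding eq growth_def
      by (simp cong: measurable_cong_sets)
    ultimately show ?thesis
      using growth_integral(2)[OF x finite_win _ edge_size_nonneg] by simp
  qed
  have "block_information dark L h A F n - info F n
      = (\<integral>x. (\<integral>y. ln (info_density F n (x, y)) \<partial>K x) - score F n x \<partial>PiM UNIV (iid F))"
    unfolding block_information_eq[OF F] info_def
    using tame_integrable[OF t l] tame_integrable[OF tame_score[OF F] l] by simp
  also have "\<bar>\<dots>\<bar> \<le> edge_size * mgf 2 ^ (L + 1)"
    by (rule tame_integral_bound[OF tame_diff[OF t tame_score[OF F]] l close])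
  finally show ?thesis .
qed

lemma information_rate_eq:
  assumes F: "F \<in> input_laws A"
  shows "information_rate dark L h A F = rate F"
proof -
  define C where "C = edge_size * mgf 2 ^ (L + 1)"
  have "(\<lambda>n. (block_information dark L h A F n - info F n) / real n) \<longlonglongrightarrow> 0"
  proof (rule Lim_null_comparison)
    show "(\<lambda>n. C / real n) \<longlonglongrightarrow> 0" by (rule lim_const_over_n)
    have "\<bar>block_information dark L h A F n - info F n\<bar> / real n \<le> C / real n" for n
      unfolding C_def by (intro divide_right_mono block_information_close F) simp
    then show "eventually (\<lambda>n. norm ((block_information dark L h A F n - info F n) / real n) \<le> C / real n) sequentially"
      by (simp add: abs_divide)
  qed
  from tendsto_add[OF this info_rate_limit[OF F]]
  have "(\<lambda>n. block_information dark L h A F n / real n) \<longlonglongrightarrow> rate F"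
    by (simp add: add_divide_distrib[symmetric])
  then show ?thesis unfolding information_rate_def by (rule limI)
qed

end

section \<open>Integrals depending holomorphically on a parameter\<close>

text \<open>A local bound on the integrand suffices: Cauchy's estimate converts it into a bound
  \<open>g w / r\<close> on the difference quotients, and dominated convergence gives the complex
  derivative of the integral.\<close>

lemma holomorphic_integral:
  fixes f :: "complex \<Rightarrow> 'a \<Rightarrow> complex"
  assumes S: "open S" and hol: "\<And>w. w \<in> space M \<Longrightarrow> (\<lambda>z. f z w) holomorphic_on S"
    and meas: "\<And>z. z \<in> S \<Longrightarrow> f z \<in> borel_measurable M"
    and dom: "\<And>z0. z0 \<in> S \<Longrightarrow> \<exists>r g. r > 0 \<and> integrable M g \<and>
       (\<forall>z w. z \<in> S \<longrightarrow> dist z0 z < r \<longrightarrow> w \<in> space M \<longrightarrow> norm (f z w) \<le> g w)"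
  shows "(\<lambda>z. \<integral>w. f z w \<partial>M) holomorphic_on S"
proof -
  have "(\<lambda>z. \<integral>w. f z w \<partial>M) field_differentiable (at z0)" if z0: "z0 \<in> S" for z0
  proof -
    obtain r1 g where r1: "r1 > 0" "integrable M g"
      and g: "\<And>z w. z \<in> S \<Longrightarrow> dist z0 z < r1 \<Longrightarrow> w \<in> space M \<Longrightarrow> norm (f z w) \<le> g w"
      using dom[OF z0] by blast
    obtain r2 where r2: "r2 > 0" "ball z0 r2 \<subseteq> S" using S z0 open_contains_ball by blast
    \<comment> \<open>Circles of radius \<open>r\<close> around points within \<open>r\<close> of
      \<open>z0\<close> stay within \<open>2 * r\<close>, inside the region where the domination is
      available.\<close>
    define r where "r = min r1 r2 / 3"
    have r: "r > 0" using r1 r2 by (simp add: r_def)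
    have inS: "z \<in> S \<and> dist z0 z < r1" if "dist z0 z < 3 * r" for z
      using that r2 by (auto simp: r_def subset_iff)
    have bound: "norm (f z w) \<le> g w" if "dist z0 z < 3 * r" "w \<in> space M" for z w
      using g inS that by blast
    have int: "integrable M (f z)" if "dist z0 z < 3 * r" for z
    proof (rule Bochner_Integration.integrable_bound[OF r1(2) meas])
      show "z \<in> S" using inS[OF that] by simp
      show "AE w in M. norm (f z w) \<le> norm (g w)"
      proof (rule AE_I2)
        fix w assume "w \<in> space M"
        from bound[OF \<open>dist z0 z < 3 * r\<close> this] show "norm (f z w) \<le> norm (g w)" by simp
      qed
    qed
    have lip: "norm (f z w - f z0 w) \<le> g w / r * norm (z - z0)" if z: "dist z0 z < r" and w: "w \<in> space M" for z w
    proof (rule field_differentiable_bound[of "ball z0 r" "\<lambda>z. f z w" "deriv (\<lambda>z. f z w)"])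
      fix u assume u: "u \<in> ball z0 r"
      have sub: "dist z0 v < 3 * r" if "dist u v \<le> r" for v
        using u that dist_triangle[of z0 v u] r by simp
      have subS: "cball u r \<subseteq> S" using sub inS by auto
      have h: "(\<lambda>z. f z w) holomorphic_on cball u r" by (rule holomorphic_on_subset[OF hol[OF w] subS])
      have "norm ((deriv ^^ 1) (\<lambda>z. f z w) u) \<le> fact 1 * g w / r ^ 1"
      proof (rule Cauchy_inequality)
        show "(\<lambda>z. f z w) holomorphic_on ball u r" by (rule holomorphic_on_subset[OF h ball_subset_cball])
        show "continuous_on (cball u r) (\<lambda>z. f z w)" by (rule holomorphic_on_imp_continuous_on[OF h])
        show "norm (f v w) \<le> g w" if "norm (u - v) = r" for v
          using that bound[OF sub w, of v] by (simp add: dist_norm)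
      qed (rule r)
      then show "norm (deriv (\<lambda>z. f z w) u) \<le> g w / r" by simp
      have "u \<in> S" using subS r by auto
      then show "((\<lambda>z. f z w) has_field_derivative deriv (\<lambda>z. f z w) u) (at u within ball z0 r)"
        using holomorphic_derivI[OF hol[OF w] S] by (blast intro: has_field_derivative_at_within)
    qed (use z r in auto)
    have der: "((\<lambda>z. f z w) has_field_derivative deriv (\<lambda>z. f z w) z0) (at z0)" if "w \<in> space M" for w
      by (rule holomorphic_derivI[OF hol[OF that] S z0])
    have quot: "((\<lambda>z. (f z w - f z0 w) / (z - z0)) \<longlongrightarrow> deriv (\<lambda>z. f z w) z0) (at z0)" if "w \<in> space M" for w
      using der[OF that] by (simp add: has_field_derivative_iff)
    have "((\<lambda>z. ((\<integral>w. f z w \<partial>M) - (\<integral>w. f z0 w \<partial>M)) / (z - z0)) \<longlongrightarrow> (\<integral>w. deriv (\<lambda>z. f z w) z0 \<partial>M)) (at z0)"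
      unfolding tendsto_at_iff_sequentially
    proof (intro allI impI)
      fix X :: "nat \<Rightarrow> complex" assume X: "\<forall>i. X i \<in> UNIV - {z0}" "X \<longlonglongrightarrow> z0"
      obtain N where N: "\<And>i. i \<ge> N \<Longrightarrow> dist z0 (X i) < r"
        using metric_LIMSEQ_D[OF X(2) r] by (auto simp: dist_commute)
      define Y where "Y i = X (i + N)" for i
      have Y: "Y i \<noteq> z0" "dist z0 (Y i) < r" for i using X(1) N by (auto simp: Y_def)
      have Y3: "dist z0 (Y i) < 3 * r" for i using Y(2)[of i] r by linarith
      have Yl: "filterlim Y (at z0) sequentially"
        using LIMSEQ_ignore_initial_segment[OF X(2), of N] Y(1) by (auto simp: filterlim_at Y_def[abs_def])
      define q where "q i w = (f (Y i) w - f z0 w) / (Y i - z0)" for i w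
      have qm: "q i \<in> borel_measurable M" for i
        unfolding q_def using meas inS[OF Y3[of i]] z0 by (intro borel_measurable_divide borel_measurable_diff borel_measurable_const) auto
      have ql: "(\<lambda>i. q i w) \<longlonglongrightarrow> deriv (\<lambda>z. f z w) z0" if "w \<in> space M" for w
        unfolding q_def by (rule filterlim_compose[OF quot[OF that] Yl])
      have qb: "norm (q i w) \<le> g w / r" if "w \<in> space M" for i w
        using lip[OF Y(2) that, of i] Y(1)[of i] by (simp add: q_def norm_divide divide_le_eq)
      have "(\<lambda>i. \<integral>w. q i w \<partial>M) \<longlonglongrightarrow> (\<integral>w. deriv (\<lambda>z. f z w) z0 \<partial>M)"
      proof (rule integral_dominated_convergence)
        show "(\<lambda>w. deriv (\<lambda>z. f z w) z0) \<in> borel_measurable M"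
          by (rule borel_measurable_LIMSEQ_metric[OF qm ql])
        show "integrable M (\<lambda>w. g w / r)" using r1 by simp
      qed (use qm ql qb in auto)
      moreover have "(\<integral>w. q i w \<partial>M) = ((\<integral>w. f (Y i) w \<partial>M) - (\<integral>w. f z0 w \<partial>M)) / (Y i - z0)" for i
        unfolding q_def using int[OF Y3[of i]] int[of z0] r by simp
      ultimately have "(\<lambda>i. ((\<integral>w. f (X (i + N)) w \<partial>M) - (\<integral>w. f z0 w \<partial>M)) / (X (i + N) - z0)) \<longlonglongrightarrow> (\<integral>w. deriv (\<lambda>z. f z w) z0 \<partial>M)"
        by (simp add: Y_def)
      then show "((\<lambda>z. ((\<integral>w. f z w \<partial>M) - (\<integral>w. f z0 w \<partial>M)) / (z - z0)) \<circ> X) \<longlonglongrightarrow> (\<integral>w. deriv (\<lambda>z. f z w) z0 \<partial>M)"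
        unfolding comp_def by (rule LIMSEQ_offset)
    qed
    then show ?thesis unfolding field_differentiable_def has_field_derivative_iff by blast
  qed
  then show ?thesis using S by (simp add: holomorphic_on_def field_differentiable_at_within)
qed

text \<open>The bound has to persist as \<open>t\<close> tends to zero, because complex intensities
  may approach zero near the boundary of the half plane.\<close>

lemma mult_ln_bound: "t > 0 \<Longrightarrow> \<bar>t * ln t\<bar> \<le> 1 + t\<^sup>2" for t :: real
proof -
  assume t: "t > 0"
  show ?thesis
  proof (cases "t \<ge> 1")
    case True
    then have "0 \<le> ln t" "ln t \<le> t" using ln_le_minus_one[OF t] by auto
    then have "t * ln t \<le> t * t" "0 \<le> t * ln t" using t by (auto intro: mult_left_mono)
    then show ?thesis by (simp add: power2_eq_square)
  next
    case False
    have "ln (1 / t) \<le> 1 / t - 1" using t by (intro ln_le_minus_one) auto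
    then have "t * ln (1 / t) \<le> t * (1 / t - 1)" using t by (intro mult_left_mono) auto
    then have "- (t * ln t) \<le> 1 - t" using t by (simp add: ln_div right_diff_distrib)
    moreover have "t * ln t \<le> 0" using t False by (intro mult_nonneg_nonpos) auto
    ultimately have "\<bar>t * ln t\<bar> \<le> 1" using t by linarith
    then show ?thesis using zero_le_power2[of t] by linarith
  qed
qed

context poisson_channel
begin

subsection \<open>Complex input values\<close>

text \<open>The intensity when input \<open>j\<close> takes the complex value \<open>z\<close>,
  through the affine formula of \<open>Z_upd\<close>.\<close>

definition cZ :: "int \<Rightarrow> (int \<Rightarrow> real) \<Rightarrow> complex \<Rightarrow> int \<Rightarrow> complex" where
  "cZ j x z k = complex_of_real (Z (x(j := 0)) k) + complex_of_real (tap (k - j)) * z"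

definition clik :: "int set \<Rightarrow> int \<Rightarrow> (int \<Rightarrow> real) \<Rightarrow> complex \<Rightarrow> (int \<Rightarrow> nat) \<Rightarrow> complex" where
  "clik T j x z y = (\<Prod>k\<in>T. exp (1 - cZ j x z k) * cZ j x z k ^ y k)"

definition ceta :: "complex \<Rightarrow> complex" where "ceta w = 1 - w + w * Ln w"

definition domain :: "complex set" where "domain = {z. Re z > - dark / max_tap L h}"

lemma cZ_of_real: "cZ j x (complex_of_real t) k = complex_of_real (Z (x(j := t)) k)"
  by (simp add: cZ_def Z_upd[of x j t])

lemma clik_of_real: "clik T j x (complex_of_real t) y = complex_of_real (lik T (x(j := t)) y)"
  by (simp add: clik_def lik_def cZ_of_real exp_of_real[symmetric])

lemma ceta_of_real: "u > 0 \<Longrightarrow> ceta (complex_of_real u) = complex_of_real (eta u)"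
  by (simp add: ceta_def eta_def Ln_of_real)

lemma max_tap_props: "max_tap L h > 0" "l \<le> L \<Longrightarrow> h l \<le> max_tap L h"
proof -
  have fin: "finite {h r | r. r \<le> L \<and> h r > 0}" by simp
  obtain l0 where l0: "l0 \<le> L" "h l0 > 0"
  proof (rule ccontr)
    assume "\<not> thesis"
    then have "(\<Sum>l\<le>L. h l) \<le> 0" using that by (intro sum_nonpos) (meson atMost_iff not_le)
    then show False using h_sum by simp
  qed
  then have "h l0 \<le> max_tap L h" unfolding max_tap_def using fin by (intro Max_ge) auto
  then show pos: "max_tap L h > 0" using l0 by simp
  show "h l \<le> max_tap L h" if "l \<le> L"
  proof (cases "h l > 0")
    case True
    then show ?thesis unfolding max_tap_def using fin that by (intro Max_ge) auto
  qed (use pos in simp)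
qed

lemma open_domain: "open domain"
  unfolding domain_def by (rule open_halfspace_Re_gt)

lemma real_in_domain: "0 \<le> t \<Longrightarrow> complex_of_real t \<in> domain"
  using max_tap_props(1) dark by (auto simp: domain_def intro: order.strict_trans2[of _ 0] divide_neg_pos)

text \<open>No tap exceeds \<open>max_tap L h\<close>, so input \<open>j\<close> contributes a real
  part above \<open>- dark\<close>, and the remaining terms are at least \<open>dark\<close>. Thus
  intensities avoid the cut of \<open>Ln\<close>.\<close>

lemma cZ_Re_pos:
  assumes x: "x \<in> inputs" and z: "z \<in> domain"
  shows "Re (cZ j x z k) > 0"
proof -
  have "tap (k - j) \<le> max_tap L h" using max_tap_props by (auto simp: tap_def less_imp_le)
  have "- dark < tap (k - j) * Re z"
  proof (cases "Re z \<ge> 0")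
    case True
    then have "0 \<le> tap (k - j) * Re z" using tap_nonneg by simp
    then show ?thesis using dark by linarith
  next
    case False
    then have "max_tap L h * Re z \<le> tap (k - j) * Re z" using \<open>tap (k - j) \<le> max_tap L h\<close> by (intro mult_right_mono_neg) auto
    moreover have "- dark < max_tap L h * Re z" using z max_tap_props(1) by (simp add: domain_def field_simps)
    ultimately show ?thesis by linarith
  qed
  then show ?thesis using Z_lower[OF inputs_upd[OF x order_refl A], of j k] by (simp add: cZ_def)
qed

lemma cZ_norm:
  assumes x: "x \<in> inputs" and z: "norm z \<le> R"
  shows "norm (cZ j x z k) \<le> Z (x(j := 0)) k + R"
proof -
  have "norm (complex_of_real (tap (k - j)) * z) \<le> 1 * R"
    unfolding norm_mult using tap_le_1 tap_nonneg z by (intro mult_mono) auto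
  then show ?thesis
    unfolding cZ_def using Z_pos[OF inputs_upd[OF x order_refl A], of j k]
    by (intro order_trans[OF norm_triangle_ineq]) simp
qed

lemma ceta_bound:
  assumes x: "x \<in> inputs" and z: "z \<in> domain" "norm z \<le> R"
  shows "norm (ceta (cZ j x z k)) \<le> 2 + 5 * (peak + R) + (peak + R)\<^sup>2"
proof -
  let ?w = "cZ j x z k" and ?m = "peak + R"
  have re: "Re ?w > 0" by (rule cZ_Re_pos[OF x z(1)])
  then have w0: "?w \<noteq> 0" by auto
  have m: "norm ?w \<le> ?m"
    using cZ_norm[OF x z(2), of j k] Z_upper[OF inputs_upd[OF x order_refl A], of j k] by linarith
  have "norm (Ln ?w) \<le> \<bar>Re (Ln ?w)\<bar> + \<bar>Im (Ln ?w)\<bar>" by (rule cmod_le)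
  also have "\<dots> \<le> \<bar>ln (norm ?w)\<bar> + pi"
    using w0 mpi_less_Im_Ln[OF w0] Im_Ln_le_pi[OF w0] by simp
  finally have "norm (?w * Ln ?w) \<le> norm ?w * (\<bar>ln (norm ?w)\<bar> + pi)"
    unfolding norm_mult by (intro mult_left_mono) auto
  also have "\<dots> = \<bar>norm ?w * ln (norm ?w)\<bar> + norm ?w * pi" by (simp add: abs_mult distrib_left)
  also have "\<dots> \<le> (1 + (norm ?w)\<^sup>2) + norm ?w * 4"
    using mult_ln_bound[of "norm ?w"] w0 pi_less_4 by (intro add_mono mult_left_mono) auto
  also have "\<dots> \<le> (1 + ?m\<^sup>2) + ?m * 4"
    using m by (intro add_mono mult_right_mono power_mono) auto
  finally have 1: "norm (?w * Ln ?w) \<le> (1 + ?m\<^sup>2) + ?m * 4" .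
  have "norm (1 - ?w) \<le> 1 + ?m" using m norm_triangle_ineq4[of 1 ?w] by simp
  then have "norm (ceta ?w) \<le> (1 + ?m) + ((1 + ?m\<^sup>2) + ?m * 4)"
    unfolding ceta_def using 1 by (intro order_trans[OF norm_triangle_ineq] add_mono) auto
  then show ?thesis by simp
qed

text \<open>The factor by which a complex value of modulus at most \<open>R\<close> can enlarge an
  intensity, relative to the value zero, where it is at least \<open>dark\<close>.\<close>

definition cratio :: "real \<Rightarrow> real" where "cratio R = 1 + R / dark"

lemma cratio_ge_1: "R \<ge> 0 \<Longrightarrow> cratio R \<ge> 1"
  using dark by (simp add: cratio_def)

lemma clik_norm_window:
  assumes x: "x \<in> inputs" and z: "norm z \<le> R" and T: "finite T"
  shows "norm (clik T j x z y) \<le> exp R ^ (L + 1) * cratio R ^ (\<Sum>k\<in>win j. y k) * lik T (x(j := 0)) y"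
proof -
  have R: "R \<ge> 0" using norm_ge_zero z by (rule order_trans)
  note x0 = inputs_upd[OF x order_refl A, of j]
  have "norm (clik T j x z y) = (\<Prod>k\<in>T. norm (exp (1 - cZ j x z k) * cZ j x z k ^ y k))"
    by (simp add: clik_def prod_norm)
  also have "\<dots> \<le> exp R ^ (L + 1) * cratio R ^ (\<Sum>k\<in>win j. y k) * lik T (x(j := 0)) y"
    unfolding lik_def
  proof (rule prod_window_le[OF T cratio_ge_1[OF R]])
    fix k
    show "0 \<le> exp (1 - Z (x(j := 0)) k) * Z (x(j := 0)) k ^ y k" using Z_pos[OF x0] by (simp add: less_imp_le)
    show "norm (exp (1 - cZ j x z k) * cZ j x z k ^ y k)
        = exp (1 - Z (x(j := 0)) k) * Z (x(j := 0)) k ^ y k" if "k \<notin> win j"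
    proof -
      have "tap (k - j) = 0" using that by (auto simp: tap_def win_def)
      then show ?thesis using Z_pos[OF x0, of k] by (simp add: cZ_def norm_mult norm_power)
    qed
    have "\<bar>tap (k - j) * Re z\<bar> \<le> 1 * R"
      unfolding abs_mult using tap_le_1 tap_nonneg abs_Re_le_cmod[of z] z by (intro mult_mono) auto
    then have "norm (exp (1 - cZ j x z k)) \<le> exp R * exp (1 - Z (x(j := 0)) k)"
      by (simp add: cZ_def exp_add[symmetric])
    moreover have "norm (cZ j x z k ^ y k) \<le> cratio R ^ y k * Z (x(j := 0)) k ^ y k"
    proof -
      have "R \<le> R / dark * Z (x(j := 0)) k"
        using mult_left_mono[OF Z_lower[OF x0, of k], of "R / dark"] R dark by simp
      then have "norm (cZ j x z k) \<le> cratio R * Z (x(j := 0)) k"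
        using cZ_norm[OF x z, of j k] by (simp add: cratio_def distrib_right)
      then show ?thesis unfolding norm_power power_mult_distrib[symmetric] by (intro power_mono) auto
    qed
    ultimately have "norm (exp (1 - cZ j x z k)) * norm (cZ j x z k ^ y k)
        \<le> (exp R * exp (1 - Z (x(j := 0)) k)) * (cratio R ^ y k * Z (x(j := 0)) k ^ y k)"
      by (intro mult_mono) auto
    then show "norm (exp (1 - cZ j x z k) * cZ j x z k ^ y k)
        \<le> exp R * cratio R ^ y k * (exp (1 - Z (x(j := 0)) k) * Z (x(j := 0)) k ^ y k)"
      by (simp add: norm_mult ac_simps)
  qed (use R in auto)
  finally show ?thesis .
qed

text \<open>In the base, 2 comes from the growth of \<open>ln_jump\<close> and
  \<open>cratio R\<close> from the complex likelihood.\<close>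

definition local_weight :: "int set \<Rightarrow> int \<Rightarrow> real \<Rightarrow> (int \<Rightarrow> nat) \<Rightarrow> real" where
  "local_weight T j R y = log_size * exp R ^ (L + 1) * (2 * cratio R) ^ (\<Sum>k\<in>win j. embed T y k)"

lemma local_weight_props:
  assumes "R \<ge> 0" "finite T"
  shows "growth (win j) (log_size * exp R ^ (L + 1)) (2 * cratio R) (local_weight T j R)"
    and "depends_on T (local_weight T j R)" and "0 \<le> local_weight T j R y"
proof -
  have q: "1 \<le> 2 * cratio R" using cratio_ge_1[OF assms(1)] by simp
  have em: "embed T \<in> SY \<rightarrow>\<^sub>M SY"
    by (rule measurable_PiM_single') (auto simp: glue_def space_PiM)
  show "0 \<le> local_weight T j R y" for y using q log_size_nonneg by (simp add: local_weight_def)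
  show "growth (win j) (log_size * exp R ^ (L + 1)) (2 * cratio R) (local_weight T j R)"
    unfolding growth_def
  proof (intro conjI allI)
    have "(\<lambda>y. (2 * cratio R) ^ (\<Sum>k\<in>win j. embed T y k)) \<in> borel_measurable SY"
      by (rule measurable_compose[OF em measurable_growth_weight]) simp
    then show "local_weight T j R \<in> borel_measurable SY"
      unfolding local_weight_def by (intro borel_measurable_times borel_measurable_const)
    fix y :: "int \<Rightarrow> nat"
    have "(\<Sum>k\<in>win j. embed T y k) \<le> (\<Sum>k\<in>win j. y k)" by (rule sum_mono) (simp add: glue_def)
    then have "(2 * cratio R) ^ (\<Sum>k\<in>win j. embed T y k) \<le> (2 * cratio R) ^ (\<Sum>k\<in>win j. y k)"
      using q by (intro power_increasing) auto
    then show "\<bar>local_weight T j R y\<bar> \<le> log_size * exp R ^ (L + 1) * (2 * cratio R) ^ (\<Sum>k\<in>win j. y k)"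
      using q log_size_nonneg by (simp add: local_weight_def mult_left_mono)
  qed
  show "depends_on T (local_weight T j R)"
  proof (rule depends_onI)
    fix y y' :: "int \<Rightarrow> nat" assume "\<And>i. i \<in> T \<Longrightarrow> y i = y' i"
    then have "embed T y = embed T y'" by (auto simp: glue_def)
    then show "local_weight T j R y = local_weight T j R y'" by (simp add: local_weight_def)
  qed
qed

text \<open>The output weight is evaluated at \<open>embed T y\<close> because outputs outside the block \<open>T\<close> are distributed
  as \<^term>\<open>nu\<close> under the density \<^term>\<open>lik T x\<close>.\<close>

lemma jump_clik_bound:
  assumes \<sigma>: "laws \<sigma>" and x: "x \<in> inputs" and z: "norm z \<le> R" and T: "finite T"
  shows "norm (complex_of_real (ln_jump \<sigma> T j y) * clik T j x z y) \<le> local_weight T j R y * lik T (x(j := 0)) y"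
proof -
  let ?y = "embed T y"
  have R: "R \<ge> 0" using norm_ge_zero z by (rule order_trans)
  have "clr j ?y k = clr j y k" if "k \<in> T" for k using that by (simp add: clr_def glue_def)
  then have 1: "ln_jump \<sigma> T j y = ln_jump \<sigma> T j ?y"
    unfolding ln_jump_def
    by (intro arg_cong2[where f=minus] arg_cong[where f=ln] depends_onD[OF depends_on_dens]) (auto simp: glue_def)
  have 2: "clik T j x z y = clik T j x z ?y" by (simp add: clik_def glue_def)
  have 3: "lik T (x(j := 0)) y = lik T (x(j := 0)) ?y" by (rule depends_onD[OF depends_on_lik]) (simp add: glue_def)
  have "\<bar>ln_jump \<sigma> T j ?y\<bar> \<le> log_size * 2 ^ (\<Sum>k\<in>win j. ?y k)"
    using growth_ln_jump[OF \<sigma> T, of j] by (simp add: growth_def)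
  then have "\<bar>ln_jump \<sigma> T j ?y\<bar> * norm (clik T j x z ?y)
      \<le> (log_size * 2 ^ (\<Sum>k\<in>win j. ?y k)) * (exp R ^ (L + 1) * cratio R ^ (\<Sum>k\<in>win j. ?y k) * lik T (x(j := 0)) ?y)"
    using log_size_nonneg by (intro mult_mono clik_norm_window[OF x z T]) auto
  also have "\<dots> = local_weight T j R y * lik T (x(j := 0)) ?y"
    by (simp add: local_weight_def power_mult_distrib)
  finally show ?thesis unfolding 1 2 3 by (simp add: norm_mult)
qed

text \<open>Complex form of the terms of \<open>score_diff\<close>. The \<open>eta\<close> terms
  outside the window do not involve \<open>z\<close> and are left out. The channel is replaced by
  its density against the fixed measure \<open>nu\<close>, so that \<open>z\<close> occurs only in
  the integrand.\<close>

definition site_integrand :: "real measure \<Rightarrow> nat \<Rightarrow> int \<Rightarrow> complex \<Rightarrow> (int \<Rightarrow> real) \<times> (int \<Rightarrow> nat) \<Rightarrow> complex" where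
  "site_integrand F n j z p = (\<Sum>k\<in>outs n \<inter> win j. ceta (cZ j (fst p) z k))
     - complex_of_real (ln_jump (iid F) (outs n) j (snd p)) * clik (outs n) j (fst p) z (snd p)"

definition site_fun :: "real measure \<Rightarrow> nat \<Rightarrow> int \<Rightarrow> complex \<Rightarrow> complex" where
  "site_fun F n j z = (\<integral>p. site_integrand F n j z p \<partial>(PiM UNIV (iid F) \<Otimes>\<^sub>M nu))"

text \<open>Dominates the integrand for all \<open>z\<close> of the domain with modulus at most
  \<open>R\<close>. Its second term carries a real likelihood, so its integral is a mean over the
  actual channel and is bounded independently of \<open>n\<close> and \<open>j\<close>.\<close>

definition site_dom :: "nat \<Rightarrow> int \<Rightarrow> real \<Rightarrow> (int \<Rightarrow> real) \<times> (int \<Rightarrow> nat) \<Rightarrow> real" where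
  "site_dom n j R p = real (L + 1) * (2 + 5 * (peak + R) + (peak + R)\<^sup>2)
     + local_weight (outs n) j R (snd p) * lik (outs n) ((fst p)(j := 0)) (snd p)"

definition site_bound :: "real \<Rightarrow> real" where
  "site_bound R = real (L + 1) * (2 + 5 * (peak + R) + (peak + R)\<^sup>2)
     + log_size * exp R ^ (L + 1) * mgf (2 * cratio R) ^ (L + 1)"

lemma site_integrand_bound:
  assumes F: "F \<in> input_laws A" and x: "x \<in> inputs" and z: "z \<in> domain" "norm z \<le> R"
  shows "norm (site_integrand F n j z (x, y)) \<le> site_dom n j R (x, y)"
proof -
  let ?c = "2 + 5 * (peak + R) + (peak + R)\<^sup>2"
  have R: "R \<ge> 0" using norm_ge_zero z(2) by (rule order_trans)
  have c: "?c \<ge> 0" using R peak_pos by simp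
  have "norm (\<Sum>k\<in>outs n \<inter> win j. ceta (cZ j x z k)) \<le> (\<Sum>k\<in>outs n \<inter> win j. ?c)"
    by (intro order_trans[OF norm_sum] sum_mono ceta_bound[OF x z])
  also have "\<dots> \<le> (\<Sum>k\<in>win j. ?c)" using c by (intro sum_mono2) auto
  also have "\<dots> = real (L + 1) * ?c" by simp
  finally have 1: "norm (\<Sum>k\<in>outs n \<inter> win j. ceta (cZ j x z k)) \<le> real (L + 1) * ?c" .
  show ?thesis
    unfolding site_integrand_def site_dom_def fst_conv snd_conv
    by (rule order_trans[OF norm_triangle_ineq4])
      (rule add_mono[OF 1 jump_clik_bound[OF laws_iid[OF F] x z(2) finite_outs]])
qed

lemma measurable_Z_zero [measurable]: "(\<lambda>x. Z (x(j := 0)) k) \<in> borel_measurable SX"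
proof -
  have "Z (x(j := 0)) k = Z x k - tap (k - j) * x j" for x using Z_upd[of x j "x j" k] by simp
  then show ?thesis by simp
qed

lemma sets_PX_nu: "laws \<sigma> \<Longrightarrow> sets (PiM UNIV \<sigma> \<Otimes>\<^sub>M nu) = sets (SX \<Otimes>\<^sub>M SY)"
  using sets_PX by (intro sets_pair_measure_cong) auto

lemma measurable_lik_zero: "(\<lambda>p. lik T ((fst p)(j := 0)) (snd p)) \<in> borel_measurable (SX \<Otimes>\<^sub>M SY)"
  unfolding lik_def by (intro borel_measurable_prod borel_measurable_times measurable_power_nat) measurable

lemma measurable_site_integrand:
  assumes F: "F \<in> input_laws A"
  shows "site_integrand F n j z \<in> borel_measurable (SX \<Otimes>\<^sub>M SY)"
proof -
  have cz [measurable]: "(\<lambda>x. cZ j x z k) \<in> borel_measurable SX" for k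
    unfolding cZ_def by measurable
  have 1: "(\<lambda>p. ceta (cZ j (fst p) z k)) \<in> borel_measurable (SX \<Otimes>\<^sub>M SY)" for k
    unfolding ceta_def by measurable
  have 2: "(\<lambda>p. clik (outs n) j (fst p) z (snd p)) \<in> borel_measurable (SX \<Otimes>\<^sub>M SY)"
    unfolding clik_def by (intro borel_measurable_prod borel_measurable_times measurable_power_nat) measurable
  have "ln_jump (iid F) (outs n) j \<in> borel_measurable SY"
    using growth_ln_jump[OF laws_iid[OF F] finite_outs] by (simp add: growth_def)
  then have 3: "(\<lambda>p. complex_of_real (ln_jump (iid F) (outs n) j (snd p))) \<in> borel_measurable (SX \<Otimes>\<^sub>M SY)"
    by (intro measurable_compose[OF measurable_snd] measurable_compose[OF _ borel_measurable_of_real]) auto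
  show ?thesis unfolding site_integrand_def
    by (intro borel_measurable_diff borel_measurable_sum borel_measurable_times 1 2 3)
qed

lemma integrable_product_lik:
  assumes \<sigma>: "laws \<sigma>" and T: "finite T" and S: "finite S" "r \<ge> 1" "c \<ge> 0"
    and g: "growth S c r \<phi>" and d: "depends_on T \<phi>" and t: "0 \<le> t" "t \<le> A"
    and m: "(\<lambda>p. lik T ((fst p)(j := t)) (snd p)) \<in> borel_measurable (SX \<Otimes>\<^sub>M SY)"
  shows "integrable (PiM UNIV \<sigma> \<Otimes>\<^sub>M nu) (\<lambda>p. \<phi> (snd p) * lik T ((fst p)(j := t)) (snd p))"
    and "(\<integral>p. \<phi> (snd p) * lik T ((fst p)(j := t)) (snd p) \<partial>(PiM UNIV \<sigma> \<Otimes>\<^sub>M nu))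
      = (\<integral>x. \<integral>y. \<phi> y \<partial>K (x(j := t)) \<partial>PiM UNIV \<sigma>)"
proof -
  interpret X: prob_space "PiM UNIV \<sigma>" by (rule prob_PX[OF \<sigma>])
  interpret Y: prob_space nu by (rule prob_nu)
  interpret pair_sigma_finite "PiM UNIV \<sigma>" nu ..
  have \<phi>m: "\<phi> \<in> borel_measurable SY" using g by (simp add: growth_def)
  have ga: "growth S c r (\<lambda>y. \<bar>\<phi> y\<bar>)" using g by (auto simp: growth_def)
  have da: "depends_on T (\<lambda>y. \<bar>\<phi> y\<bar>)" by (rule depends_on_comp[where f=abs, OF d])
  have "(\<lambda>p. \<phi> (snd p) * lik T ((fst p)(j := t)) (snd p)) \<in> borel_measurable (SX \<Otimes>\<^sub>M SY)"
    by (intro borel_measurable_times m measurable_compose[OF measurable_snd \<phi>m])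
  then have mm: "(\<lambda>p. \<phi> (snd p) * lik T ((fst p)(j := t)) (snd p)) \<in> borel_measurable (PiM UNIV \<sigma> \<Otimes>\<^sub>M nu)"
    by (simp add: measurable_cong_sets[OF sets_PX_nu[OF \<sigma>] refl])
  show i: "integrable (PiM UNIV \<sigma> \<Otimes>\<^sub>M nu) (\<lambda>p. \<phi> (snd p) * lik T ((fst p)(j := t)) (snd p))"
  proof (rule Fubini_integrable[OF mm])
    have eq: "(\<integral>y. norm (\<phi> (snd (x, y)) * lik T ((fst (x, y))(j := t)) (snd (x, y))) \<partial>nu) = (\<integral>y. \<bar>\<phi> y\<bar> \<partial>K (x(j := t)))"
      if "x \<in> inputs" for x
      using integral_K_lik(1)[OF inputs_upd[OF that t] T _ da] lik_pos[OF inputs_upd[OF that t], of T] \<phi>m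
      by (simp add: abs_mult abs_of_pos mult.commute)
    have "integrable (PiM UNIV \<sigma>) (\<lambda>x. \<integral>y. \<bar>\<phi> y\<bar> \<partial>K (x(j := t)))"
      by (rule tame_integrable[OF tame_upd[OF tame_output_average[OF ga S] t] \<sigma>])
    then show "integrable (PiM UNIV \<sigma>) (\<lambda>x. \<integral>y. norm (\<phi> (snd (x, y)) * lik T ((fst (x, y))(j := t)) (snd (x, y))) \<partial>nu)"
      by (rule Bochner_Integration.integrable_cong[OF refl, THEN iffD2, rotated]) (simp only: space_PX[OF \<sigma>] eq)
    show "AE x in PiM UNIV \<sigma>. integrable nu (\<lambda>y. \<phi> (snd (x, y)) * lik T ((fst (x, y))(j := t)) (snd (x, y)))"
    proof (rule AE_I2)
      fix x assume "x \<in> space (PiM UNIV \<sigma>)"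
      then have x: "x \<in> inputs" using space_PX[OF \<sigma>] by simp
      show "integrable nu (\<lambda>y. \<phi> (snd (x, y)) * lik T ((fst (x, y))(j := t)) (snd (x, y)))"
        using integral_K_lik(2)[OF inputs_upd[OF x t] T \<phi>m d] growth_integral(1)[OF inputs_upd[OF x t] S g]
        by (simp add: mult.commute)
    qed
  qed
  have "(\<integral>p. \<phi> (snd p) * lik T ((fst p)(j := t)) (snd p) \<partial>(PiM UNIV \<sigma> \<Otimes>\<^sub>M nu))
      = (\<integral>x. \<integral>y. \<phi> y * lik T (x(j := t)) y \<partial>nu \<partial>PiM UNIV \<sigma>)"
    using integral_fst'[OF i] by simp
  also have "\<dots> = (\<integral>x. \<integral>y. \<phi> y \<partial>K (x(j := t)) \<partial>PiM UNIV \<sigma>)"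
    using space_PX[OF \<sigma>] inputs_upd[OF _ t]
    by (intro Bochner_Integration.integral_cong[OF refl]) (simp add: integral_K_lik(1)[OF _ T \<phi>m d] mult.commute)
  finally show "(\<integral>p. \<phi> (snd p) * lik T ((fst p)(j := t)) (snd p) \<partial>(PiM UNIV \<sigma> \<Otimes>\<^sub>M nu))
      = (\<integral>x. \<integral>y. \<phi> y \<partial>K (x(j := t)) \<partial>PiM UNIV \<sigma>)" .
qed

lemma site_dom_integral:
  assumes F: "F \<in> input_laws A" and R: "R \<ge> 0"
  shows "integrable (PiM UNIV (iid F) \<Otimes>\<^sub>M nu) (site_dom n j R)"
    and "(\<integral>p. site_dom n j R p \<partial>(PiM UNIV (iid F) \<Otimes>\<^sub>M nu)) \<le> site_bound R"
proof -
  note l = laws_iid[OF F]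
  interpret X: prob_space "PiM UNIV (iid F)" by (rule prob_PX[OF l])
  interpret Y: prob_space nu by (rule prob_nu)
  interpret XY: pair_prob_space "PiM UNIV (iid F)" nu ..
  note w = local_weight_props(1,2)[OF R finite_outs[of n], of j]
  have q: "2 * cratio R \<ge> 1" "0 \<le> log_size * exp R ^ (L + 1)"
    using cratio_ge_1[OF R] log_size_nonneg by auto
  note i = integrable_product_lik[OF l finite_outs finite_win q w order_refl A measurable_lik_zero]
  show "integrable (PiM UNIV (iid F) \<Otimes>\<^sub>M nu) (site_dom n j R)"
    unfolding site_dom_def using i(1) by (intro Bochner_Integration.integrable_add) auto
  have "(\<integral>x. \<integral>y. local_weight (outs n) j R y \<partial>K (x(j := 0)) \<partial>PiM UNIV (iid F)) \<le> log_size * exp R ^ (L + 1) * mgf (2 * cratio R) ^ (L + 1)"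
  proof -
    have "\<bar>\<integral>x. \<integral>y. local_weight (outs n) j R y \<partial>K (x(j := 0)) \<partial>PiM UNIV (iid F)\<bar> \<le> log_size * exp R ^ (L + 1) * mgf (2 * cratio R) ^ card (win j)"
    proof (rule tame_integral_bound[OF tame_upd[OF tame_output_average[OF w(1) finite_win q] order_refl A] l])
      fix x assume "x \<in> inputs"
      then show "\<bar>\<integral>y. local_weight (outs n) j R y \<partial>K (x(j := 0))\<bar> \<le> log_size * exp R ^ (L + 1) * mgf (2 * cratio R) ^ card (win j)"
        by (intro growth_integral(2)[OF inputs_upd[OF _ order_refl A] finite_win q w(1)])
    qed
    then show ?thesis unfolding card_win by linarith
  qed
  then show "(\<integral>p. site_dom n j R p \<partial>(PiM UNIV (iid F) \<Otimes>\<^sub>M nu)) \<le> site_bound R"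
    unfolding site_dom_def site_bound_def using i XY.P.prob_space by simp
qed

lemma site_fun_bound:
  assumes F: "F \<in> input_laws A" and z: "z \<in> domain" "norm z \<le> R"
  shows "norm (site_fun F n j z) \<le> site_bound R"
proof -
  note l = laws_iid[OF F]
  have R: "R \<ge> 0" using norm_ge_zero z(2) by (rule order_trans)
  have b: "norm (site_integrand F n j z p) \<le> site_dom n j R p" if "p \<in> space (PiM UNIV (iid F) \<Otimes>\<^sub>M nu)" for p
    using site_integrand_bound[OF F _ z, of "fst p" n j "snd p"] that space_PX[OF l] by (auto simp: space_pair_measure)
  have "norm (site_fun F n j z) \<le> (\<integral>p. norm (site_integrand F n j z p) \<partial>(PiM UNIV (iid F) \<Otimes>\<^sub>M nu))"
    unfolding site_fun_def by (rule integral_norm_bound)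
  also have "\<dots> \<le> (\<integral>p. site_dom n j R p \<partial>(PiM UNIV (iid F) \<Otimes>\<^sub>M nu))"
  proof (rule integral_mono)
    show "integrable (PiM UNIV (iid F) \<Otimes>\<^sub>M nu) (\<lambda>p. norm (site_integrand F n j z p))"
    proof (rule Bochner_Integration.integrable_bound[OF site_dom_integral(1)[OF F R, of n j]])
      show "(\<lambda>p. norm (site_integrand F n j z p)) \<in> borel_measurable (PiM UNIV (iid F) \<Otimes>\<^sub>M nu)"
        using measurable_site_integrand[OF F, of n j z]
        by (simp add: measurable_cong_sets[OF sets_PX_nu[OF l] refl])
    qed (use b in \<open>force intro!: AE_I2\<close>)
  qed (use b site_dom_integral(1)[OF F R] in auto)
  also have "\<dots> \<le> site_bound R" by (rule site_dom_integral(2)[OF F R])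
  finally show ?thesis .
qed


lemma site_fun_holomorphic:
  assumes F: "F \<in> input_laws A"
  shows "site_fun F n j holomorphic_on domain"
  unfolding site_fun_def
proof (rule holomorphic_integral[OF open_domain])
  note l = laws_iid[OF F]
  show "site_integrand F n j z \<in> borel_measurable (PiM UNIV (iid F) \<Otimes>\<^sub>M nu)" for z
    unfolding measurable_cong_sets[OF sets_PX_nu[OF l] refl] by (rule measurable_site_integrand[OF F])
  show "(\<lambda>z. site_integrand F n j z p) holomorphic_on domain" if "p \<in> space (PiM UNIV (iid F) \<Otimes>\<^sub>M nu)" for p
  proof -
    have x: "fst p \<in> inputs" using that unfolding space_pair_measure space_PX[OF l] by (simp add: mem_Times_iff)
    have ln: "(\<lambda>z. Ln (cZ j (fst p) z k)) holomorphic_on domain" for k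
    proof -
      have "cZ j (fst p) z k \<notin> \<real>\<^sub>\<le>\<^sub>0" if "z \<in> domain" for z
        using cZ_Re_pos[OF x that, of j k] by (auto simp: complex_nonpos_Reals_iff)
      then show ?thesis unfolding cZ_def by (intro holomorphic_intros) auto
    qed
    show ?thesis
      unfolding site_integrand_def ceta_def clik_def
      by (intro holomorphic_intros ln) (auto simp: cZ_def intro!: holomorphic_intros)
  qed
  show "\<exists>r g. r > 0 \<and> integrable (PiM UNIV (iid F) \<Otimes>\<^sub>M nu) g \<and>
       (\<forall>z w. z \<in> domain \<longrightarrow> dist z0 z < r \<longrightarrow> w \<in> space (PiM UNIV (iid F) \<Otimes>\<^sub>M nu) \<longrightarrow> norm (site_integrand F n j z w) \<le> g w)" for z0
  proof (intro exI conjI allI impI)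
    show "(1::real) > 0" by simp
    show "integrable (PiM UNIV (iid F) \<Otimes>\<^sub>M nu) (site_dom n j (norm z0 + 1))"
      by (rule site_dom_integral(1)[OF F]) simp
    fix z w assume z: "z \<in> domain" "dist z0 z < 1" and w: "w \<in> space (PiM UNIV (iid F) \<Otimes>\<^sub>M nu)"
    have "norm z \<le> norm z0 + 1" using z(2) norm_triangle_sub[of z z0] by (simp add: dist_norm norm_minus_commute)
    then show "norm (site_integrand F n j z w) \<le> site_dom n j (norm z0 + 1) w"
      using site_integrand_bound[OF F _ z(1), of "fst w" "norm z0 + 1" n j "snd w"] w space_PX[OF l]
      by (auto simp: space_pair_measure)
  qed
qed

text \<open>Only differences match the score: the omitted \<open>eta\<close> terms and the cleared
  log density are constant in the value at \<open>j\<close>.\<close>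

lemma site_fun_of_real:
  assumes F: "F \<in> input_laws A" and t: "0 \<le> t" "t \<le> A"
  shows "site_fun F n j (complex_of_real t) - site_fun F n j 0
    = complex_of_real (\<integral>x. score F n (x(j := t)) - score F n (x(j := 0)) \<partial>PiM UNIV (iid F))"
proof -
  note l = laws_iid[OF F]
  interpret X: prob_space "PiM UNIV (iid F)" by (rule prob_PX[OF l])
  interpret Y: prob_space nu by (rule prob_nu)
  interpret XY: pair_prob_space "PiM UNIV (iid F)" nu ..
  let ?T = "outs n" and ?J = "ln_jump (iid F) (outs n) j"
  define e where "e s x = (\<Sum>k\<in>?T \<inter> win j. eta (Z (x(j := s)) k))" for s x
  have Jg: "growth (win j) log_size 2 ?J" by (rule growth_ln_jump[OF l finite_outs])
  have Jd: "depends_on ?T ?J"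
  proof (rule depends_onI)
    fix y y' :: "int \<Rightarrow> nat" assume eq: "\<And>i. i \<in> ?T \<Longrightarrow> y i = y' i"
    then have "clr j y i = clr j y' i" if "i \<in> ?T" for i using that by (simp add: clr_def glue_def)
    then show "?J y = ?J y'"
      unfolding ln_jump_def using eq
      by (intro arg_cong2[where f=minus] arg_cong[where f=ln] depends_onD[OF depends_on_dens])
  qed
  have val: "site_fun F n j (complex_of_real s)
      = complex_of_real ((\<integral>x. e s x \<partial>PiM UNIV (iid F)) - (\<integral>x. \<integral>y. ?J y \<partial>K (x(j := s)) \<partial>PiM UNIV (iid F)))"
    and te: "tame (e s)"
    if s: "0 \<le> s" "s \<le> A" for s
  proof -
    show te: "tame (e s)" unfolding e_def by (rule tame_upd[OF tame_sum_eta s])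
    have "(\<lambda>x. x(j := s)) \<in> SX \<rightarrow>\<^sub>M SX"
    proof -
      have "(\<lambda>x. (x, s)) \<in> SX \<rightarrow>\<^sub>M SX \<Otimes>\<^sub>M input_space A"
        using s by (intro measurable_Pair) (auto simp: space_input_space)
      from measurable_compose[OF this measurable_fun_upd_input[of j]] show ?thesis by simp
    qed
    then have "(\<lambda>p. ((fst p)(j := s), snd p)) \<in> SX \<Otimes>\<^sub>M SY \<rightarrow>\<^sub>M SX \<Otimes>\<^sub>M SY"
      by (intro measurable_Pair measurable_compose[OF measurable_fst] measurable_snd)
    from measurable_compose[OF this measurable_lik[of ?T]]
    have lm: "(\<lambda>p. lik ?T ((fst p)(j := s)) (snd p)) \<in> borel_measurable (SX \<Otimes>\<^sub>M SY)" by simp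
    have "(1::real) \<le> 2" by simp
    note i = integrable_product_lik[OF l finite_outs finite_win this log_size_nonneg Jg Jd s lm]
    note ei = tame_integrable[OF te l]
    have ep: "integrable (PiM UNIV (iid F) \<Otimes>\<^sub>M nu) (\<lambda>p. e s (fst p))"
      "(\<integral>p. e s (fst p) \<partial>(PiM UNIV (iid F) \<Otimes>\<^sub>M nu)) = (\<integral>x. e s x \<partial>PiM UNIV (iid F))"
    proof -
      have m: "(\<lambda>p. e s (fst p)) \<in> borel_measurable (PiM UNIV (iid F) \<Otimes>\<^sub>M nu)"
        using tame_measurable[OF te l] by (intro measurable_compose[OF measurable_fst])
      show i: "integrable (PiM UNIV (iid F) \<Otimes>\<^sub>M nu) (\<lambda>p. e s (fst p))"
        by (rule XY.Fubini_integrable[OF m]) (use ei in \<open>simp_all add: Y.prob_space\<close>)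
      show "(\<integral>p. e s (fst p) \<partial>(PiM UNIV (iid F) \<Otimes>\<^sub>M nu)) = (\<integral>x. e s x \<partial>PiM UNIV (iid F))"
        using XY.integral_fst'[OF i] by (simp add: Y.prob_space)
    qed
    have "site_fun F n j (complex_of_real s)
        = (\<integral>p. complex_of_real (e s (fst p) - ?J (snd p) * lik ?T ((fst p)(j := s)) (snd p)) \<partial>(PiM UNIV (iid F) \<Otimes>\<^sub>M nu))"
      unfolding site_fun_def
    proof (rule Bochner_Integration.integral_cong[OF refl])
      fix p assume "p \<in> space (PiM UNIV (iid F) \<Otimes>\<^sub>M nu)"
      then have x: "fst p \<in> inputs" unfolding space_pair_measure space_PX[OF l] by (simp add: mem_Times_iff)
      show "site_integrand F n j (complex_of_real s) p
        = complex_of_real (e s (fst p) - ?J (snd p) * lik ?T ((fst p)(j := s)) (snd p))"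
        using Z_pos[OF inputs_upd[OF x s]]
        by (simp add: site_integrand_def e_def cZ_of_real clik_of_real ceta_of_real del: fun_upd_apply)
    qed
    also have "\<dots> = complex_of_real (\<integral>p. e s (fst p) - ?J (snd p) * lik ?T ((fst p)(j := s)) (snd p) \<partial>(PiM UNIV (iid F) \<Otimes>\<^sub>M nu))"
      by (rule integral_of_real[OF Bochner_Integration.integrable_diff[OF ep(1) i(1)]])
    also have "(\<integral>p. e s (fst p) - ?J (snd p) * lik ?T ((fst p)(j := s)) (snd p) \<partial>(PiM UNIV (iid F) \<Otimes>\<^sub>M nu))
        = (\<integral>x. e s x \<partial>PiM UNIV (iid F)) - (\<integral>x. \<integral>y. ?J y \<partial>K (x(j := s)) \<partial>PiM UNIV (iid F))"
      unfolding Bochner_Integration.integral_diff[OF ep(1) i(1)] ep(2) i(2) ..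
    finally show "site_fun F n j (complex_of_real s)
      = complex_of_real ((\<integral>x. e s x \<partial>PiM UNIV (iid F)) - (\<integral>x. \<integral>y. ?J y \<partial>K (x(j := s)) \<partial>PiM UNIV (iid F)))" .
  qed
  have tJ: "tame (\<lambda>x. \<integral>y. ?J y \<partial>K (x(j := s)))" if s: "0 \<le> s" "s \<le> A" for s
    using log_size_nonneg by (intro tame_upd[OF tame_output_average[OF Jg] s]) auto
  have diff: "score F n (x(j := t)) - score F n (x(j := 0))
      = (e t x - e 0 x) - ((\<integral>y. ?J y \<partial>K (x(j := t))) - (\<integral>y. ?J y \<partial>K (x(j := 0))))" if x: "x \<in> inputs" for x
  proof -
    have "(\<Sum>k\<in>?T. eta (Z (x(j := t)) k) - eta (Z (x(j := 0)) k)) = (\<Sum>k\<in>?T \<inter> win j. eta (Z (x(j := t)) k) - eta (Z (x(j := 0)) k))"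
      by (rule sum.mono_neutral_right) (auto simp: Z_upd_outside)
    then show ?thesis unfolding score_diff[OF F x t] e_def by (simp add: sum_subtractf)
  qed
  have "(\<integral>x. score F n (x(j := t)) - score F n (x(j := 0)) \<partial>PiM UNIV (iid F))
      = (\<integral>x. (e t x - e 0 x) - ((\<integral>y. ?J y \<partial>K (x(j := t))) - (\<integral>y. ?J y \<partial>K (x(j := 0)))) \<partial>PiM UNIV (iid F))"
    using space_PX[OF l] diff by (intro Bochner_Integration.integral_cong) auto
  also have "\<dots> = ((\<integral>x. e t x \<partial>PiM UNIV (iid F)) - (\<integral>x. e 0 x \<partial>PiM UNIV (iid F)))
      - ((\<integral>x. \<integral>y. ?J y \<partial>K (x(j := t)) \<partial>PiM UNIV (iid F)) - (\<integral>x. \<integral>y. ?J y \<partial>K (x(j := 0)) \<partial>PiM UNIV (iid F)))"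
    using tame_integrable[OF te[OF t] l] tame_integrable[OF te[OF order_refl A] l]
      tame_integrable[OF tJ[OF t] l] tame_integrable[OF tJ[OF order_refl A] l] by (simp del: fun_upd_apply)
  finally show ?thesis
    using val[OF t] val[OF order_refl A] by simp
qed

end

section \<open>One-sided derivatives from uniform expansions\<close>

text \<open>Dividing the expansion by \<open>e\<close> shows that \<open>v n\<close> is eventually
  within about \<open>e * C\<close> of the difference quotient \<open>w e\<close> of the limit,
  which does not involve \<open>n\<close>. Small \<open>e\<close> makes \<open>v\<close> Cauchy, and
  the same inequality in the limit of \<open>n\<close> identifies its limit as the
  derivative.\<close>

lemma right_derivative_of_expansions:
  fixes U :: "nat \<Rightarrow> real \<Rightarrow> real" and u :: "real \<Rightarrow> real" and v :: "nat \<Rightarrow> real"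
  assumes lim: "\<And>e. 0 \<le> e \<Longrightarrow> e \<le> 1 \<Longrightarrow> (\<lambda>n. U n e) \<longlonglongrightarrow> u e"
    and exp: "\<And>n e. n \<ge> 1 \<Longrightarrow> 0 \<le> e \<Longrightarrow> e \<le> 1 \<Longrightarrow> \<bar>U n e - U n 0 - e * v n\<bar> \<le> e\<^sup>2 * C"
  obtains d where "v \<longlonglongrightarrow> d" "(u has_real_derivative d) (at_right 0)"
proof -
  have C: "C \<ge> 0" using exp[of 1 1] by simp
  define w where "w e = (u e - u 0) / e" for e
  have near: "eventually (\<lambda>n. \<bar>v n - w e\<bar> < e * C + r) sequentially" if e: "0 < e" "e \<le> 1" and r: "r > 0" for e r
  proof -
    have "(\<lambda>n. (U n e - U n 0) / e) \<longlonglongrightarrow> w e"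
      unfolding w_def using e by (intro tendsto_intros lim) auto
    then have "eventually (\<lambda>n. \<bar>(U n e - U n 0) / e - w e\<bar> < r) sequentially"
      using r by (simp add: tendsto_iff dist_real_def)
    then show ?thesis using eventually_ge_at_top[of 1]
    proof eventually_elim
      fix n :: nat assume n: "n \<ge> 1" and a: "\<bar>(U n e - U n 0) / e - w e\<bar> < r"
      have "\<bar>(U n e - U n 0) / e - v n\<bar> = \<bar>U n e - U n 0 - e * v n\<bar> / e"
        using e by (simp add: abs_divide[symmetric] field_simps)
      also have "\<dots> \<le> e\<^sup>2 * C / e" using exp[OF n, of e] e by (intro divide_right_mono) auto
      also have "\<dots> = e * C" using e by (simp add: power2_eq_square)
      finally show "\<bar>v n - w e\<bar> < e * C + r" using a by linarith
    qed
  qed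
  have "Cauchy v"
  proof (rule metric_CauchyI)
    fix r :: real assume r: "r > 0"
    \<comment> \<open>Chosen so that \<open>e * C\<close> is at most \<open>r / 4\<close>; another
      \<open>r / 4\<close> is left for the convergence in \<open>n\<close>.\<close>
    define e where "e = min 1 (r / (4 * (C + 1)))"
    have e: "0 < e" "e \<le> 1" using r C by (auto simp: e_def)
    have "e * C \<le> r / (4 * (C + 1)) * (C + 1)" using C r by (intro mult_mono) (auto simp: e_def)
    also have "r / (4 * (C + 1)) * (C + 1) = r / 4"
    proof -
      have "C + 1 \<noteq> 0" using C by linarith
      then show ?thesis by (simp add: field_simps)
    qed
    finally have eC: "e * C \<le> r / 4" .
    from near[OF e, of "r / 4"] r obtain N where "\<And>n. n \<ge> N \<Longrightarrow> \<bar>v n - w e\<bar> < e * C + r / 4"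
      by (auto simp: eventually_sequentially)
    then have N: "\<And>n. n \<ge> N \<Longrightarrow> \<bar>v n - w e\<bar> < r / 2" using eC by force
    show "\<exists>M. \<forall>m\<ge>M. \<forall>n\<ge>M. dist (v m) (v n) < r"
    proof (intro exI allI impI)
      fix m n assume "m \<ge> N" "n \<ge> N"
      then show "dist (v m) (v n) < r" using N[of m] N[of n] unfolding dist_real_def by linarith
    qed
  qed
  then obtain d where d: "v \<longlonglongrightarrow> d" using Cauchy_convergent convergent_def by blast
  have wd: "\<bar>w e - d\<bar> \<le> e * C" if e: "0 < e" "e \<le> 1" for e
  proof (rule field_le_epsilon)
    fix r :: real assume r: "r > 0"
    have "(\<lambda>n. \<bar>v n - w e\<bar>) \<longlonglongrightarrow> \<bar>d - w e\<bar>" by (intro tendsto_intros d)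
    moreover have "eventually (\<lambda>n. \<bar>v n - w e\<bar> \<le> e * C + r) sequentially"
      using near[OF e r] by eventually_elim simp
    ultimately have "\<bar>d - w e\<bar> \<le> e * C + r" by (rule tendsto_upperbound) simp
    then show "\<bar>w e - d\<bar> \<le> e * C + r" by (simp add: abs_minus_commute)
  qed
  have "((\<lambda>e. w e - d) \<longlongrightarrow> 0) (at_right 0)"
  proof (rule Lim_null_comparison)
    show "eventually (\<lambda>e. norm (w e - d) \<le> e * C) (at_right 0)"
      using eventually_at_right_less[of 0] eventually_at_right_real[of 0 1]
      by (auto elim!: eventually_elim2 intro!: wd)
    have "((\<lambda>e. e * C) \<longlongrightarrow> 0 * C) (at_right 0)" by (intro tendsto_intros)
    then show "((\<lambda>e. e * C) \<longlongrightarrow> 0) (at_right 0)" by simp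
  qed
  then have "(w \<longlongrightarrow> d) (at_right 0)" by (rule LIM_zero_cancel)
  then have "(u has_real_derivative d) (at_right 0)"
    unfolding has_field_derivative_iff w_def by simp
  with d show thesis by (rule that)
qed

section \<open>The influence function and its holomorphic extension\<close>

context poisson_channel
begin

abbreviation info_rate :: "real measure \<Rightarrow> real" where
  "info_rate \<equiv> information_rate dark L h A"

lemma mixture_0:
  assumes "F \<in> input_laws A" "G \<in> input_laws A"
  shows "mixture 0 F G = F"
proof (rule measure_eqI)
  have S: "sets G = sets F" using assms[THEN input_lawsD(2)] by simp
  fix B assume "B \<in> sets (mixture 0 F G)"
  then show "emeasure (mixture 0 F G) B = emeasure F B" using S by (simp add: emeasure_mixture)
qed simp

lemma rate_derivative:
  assumes F: "F \<in> input_laws A" and G: "G \<in> input_laws A"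
  shows "(\<lambda>n. slope F G n / real n) \<longlonglongrightarrow> directional_derivative dark L h A F G"
    and "directionally_differentiable dark L h A F G"
proof -
  let ?u = "\<lambda>\<epsilon>. info_rate (mixture \<epsilon> F G)" and ?U = "\<lambda>n \<epsilon>. info (mixture \<epsilon> F G) n / real n"
  obtain d where d: "(\<lambda>n. slope F G n / real n) \<longlonglongrightarrow> d" "(?u has_real_derivative d) (at_right 0)"
  proof (rule right_derivative_of_expansions[of ?U ?u "\<lambda>n. slope F G n / real n" "real (L + 1) * curvature"])
    fix \<epsilon> :: real assume e: "0 \<le> \<epsilon>" "\<epsilon> \<le> 1"
    note H = mixture_in_input_laws[OF F G e]
    show "(\<lambda>n. ?U n \<epsilon>) \<longlonglongrightarrow> ?u \<epsilon>" unfolding information_rate_eq[OF H] by (rule info_rate_limit[OF H])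
    fix n :: nat assume n: "n \<ge> 1"
    have c: "curvature \<ge> 0"
      using pair_size_nonneg rho decay_nonneg[OF ratio_bound_nonneg] by (simp add: curvature_def ratio_decay_def)
    have "\<bar>?U n \<epsilon> - ?U n 0 - \<epsilon> * (slope F G n / real n)\<bar> = \<bar>info (mixture \<epsilon> F G) n - info F n - \<epsilon> * slope F G n\<bar> / real n"
      unfolding mixture_0[OF F G] times_divide_eq_right diff_divide_distrib[symmetric] abs_divide by simp
    also have "\<dots> \<le> \<epsilon>\<^sup>2 * real (n + L) * curvature / real n"
      by (intro divide_right_mono info_expansion F G e) simp
    also have "\<dots> = \<epsilon>\<^sup>2 * curvature * (real (n + L) / real n)" by simp
    \<comment> \<open>The \<open>L\<close> sites before the block cost at most a factor
      \<open>L + 1\<close> after normalization, as \<open>n\<close> is at least 1.\<close>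
    also have "\<dots> \<le> \<epsilon>\<^sup>2 * curvature * real (L + 1)"
    proof (intro mult_left_mono)
      have "real L \<le> real L * real n" using n by (simp add: mult_le_cancel_left1)
      then show "real (n + L) / real n \<le> real (L + 1)" using n by (simp add: field_simps)
    qed (use c in simp)
    finally show "\<bar>?U n \<epsilon> - ?U n 0 - \<epsilon> * (slope F G n / real n)\<bar> \<le> \<epsilon>\<^sup>2 * (real (L + 1) * curvature)"
      by (simp add: ac_simps)
  qed
  have v: "(?u has_vector_derivative d) (at_right 0)"
    using d(2) by (simp add: has_real_derivative_iff_has_vector_derivative)
  then have "directional_derivative dark L h A F G = d"
    unfolding directional_derivative_def by (intro vector_derivative_within) auto
  then show "(\<lambda>n. slope F G n / real n) \<longlonglongrightarrow> directional_derivative dark L h A F G" using d(1) by simp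
  show "directionally_differentiable dark L h A F G"
    unfolding directionally_differentiable_def using v
    by (auto simp: has_vector_derivative_def differentiable_def)
qed

definition site_average :: "real measure \<Rightarrow> nat \<Rightarrow> int \<Rightarrow> real \<Rightarrow> real" where
  "site_average F n j t = (\<integral>x. score F n (x(j := t)) \<partial>PiM UNIV (iid F))"

text \<open>The value of \<open>slope\<close> at the point mass at \<open>t\<close>, as a function
  of \<open>t\<close> that can be integrated against any law.\<close>

definition point_slope :: "real measure \<Rightarrow> nat \<Rightarrow> real \<Rightarrow> real" where
  "point_slope F n t = (\<Sum>j\<in>sites n. site_average F n j t - info F n)"

lemma measurable_site_average:
  assumes F: "F \<in> input_laws A"
  shows "site_average F n j \<in> borel_measurable (input_space A)"
proof -
  interpret X: prob_space "PiM UNIV (iid F)" by (rule prob_PX[OF laws_iid[OF F]])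
  have "(\<lambda>p. score F n ((snd p)(j := fst p))) \<in> borel_measurable (input_space A \<Otimes>\<^sub>M SX)"
    using measurable_compose[OF measurable_pair_swap' tame_joint_measurable[OF tame_score[OF F, of n], of j]]
    by (simp add: split_beta')
  moreover have "sets (input_space A \<Otimes>\<^sub>M PiM UNIV (iid F)) = sets (input_space A \<Otimes>\<^sub>M SX)"
    using sets_PX[OF laws_iid[OF F]] by (intro sets_pair_measure_cong) auto
  ultimately have "(\<lambda>(t, x). score F n (x(j := t))) \<in> borel_measurable (input_space A \<Otimes>\<^sub>M PiM UNIV (iid F))"
    by (simp add: split_beta' cong: measurable_cong_sets)
  then show ?thesis unfolding site_average_def by (rule X.borel_measurable_lebesgue_integral)
qed

lemma site_average_diff:
  assumes F: "F \<in> input_laws A" and t: "0 \<le> t" "t \<le> A"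
  shows "site_average F n j t - site_average F n j 0
    = (\<integral>x. score F n (x(j := t)) - score F n (x(j := 0)) \<partial>PiM UNIV (iid F))"
  unfolding site_average_def
  using tame_integrable[OF tame_upd[OF tame_score[OF F] t] laws_iid[OF F]]
    tame_integrable[OF tame_upd[OF tame_score[OF F] order_refl A] laws_iid[OF F]] by simp

lemma site_average_close:
  assumes F: "F \<in> input_laws A" and t: "0 \<le> t" "t \<le> A"
  shows "\<bar>site_average F n j t - site_average F n j 0\<bar> \<le> step_size"
  unfolding site_average_diff[OF assms]
proof (rule tame_integral_bound[OF _ laws_iid[OF F]])
  show "tame (\<lambda>x. score F n (x(j := t)) - score F n (x(j := 0)))"
    using tame_score[OF F] t A by (intro tame_diff tame_upd) auto
  show "\<bar>score F n (x(j := t)) - score F n (x(j := 0))\<bar> \<le> step_size" if "x \<in> inputs" for x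
    by (rule score_step[OF F that t])
qed

lemma site_average_integral:
  assumes F: "F \<in> input_laws A" and G: "G \<in> input_laws A"
  shows "integrable G (site_average F n j)"
    and "(\<integral>t. site_average F n j t \<partial>G) = (\<integral>x. score F n x \<partial>PiM UNIV ((iid F)(j := G)))"
proof -
  show "integrable G (site_average F n j)"
    by (rule input_average_close(1)[OF G measurable_site_average[OF F]]) (rule site_average_close[OF F])
  show "(\<integral>t. site_average F n j t \<partial>G) = (\<integral>x. score F n x \<partial>PiM UNIV ((iid F)(j := G)))"
    unfolding site_average_def integral_upd_swap[OF tame_score[OF F] laws_iid[OF F] G] ..
qed

lemma slope_eq_integral:
  assumes F: "F \<in> input_laws A" and G: "G \<in> input_laws A"
  shows "slope F G n = (\<integral>t. point_slope F n t \<partial>G)"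
proof -
  interpret prob_space G by (rule input_lawsD[OF G])
  have "(\<integral>t. point_slope F n t \<partial>G) = (\<Sum>j\<in>sites n. \<integral>t. site_average F n j t - info F n \<partial>G)"
    unfolding point_slope_def using site_average_integral(1)[OF F G] by (intro Bochner_Integration.integral_sum) auto
  also have "\<dots> = slope F G n"
    unfolding slope_def using site_average_integral[OF F G] prob_space by simp
  finally show ?thesis ..
qed

lemma measurable_point_slope:
  assumes "F \<in> input_laws A"
  shows "point_slope F n \<in> borel_measurable (input_space A)"
  unfolding point_slope_def using measurable_site_average[OF assms] by measurable

text \<open>\<open>info\<close> is the mean of \<open>site_average\<close> under \<open>F\<close>,
  and no value of the latter is further than \<open>step_size\<close> from the one at zero.\<close>

lemma site_average_info:
  assumes F: "F \<in> input_laws A"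
  shows "\<bar>site_average F n j 0 - info F n\<bar> \<le> step_size"
proof -
  have "(iid F)(j := F) = iid F" by auto
  then have "(\<integral>t. site_average F n j t \<partial>F) = info F n"
    using site_average_integral(2)[OF F F, of n j] by (simp add: info_def)
  then show ?thesis
    using input_average_close(2)[OF F measurable_site_average[OF F] site_average_close[OF F], of n j]
    by (simp add: abs_minus_commute)
qed

lemma point_slope_bound:
  assumes F: "F \<in> input_laws A" and t: "0 \<le> t" "t \<le> A"
  shows "\<bar>point_slope F n t / real n\<bar> \<le> real (L + 1) * (2 * step_size)"
proof (cases "n = 0")
  case False
  have "\<bar>point_slope F n t\<bar> \<le> (\<Sum>j\<in>sites n. 2 * step_size)"
    unfolding point_slope_def
  proof (intro order_trans[OF sum_abs] sum_mono)
    fix j show "\<bar>site_average F n j t - info F n\<bar> \<le> 2 * step_size"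
      using site_average_info[OF F, of n j] site_average_close[OF F t, of n j] by linarith
  qed
  then have "\<bar>point_slope F n t / real n\<bar> \<le> real (n + L) * (2 * step_size) / real n"
    unfolding abs_divide by (simp add: divide_right_mono)
  also have "\<dots> = (real (n + L) / real n) * (2 * step_size)" by simp
  also have "\<dots> \<le> real (L + 1) * (2 * step_size)"
  proof (intro mult_right_mono)
    have "real L \<le> real L * real n" using False by (simp add: mult_le_cancel_left1)
    then show "real (n + L) / real n \<le> real (L + 1)" using False by (simp add: field_simps)
  qed (use step_size_nonneg in simp)
  finally show ?thesis .
qed (use step_size_nonneg in simp)

abbreviation psi :: "real measure \<Rightarrow> real \<Rightarrow> real" where "psi \<equiv> influence dark L h A"

lemma psi_limit:
  assumes F: "F \<in> input_laws A" and t: "0 \<le> t" "t \<le> A"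
  shows "(\<lambda>n. point_slope F n t / real n) \<longlonglongrightarrow> psi F t"
proof -
  have G: "point_mass A t \<in> input_laws A" using t by (intro point_mass_in_input_laws) simp
  have "slope F (point_mass A t) n = point_slope F n t" for n
    unfolding slope_eq_integral[OF F G] unfolding point_mass_def
    using t by (intro integral_return measurable_point_slope F) (simp add: space_input_space)
  then show ?thesis using rate_derivative(1)[OF F G] by (simp add: influence_def)
qed

text \<open>For fixed \<open>n\<close> the slope is the integral of \<open>point_slope\<close>; the
  uniform bound on the normalized point slopes lets the limit pass under the integral.\<close>

lemma psi_integral:
  assumes F: "F \<in> input_laws A" and G: "G \<in> input_laws A"
  shows "directional_derivative dark L h A F G = (\<integral>t. psi F t \<partial>G)"
proof (rule LIMSEQ_unique[OF rate_derivative(1)[OF F G]])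
  note GD = input_lawsD[OF G]
  interpret prob_space G by (rule GD)
  have m: "(\<lambda>t. point_slope F n t / real n) \<in> borel_measurable G" for n
    using measurable_point_slope[OF F, of n] GD(2) by (simp cong: measurable_cong_sets)
  have l: "(\<lambda>n. point_slope F n t / real n) \<longlonglongrightarrow> psi F t" if "t \<in> space G" for t
    using psi_limit[OF F] that GD(3) by simp
  have "(\<lambda>n. \<integral>t. point_slope F n t / real n \<partial>G) \<longlonglongrightarrow> (\<integral>t. psi F t \<partial>G)"
  proof (rule integral_dominated_convergence)
    show "psi F \<in> borel_measurable G" by (rule borel_measurable_LIMSEQ_real[OF l m])
    show "integrable G (\<lambda>_. real (L + 1) * (2 * step_size))" by simp
    show "AE t in G. norm (point_slope F n t / real n) \<le> real (L + 1) * (2 * step_size)" for n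
      using point_slope_bound[OF F] GD(3) by (intro AE_I2) auto
  qed (use m l in auto)
  then show "(\<lambda>n. slope F G n / real n) \<longlonglongrightarrow> (\<integral>t. psi F t \<partial>G)"
    by (simp add: slope_eq_integral[OF F G])
qed

text \<open>Moving from \<open>F\<close> towards \<open>F\<close> has slope zero. The subtracted
  integral in the derivative formula is therefore zero.\<close>

lemma psi_mean_zero:
  assumes F: "F \<in> input_laws A"
  shows "(\<integral>t. psi F t \<partial>F) = 0"
proof -
  have "(iid F)(j := F) = iid F" for j by auto
  then have "slope F F n = 0" for n by (simp add: slope_def info_def)
  then have "(\<lambda>n. 0 :: real) \<longlonglongrightarrow> (\<integral>t. psi F t \<partial>F)"
    using rate_derivative(1)[OF F F] psi_integral[OF F F] by simp
  then show ?thesis using LIMSEQ_unique tendsto_const by blast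
qed

text \<open>As \<open>site_fun\<close> is correct only up to a constant, its value at zero is
  subtracted and the real value there is put back.\<close>

definition cslope :: "real measure \<Rightarrow> nat \<Rightarrow> complex \<Rightarrow> complex" where
  "cslope F n z = (\<Sum>j\<in>sites n. site_fun F n j z - site_fun F n j 0 + complex_of_real (site_average F n j 0 - info F n)) / of_nat n"

lemma cslope_of_real:
  assumes F: "F \<in> input_laws A" and t: "0 \<le> t" "t \<le> A"
  shows "cslope F n (complex_of_real t) = complex_of_real (point_slope F n t / real n)"
  unfolding cslope_def point_slope_def site_fun_of_real[OF assms] site_average_diff[OF assms, symmetric]
  by simp

lemma cslope_holomorphic:
  assumes F: "F \<in> input_laws A"
  shows "cslope F n holomorphic_on domain"
proof -
  have "(\<lambda>z. (\<Sum>j\<in>sites n. site_fun F n j z - site_fun F n j 0 + complex_of_real (site_average F n j 0 - info F n)) * (1 / of_nat n)) holomorphic_on domain"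
    by (intro holomorphic_intros site_fun_holomorphic[OF F])
  then show ?thesis by (simp add: cslope_def[abs_def])
qed

text \<open>The bound depends on \<open>R\<close> but not on the block length: the hypothesis of
  Montel's theorem on compact sets. Lengths start at one so that the ratio of sites to outputs is at
  most \<open>L + 1\<close>.\<close>

lemma cslope_bound:
  assumes F: "F \<in> input_laws A" and z: "z \<in> domain" "norm z \<le> R"
  shows "norm (cslope F (Suc n) z) \<le> real (L + 1) * (2 * site_bound R + step_size)"
proof -
  let ?n = "Suc n" and ?c = "2 * site_bound R + step_size"
  have R: "R \<ge> 0" using norm_ge_zero z(2) by (rule order_trans)
  have z0: "0 \<in> domain" using real_in_domain[of 0] by simp
  have "norm (\<Sum>j\<in>sites ?n. site_fun F ?n j z - site_fun F ?n j 0 + complex_of_real (site_average F ?n j 0 - info F ?n)) \<le> (\<Sum>j\<in>sites ?n. ?c)"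
  proof (intro order_trans[OF norm_sum] sum_mono)
    fix j
    have "norm (site_fun F ?n j z - site_fun F ?n j 0 + complex_of_real (site_average F ?n j 0 - info F ?n))
        \<le> norm (site_fun F ?n j z) + norm (site_fun F ?n j 0) + norm (complex_of_real (site_average F ?n j 0 - info F ?n))"
      by (intro order_trans[OF norm_triangle_ineq] add_right_mono norm_triangle_ineq4)
    also have "\<dots> \<le> site_bound R + site_bound R + step_size"
      using site_average_info[OF F, of ?n j] R
      by (intro add_mono site_fun_bound[OF F] z z0) (simp_all only: norm_of_real norm_zero)
    finally show "norm (site_fun F ?n j z - site_fun F ?n j 0 + complex_of_real (site_average F ?n j 0 - info F ?n)) \<le> ?c" by simp
  qed
  then have "norm (cslope F ?n z) \<le> real (?n + L) * ?c / real ?n"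
    unfolding cslope_def norm_divide norm_of_nat by (simp add: divide_right_mono del: of_nat_Suc of_nat_add)
  also have "\<dots> = (real (?n + L) / real ?n) * ?c" by simp
  also have "\<dots> \<le> real (L + 1) * ?c"
  proof (intro mult_right_mono)
    show "real (?n + L) / real ?n \<le> real (L + 1)" by (simp add: field_simps)
    have "0 \<le> site_bound R" using norm_ge_zero site_fun_bound[OF F z] by (rule order_trans)
    then show "0 \<le> ?c" using step_size_nonneg by simp
  qed
  finally show ?thesis .
qed

text \<open>A subsequence suffices: on the interval the full sequence already converges to the
  influence, so every subsequential limit has the right values there.\<close>

lemma psi_extension:
  assumes F: "F \<in> input_laws A"
  obtains \<Psi> where "\<Psi> holomorphic_on domain"
    "\<And>t. 0 \<le> t \<Longrightarrow> t \<le> A \<Longrightarrow> \<Psi> (complex_of_real t) = complex_of_real (psi F t)"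
proof -
  have bd: "\<exists>B. \<forall>g\<in>range (\<lambda>n. cslope F (Suc n)). \<forall>z\<in>C. norm (g z) \<le> B" if C: "compact C" "C \<subseteq> domain" for C
  proof -
    obtain R where "\<forall>z\<in>C. norm z \<le> R" using compact_imp_bounded[OF C(1)] bounded_iff by blast
    then show ?thesis using cslope_bound[OF F] C(2) by (intro exI[of _ "real (L + 1) * (2 * site_bound R + step_size)"]) blast
  qed
  have hol: "g holomorphic_on domain" if "g \<in> range (\<lambda>n. cslope F (Suc n))" for g
    using that cslope_holomorphic[OF F] by auto
  obtain \<Psi> r where \<Psi>: "\<Psi> holomorphic_on domain" and r: "strict_mono (r :: nat \<Rightarrow> nat)"
    and lim: "\<And>z. z \<in> domain \<Longrightarrow> (\<lambda>n. cslope F (Suc (r n)) z) \<longlonglongrightarrow> \<Psi> z"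
    using Montel[OF open_domain hol bd subset_refl] by metis
  have "\<Psi> (complex_of_real t) = complex_of_real (psi F t)" if t: "0 \<le> t" "t \<le> A" for t
  proof (rule LIMSEQ_unique[OF lim[OF real_in_domain[OF t(1)]]])
    have "(\<lambda>n. point_slope F (Suc n) t / real (Suc n)) \<longlonglongrightarrow> psi F t"
      by (rule LIMSEQ_Suc[OF psi_limit[OF F t]])
    from LIMSEQ_subseq_LIMSEQ[OF this r]
    show "(\<lambda>n. cslope F (Suc (r n)) (complex_of_real t)) \<longlonglongrightarrow> complex_of_real (psi F t)"
      unfolding cslope_of_real[OF F t] comp_def by (rule tendsto_of_real)
  qed
  with \<Psi> show thesis by (rule that)
qed

end

theorem lemma5:
  fixes L :: nat and dark A Pavg :: real and h :: "nat \<Rightarrow> real" and F :: "real measure"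
  assumes "dark > 0"
    and "h 0 > 0" and "\<forall>l\<le>L. h l \<ge> 0" and "(\<Sum>l\<le>L. h l) = 1"
    and "A \<ge> 0" and "Pavg \<ge> 0"
    and "F \<in> constrained_laws A Pavg"
  shows "(\<forall>x\<in>{0..A}. directionally_differentiable dark L h A F (point_mass A x)) \<and>
    continuous_on {0..A} (influence dark L h A F) \<and>
    (\<exists>\<Psi> :: complex \<Rightarrow> complex.
       \<Psi> holomorphic_on {z. Re z > - dark / max_tap L h} \<and>
       (\<forall>x\<in>{0..A}. \<Psi> (complex_of_real x) = complex_of_real (influence dark L h A F x))) \<and>
    (\<forall>G\<in>constrained_laws A Pavg.
       directionally_differentiable dark L h A F G \<and>
       directional_derivative dark L h A F G =
         (\<integral>x. influence dark L h A F x \<partial>G) - (\<integral>x. influence dark L h A F x \<partial>F))"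
proof -
  interpret poisson_channel dark L h A
    using assms by unfold_locales auto
  have F: "F \<in> input_laws A" using assms by (simp add: constrained_laws_def)
  obtain \<Psi> where \<Psi>: "\<Psi> holomorphic_on domain"
    and eq: "\<And>t. 0 \<le> t \<Longrightarrow> t \<le> A \<Longrightarrow> \<Psi> (complex_of_real t) = complex_of_real (psi F t)"
    by (rule psi_extension[OF F]) blast
  \<comment> \<open>On the interval the influence is the real part of its holomorphic extension, and
    continuity is inherited from it.\<close>
  have "continuous_on {0..A} (\<lambda>t. Re (\<Psi> (complex_of_real t)))"
    by (intro continuous_intros continuous_on_compose2[OF holomorphic_on_imp_continuous_on[OF \<Psi>]])
      (auto intro: real_in_domain)
  then have "continuous_on {0..A} (psi F)"
    by (rule continuous_on_cong[THEN iffD1, OF refl, rotated]) (simp add: eq)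
  moreover have "directionally_differentiable dark L h A F (point_mass A x)" if "x \<in> {0..A}" for x
    by (rule rate_derivative(2)[OF F point_mass_in_input_laws[OF that]])
  moreover have "directionally_differentiable dark L h A F G \<and>
      directional_derivative dark L h A F G = (\<integral>x. psi F x \<partial>G) - (\<integral>x. psi F x \<partial>F)"
    if "G \<in> constrained_laws A Pavg" for G
  proof -
    have G: "G \<in> input_laws A" using that by (simp add: constrained_laws_def)
    show ?thesis using rate_derivative(2)[OF F G] psi_integral[OF F G] psi_mean_zero[OF F] by simp
  qed
  ultimately show ?thesis using \<Psi> eq unfolding domain_def by auto
qed

end
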